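(* Let $(W,S)$, $S=\{s_1,\dots,s_n\}$, be a right-angled Coxeter system with free generators $\{s_1,\dots,s_j\}$, where $j\ge2$. Let $p_1,\dots,p_n\ge2$ be integers and let $\Sigma$ be the unique regular right-angled building of type $(W,S)$ with $p_i$ chambers in each $s_i$-equivalence class, for all $i\in\{1,\dots,n\}$. Let $p<\max_{1\le i\le j}\{p_i\}$ be prime. Then for any $\alpha\in\mathbb N$ there exists a uniform lattice $\Gamma$ in $\mathrm{Aut}(\Sigma)$ with covolume $\mu(\Gamma\backslash\mathrm{Aut}(\Sigma))=a/b$ (in lowest terms, i.e. with $a,b$ coprime positive integers) such that $b$ is divisible by $p^{\alpha}$.
   Context: **Coxeter systems.** A Coxeter system $(W,S)$ of rank $n$ consists of $S=\{s_1,\dots,s_n\}$ and $W=\langle s_1,\dots,s_n\mid (s_is_j)^{m_{ij}}=1\ \forall i,j\rangle$, where $(m_{ij})$ is symmetric with $m_{ii}=1$ and $m_{ij}\in\{2,3,\dots\}\cup\{\infty\}$ for $i\ne j$ ($\infty$ means infinite order). It is right-angled if $m_{ij}\in\{2,\infty\}$ for all $i\neq j$. A generator $s_k$ is free if $m_{ik}=\infty$ for all $i\ne k$. For $T\subseteq S$, $W_T=\langle T\rangle$ ($W_\varnothing$ trivial); $T$ is spherical if $W_T$ is finite. **Chamber.** $K$ is the geometric realisation of the poset (under inclusion) of all spherical subsets of $S$, including $\varnothing$; its vertices are labelled by spherical subsets. The mirror $K_{s_i}$ is the union of all closed simplices of $K$ containing the vertex $\{s_i\}$ but not the vertex $\varnothing$.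 **Building.** For a right-angled $(W,S)$ and integers $p_i\ge2$ there is, up to isomorphism, a unique building of type $(W,S)$ such that each $s_i$-equivalence class (the class of the relation on chambers given by being equal or $s_i$-adjacent) contains exactly $p_i$ chambers; this is the regular right-angled building with these parameters. With $\mathcal C$ its set of chambers and $\delta:\mathcal C\times\mathcal C\to W$ its Weyl distance, $\Sigma$ denotes its Davis geometric realisation $(\mathcal C\times K)/\sim$, where $(c,k)\sim(c',k')$ iff $k=k'$ and $\delta(c,c')\in W_{\{s_i\,\mid\,k\in K_{s_i}\}}$. It is a union of copies of the Davis complex of $(W,S)$ (its apartments). It is a polyhedral complex whose cells are the images of simplices of the copies of $K$ (so its vertices are of all types, including $\varnothing$), equipped with the standard piecewise Euclidean complete $\mathrm{CAT}(0)$ metric restricting to Moussong's metric on each apartment: for each spherical $T$ and each coset $wW_T$ of an apartment, the simplices corresponding to chains of cosets contained in $wW_T$ form a Euclidean cube of dimension $|T|$ (the Coxeter polytope of $W_T\cong(\mathbb Z/2)^{|T|}$), all cubes having the same edge length. **Automorphism group and covolumes.** $G=\mathrm{Aut}(\Sigma)$ is the group of polyhedral (cell-preserving) isometries of $\Sigma$, a locally compact group under the compact-open topology. A lattice in $G$ is a discrete subgroup $\Gamma$ such that $\Gamma\backslash G$ admits a finite $G$-invariant measure; it is uniform if $\Gamma\backslash G$ is compact. The Haar measure $\mu$ on $G$ is normalised (Serre) so that for every discrete subgroup $\Gamma$, $\mu(\Gamma\backslash G)=\sum_{v\in\Gamma\backslash V}1/|\Gamma_{v'}|$, where $V$ is the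 vertex set of $\Sigma$, $v'\in V$ is any representative of the orbit $v$, and $\Gamma_{v'}$ is its stabiliser. Covolumes of uniform lattices are therefore positive rationals. *)

theory Defs
  imports "HOL-Analysis.Analysis" "HOL-Library.Extended_Nat"
    "HOL-Algebra.Generated_Groups" "HOL-Algebra.Coset" "HOL-Algebra.Bij" "HOL-Algebra.Group_Action"
begin

section \<open>Coxeter systems\<close>

text \<open>Generators are indexed by \<open>{1..n}\<close>; words are lists of indices and subsets of \<open>S\<close> are
  given as subsets of \<open>{1..n}\<close> (in a Coxeter system \<open>s\<close> is injective on \<open>{1..n}\<close>).\<close>

definition coxeter_matrix :: "nat \<Rightarrow> (nat \<Rightarrow> nat \<Rightarrow> enat) \<Rightarrow> bool" where
  "coxeter_matrix n m \<longleftrightarrow>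
     (\<forall>i\<in>{1..n}. m i i = 1) \<and>
     (\<forall>i\<in>{1..n}. \<forall>j\<in>{1..n}. m i j = m j i \<and> (i \<noteq> j \<longrightarrow> 2 \<le> m i j))"

definition word_value :: "('w, 'x) monoid_scheme \<Rightarrow> (nat \<Rightarrow> 'w) \<Rightarrow> nat list \<Rightarrow> 'w" where
  "word_value W s u = foldr (\<lambda>i w. s i \<otimes>\<^bsub>W\<^esub> w) u \<one>\<^bsub>W\<^esub>"

text \<open>The congruence on words generated by the Coxeter relations. Since the relations
  \<open>s\<^sub>i s\<^sub>i = 1\<close> are among them, the monoid presented in this way is the group with the same
  presentation. There is no relation for a pair with \<open>m i j = \<infinity>\<close>.\<close>

inductive coxeter_cong :: "nat \<Rightarrow> (nat \<Rightarrow> nat \<Rightarrow> enat) \<Rightarrow> nat list \<Rightarrow> nat list \<Rightarrow> bool"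
  for n m where
  relation: "\<lbrakk>i \<in> {1..n}; j \<in> {1..n}; m i j = enat k\<rbrakk>
     \<Longrightarrow> coxeter_cong n m (concat (replicate k [i, j])) []"
| refl: "coxeter_cong n m u u"
| sym: "coxeter_cong n m u v \<Longrightarrow> coxeter_cong n m v u"
| trans: "\<lbrakk>coxeter_cong n m u v; coxeter_cong n m v w\<rbrakk> \<Longrightarrow> coxeter_cong n m u w"
| append: "\<lbrakk>coxeter_cong n m u v; coxeter_cong n m u' v'\<rbrakk>
     \<Longrightarrow> coxeter_cong n m (u @ u') (v @ v')"

definition coxeter_system ::
  "('w, 'x) monoid_scheme \<Rightarrow> (nat \<Rightarrow> 'w) \<Rightarrow> nat \<Rightarrow> (nat \<Rightarrow> nat \<Rightarrow> enat) \<Rightarrow> bool" where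
  "coxeter_system W s n m \<longleftrightarrow>
     group W \<and> coxeter_matrix n m \<and>
     s ` {1..n} \<subseteq> carrier W \<and> generate W (s ` {1..n}) = carrier W \<and>
     (\<forall>u\<in>lists {1..n}. \<forall>v\<in>lists {1..n}.
        word_value W s u = word_value W s v \<longleftrightarrow> coxeter_cong n m u v)"

definition right_angled :: "nat \<Rightarrow> (nat \<Rightarrow> nat \<Rightarrow> enat) \<Rightarrow> bool" where
  "right_angled n m \<longleftrightarrow> (\<forall>i\<in>{1..n}. \<forall>j\<in>{1..n}. i \<noteq> j \<longrightarrow> m i j \<in> {2, \<infinity>})"

definition free_generator :: "nat \<Rightarrow> (nat \<Rightarrow> nat \<Rightarrow> enat) \<Rightarrow> nat \<Rightarrow> bool" where
  "free_generator n m k \<longleftrightarrow> k \<in> {1..n} \<and> (\<forall>i\<in>{1..n}. i \<noteq> k \<longrightarrow> m i k = \<infinity>)"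

definition special_subgroup ::
  "('w, 'x) monoid_scheme \<Rightarrow> (nat \<Rightarrow> 'w) \<Rightarrow> nat set \<Rightarrow> 'w set" where
  "special_subgroup W s T = generate W (s ` T)"

definition spherical_subsets ::
  "('w, 'x) monoid_scheme \<Rightarrow> (nat \<Rightarrow> 'w) \<Rightarrow> nat \<Rightarrow> nat set set" where
  "spherical_subsets W s n = {T. T \<subseteq> {1..n} \<and> finite (special_subgroup W s T)}"

definition word_length ::
  "('w, 'x) monoid_scheme \<Rightarrow> (nat \<Rightarrow> 'w) \<Rightarrow> nat \<Rightarrow> 'w \<Rightarrow> nat" where
  "word_length W s n w = (LEAST k. \<exists>u\<in>lists {1..n}. length u = k \<and> word_value W s u = w)"


section \<open>Buildings\<close>

text \<open>Buildings as chamber sets with a Weyl distance, in the sense of Tits (see Abramenko and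
  Brown, \<^emph>\<open>Buildings\<close>, Definition 5.1).\<close>

definition building ::
  "('w, 'x) monoid_scheme \<Rightarrow> (nat \<Rightarrow> 'w) \<Rightarrow> nat \<Rightarrow> 'c set \<Rightarrow> ('c \<Rightarrow> 'c \<Rightarrow> 'w) \<Rightarrow> bool" where
  "building W s n C \<delta> \<longleftrightarrow>
     C \<noteq> {} \<and>
     (\<forall>c\<in>C. \<forall>d\<in>C. \<delta> c d \<in> carrier W) \<and>
     (\<forall>c\<in>C. \<forall>d\<in>C. \<delta> c d = \<one>\<^bsub>W\<^esub> \<longleftrightarrow> c = d) \<and>
     (\<forall>c\<in>C. \<forall>d\<in>C. \<forall>c'\<in>C. \<forall>i\<in>{1..n}. \<delta> c' c = s i \<longrightarrow>
        \<delta> c' d \<in> {s i \<otimes>\<^bsub>W\<^esub> \<delta> c d, \<delta> c d} \<and>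
        (word_length W s n (s i \<otimes>\<^bsub>W\<^esub> \<delta> c d) = word_length W s n (\<delta> c d) + 1 \<longrightarrow>
           \<delta> c' d = s i \<otimes>\<^bsub>W\<^esub> \<delta> c d)) \<and>
     (\<forall>c\<in>C. \<forall>d\<in>C. \<forall>i\<in>{1..n}. \<exists>c'\<in>C. \<delta> c' c = s i \<and> \<delta> c' d = s i \<otimes>\<^bsub>W\<^esub> \<delta> c d)"

definition regular_building ::
  "('w, 'x) monoid_scheme \<Rightarrow> (nat \<Rightarrow> 'w) \<Rightarrow> nat \<Rightarrow> (nat \<Rightarrow> nat) \<Rightarrow> 'c set \<Rightarrow> ('c \<Rightarrow> 'c \<Rightarrow> 'w) \<Rightarrow> bool"
  where
  "regular_building W s n q C \<delta> \<longleftrightarrow>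
     building W s n C \<delta> \<and>
     (\<forall>i\<in>{1..n}. \<forall>c\<in>C.
        finite {d\<in>C. d = c \<or> \<delta> c d = s i} \<and> card {d\<in>C. d = c \<or> \<delta> c d = s i} = q i)"


section \<open>The chamber\<close>

text \<open>Points of the realisation of a poset of sets are given by their barycentric coordinates.\<close>

definition bary_support :: "('v \<Rightarrow> real) \<Rightarrow> 'v set" where
  "bary_support k = {T. k T \<noteq> 0}"

definition poset_simplices :: "'a set set \<Rightarrow> 'a set set set" where
  "poset_simplices P =
     {\<sigma>. \<sigma> \<subseteq> P \<and> finite \<sigma> \<and> \<sigma> \<noteq> {} \<and> (\<forall>T\<in>\<sigma>. \<forall>U\<in>\<sigma>. T \<subseteq> U \<or> U \<subseteq> T)}"

definition closed_simplex :: "'v set \<Rightarrow> ('v \<Rightarrow> real) set" where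
  "closed_simplex \<sigma> = {k. bary_support k \<subseteq> \<sigma> \<and> (\<forall>T. 0 \<le> k T) \<and> (\<Sum>T\<in>\<sigma>. k T) = 1}"

definition bary_vertex :: "'v \<Rightarrow> 'v \<Rightarrow> real" where
  "bary_vertex T = (\<lambda>U. if U = T then 1 else 0)"

definition chamber_simplices ::
  "('w, 'x) monoid_scheme \<Rightarrow> (nat \<Rightarrow> 'w) \<Rightarrow> nat \<Rightarrow> nat set set set" where
  "chamber_simplices W s n = poset_simplices (spherical_subsets W s n)"

definition chamber ::
  "('w, 'x) monoid_scheme \<Rightarrow> (nat \<Rightarrow> 'w) \<Rightarrow> nat \<Rightarrow> (nat set \<Rightarrow> real) set" where
  "chamber W s n = \<Union> (closed_simplex ` chamber_simplices W s n)"

definition mirror ::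
  "('w, 'x) monoid_scheme \<Rightarrow> (nat \<Rightarrow> 'w) \<Rightarrow> nat \<Rightarrow> nat \<Rightarrow> (nat set \<Rightarrow> real) set" where
  "mirror W s n i =
     \<Union> (closed_simplex ` {\<sigma> \<in> chamber_simplices W s n. {i} \<in> \<sigma> \<and> {} \<notin> \<sigma>})"


section \<open>The Davis realisation\<close>

type_synonym 'c davis_point = "('c \<times> (nat set \<Rightarrow> real)) set"

definition davis_rel ::
  "('w, 'x) monoid_scheme \<Rightarrow> (nat \<Rightarrow> 'w) \<Rightarrow> nat \<Rightarrow> 'c set \<Rightarrow> ('c \<Rightarrow> 'c \<Rightarrow> 'w) \<Rightarrow>
   (('c \<times> (nat set \<Rightarrow> real)) \<times> ('c \<times> (nat set \<Rightarrow> real))) set" where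
  "davis_rel W s n C \<delta> =
     {((c, k), (c', k')). c \<in> C \<and> c' \<in> C \<and> k \<in> chamber W s n \<and> k = k' \<and>
        \<delta> c c' \<in> special_subgroup W s {i\<in>{1..n}. k \<in> mirror W s n i}}"

definition davis_realization ::
  "('w, 'x) monoid_scheme \<Rightarrow> (nat \<Rightarrow> 'w) \<Rightarrow> nat \<Rightarrow> 'c set \<Rightarrow> ('c \<Rightarrow> 'c \<Rightarrow> 'w) \<Rightarrow> 'c davis_point set"
  where
  "davis_realization W s n C \<delta> = (C \<times> chamber W s n) // davis_rel W s n C \<delta>"

definition davis_class ::
  "('w, 'x) monoid_scheme \<Rightarrow> (nat \<Rightarrow> 'w) \<Rightarrow> nat \<Rightarrow> 'c set \<Rightarrow> ('c \<Rightarrow> 'c \<Rightarrow> 'w) \<Rightarrow>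
   'c \<Rightarrow> (nat set \<Rightarrow> real) \<Rightarrow> 'c davis_point" where
  "davis_class W s n C \<delta> c k = davis_rel W s n C \<delta> `` {(c, k)}"

definition davis_cells ::
  "('w, 'x) monoid_scheme \<Rightarrow> (nat \<Rightarrow> 'w) \<Rightarrow> nat \<Rightarrow> 'c set \<Rightarrow> ('c \<Rightarrow> 'c \<Rightarrow> 'w) \<Rightarrow>
   'c davis_point set set" where
  "davis_cells W s n C \<delta> =
     {davis_class W s n C \<delta> c ` closed_simplex \<sigma> | c \<sigma>. c \<in> C \<and> \<sigma> \<in> chamber_simplices W s n}"

definition davis_vertices ::
  "('w, 'x) monoid_scheme \<Rightarrow> (nat \<Rightarrow> 'w) \<Rightarrow> nat \<Rightarrow> 'c set \<Rightarrow> ('c \<Rightarrow> 'c \<Rightarrow> 'w) \<Rightarrow>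
   'c davis_point set" where
  "davis_vertices W s n C \<delta> =
     {davis_class W s n C \<delta> c (bary_vertex T) | c T. c \<in> C \<and> T \<in> spherical_subsets W s n}"

text \<open>Let \<open>l\<close> be the common edge length of the cubes. In the Euclidean cube \<open>[0, l]\<^sup>T\<close> attached to
  the coset \<open>w W\<^sub>T\<close>, placed so that the vertex \<open>w\<close> is the origin, the vertex \<open>w W\<^sub>U\<close> (\<open>U \<subseteq> T\<close>)
  is the centre of the face spanned by \<open>U\<close>, that is, \<open>l/2\<close> times the indicator vector of \<open>U\<close>.
  Extending affinely over simplices gives the following coordinates on the chamber; they restrict
  to an affine embedding on each simplex.\<close>

definition cube_coord :: "real \<Rightarrow> nat \<Rightarrow> (nat set \<Rightarrow> real) \<Rightarrow> nat \<Rightarrow> real" where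
  "cube_coord l n k i = (\<Sum>T\<in>Pow {1..n}. k T * (if i \<in> T then l / 2 else 0))"

definition simplex_dist :: "real \<Rightarrow> nat \<Rightarrow> (nat set \<Rightarrow> real) \<Rightarrow> (nat set \<Rightarrow> real) \<Rightarrow> real" where
  "simplex_dist l n k k' = L2_set (\<lambda>i. cube_coord l n k i - cube_coord l n k' i) {1..n}"

text \<open>The piecewise Euclidean metric is the intrinsic one: the infimum of the lengths of strings
  (Bridson and Haefliger, I.7.4), i.e. of finite sequences of points in which consecutive points
  lie in a common closed cell, the length being measured cell by cell. It is set to \<open>0\<close> outside
  the realisation because the locale \<open>Metric_space\<close> constrains the distance function there too.\<close>

inductive davis_string ::
  "real \<Rightarrow> ('w, 'x) monoid_scheme \<Rightarrow> (nat \<Rightarrow> 'w) \<Rightarrow> nat \<Rightarrow> 'c set \<Rightarrow> ('c \<Rightarrow> 'c \<Rightarrow> 'w) \<Rightarrow>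
   'c davis_point \<Rightarrow> 'c davis_point \<Rightarrow> real \<Rightarrow> bool"
  for l W s n C \<delta> where
  Nil: "x \<in> davis_realization W s n C \<delta> \<Longrightarrow> davis_string l W s n C \<delta> x x 0"
| Cons: "\<lbrakk>c \<in> C; \<sigma> \<in> chamber_simplices W s n; k \<in> closed_simplex \<sigma>; k' \<in> closed_simplex \<sigma>;
     davis_string l W s n C \<delta> (davis_class W s n C \<delta> c k') z r\<rbrakk>
     \<Longrightarrow> davis_string l W s n C \<delta> (davis_class W s n C \<delta> c k) z (simplex_dist l n k k' + r)"

definition davis_dist ::
  "real \<Rightarrow> ('w, 'x) monoid_scheme \<Rightarrow> (nat \<Rightarrow> 'w) \<Rightarrow> nat \<Rightarrow> 'c set \<Rightarrow> ('c \<Rightarrow> 'c \<Rightarrow> 'w) \<Rightarrow>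
   'c davis_point \<Rightarrow> 'c davis_point \<Rightarrow> real" where
  "davis_dist l W s n C \<delta> x y =
     (if x \<in> davis_realization W s n C \<delta> \<and> y \<in> davis_realization W s n C \<delta>
      then Inf {r. davis_string l W s n C \<delta> x y r} else 0)"

definition davis_topology ::
  "real \<Rightarrow> ('w, 'x) monoid_scheme \<Rightarrow> (nat \<Rightarrow> 'w) \<Rightarrow> nat \<Rightarrow> 'c set \<Rightarrow> ('c \<Rightarrow> 'c \<Rightarrow> 'w) \<Rightarrow>
   'c davis_point topology" where
  "davis_topology l W s n C \<delta> =
     Metric_space.mtopology (davis_realization W s n C \<delta>) (davis_dist l W s n C \<delta>)"


section \<open>The automorphism group\<close>

text \<open>Polyhedral isometries: bijective isometries that permute the cells (not necessarily
  preserving the labels of vertices).\<close>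

definition davis_Aut ::
  "real \<Rightarrow> ('w, 'x) monoid_scheme \<Rightarrow> (nat \<Rightarrow> 'w) \<Rightarrow> nat \<Rightarrow> 'c set \<Rightarrow> ('c \<Rightarrow> 'c \<Rightarrow> 'w) \<Rightarrow>
   ('c davis_point \<Rightarrow> 'c davis_point) monoid" where
  "davis_Aut l W s n C \<delta> =
     BijGroup (davis_realization W s n C \<delta>)
       \<lparr>carrier := {g \<in> Bij (davis_realization W s n C \<delta>).
          (\<forall>x\<in>davis_realization W s n C \<delta>. \<forall>y\<in>davis_realization W s n C \<delta>.
             davis_dist l W s n C \<delta> (g x) (g y) = davis_dist l W s n C \<delta> x y) \<and>
          (`) g ` davis_cells W s n C \<delta> = davis_cells W s n C \<delta>}\<rparr>"

definition compact_open_topology ::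
  "'a topology \<Rightarrow> 'b topology \<Rightarrow> ('a \<Rightarrow> 'b) set \<Rightarrow> ('a \<Rightarrow> 'b) topology" where
  "compact_open_topology X Y F =
     topology_generated_by {{f\<in>F. f ` Q \<subseteq> U} | Q U. compactin X Q \<and> openin Y U}"

definition davis_Aut_topology ::
  "real \<Rightarrow> ('w, 'x) monoid_scheme \<Rightarrow> (nat \<Rightarrow> 'w) \<Rightarrow> nat \<Rightarrow> 'c set \<Rightarrow> ('c \<Rightarrow> 'c \<Rightarrow> 'w) \<Rightarrow>
   ('c davis_point \<Rightarrow> 'c davis_point) topology" where
  "davis_Aut_topology l W s n C \<delta> =
     compact_open_topology (davis_topology l W s n C \<delta>) (davis_topology l W s n C \<delta>)
       (carrier (davis_Aut l W s n C \<delta>))"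


section \<open>Lattices and covolumes\<close>

text \<open>Here \<open>G\<close> is a group whose carrier is the underlying set of the topology \<open>X\<close>. The elements of
  \<open>\<Gamma>\G\<close> are the cosets \<open>\<Gamma> g\<close>, called right cosets in \<open>HOL-Algebra\<close>.\<close>

definition borel_of :: "'a topology \<Rightarrow> 'a measure" where
  "borel_of X = sigma (topspace X) {U. openin X U}"

definition discrete_subgroup :: "('g, 'x) monoid_scheme \<Rightarrow> 'g topology \<Rightarrow> 'g set \<Rightarrow> bool" where
  "discrete_subgroup G X \<Gamma> \<longleftrightarrow> subgroup \<Gamma> G \<and> subtopology X \<Gamma> = discrete_topology \<Gamma>"

definition coset_topology ::
  "('g, 'x) monoid_scheme \<Rightarrow> 'g topology \<Rightarrow> 'g set \<Rightarrow> 'g set topology" where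
  "coset_topology G X \<Gamma> =
     topology (\<lambda>U. U \<subseteq> rcosets\<^bsub>G\<^esub> \<Gamma> \<and> openin X {g \<in> carrier G. \<Gamma> #>\<^bsub>G\<^esub> g \<in> U})"

definition lattice_in :: "('g, 'x) monoid_scheme \<Rightarrow> 'g topology \<Rightarrow> 'g set \<Rightarrow> bool" where
  "lattice_in G X \<Gamma> \<longleftrightarrow>
     discrete_subgroup G X \<Gamma> \<and>
     (\<exists>\<nu> :: 'g set measure.
        sets \<nu> = sets (borel_of (coset_topology G X \<Gamma>)) \<and>
        0 < emeasure \<nu> (space \<nu>) \<and> emeasure \<nu> (space \<nu>) < \<infinity> \<and>
        (\<forall>g\<in>carrier G. \<forall>A\<in>sets \<nu>. emeasure \<nu> ((\<lambda>x. x #>\<^bsub>G\<^esub> g) ` A) = emeasure \<nu> A))"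

definition uniform_lattice :: "('g, 'x) monoid_scheme \<Rightarrow> 'g topology \<Rightarrow> 'g set \<Rightarrow> bool" where
  "uniform_lattice G X \<Gamma> \<longleftrightarrow> lattice_in G X \<Gamma> \<and> compact_space (coset_topology G X \<Gamma>)"

text \<open>Regularity is omitted: it is automatic when \<open>X\<close> is locally compact Hausdorff and second
  countable, as is the case for the automorphism groups considered here.\<close>

definition haar_measure :: "('g, 'x) monoid_scheme \<Rightarrow> 'g topology \<Rightarrow> 'g measure \<Rightarrow> bool" where
  "haar_measure G X \<mu> \<longleftrightarrow>
     sets \<mu> = sets (borel_of X) \<and>
     (\<forall>g\<in>carrier G. \<forall>A\<in>sets \<mu>. emeasure \<mu> (g <#\<^bsub>G\<^esub> A) = emeasure \<mu> A) \<and>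
     (\<forall>Q. compactin X Q \<longrightarrow> emeasure \<mu> Q < \<infinity>) \<and>
     (\<forall>U. openin X U \<and> U \<noteq> {} \<longrightarrow> 0 < emeasure \<mu> U)"

text \<open>For discrete \<open>\<Gamma>\<close>, the mass of \<open>\<Gamma>\G\<close> under the measure induced by \<open>\<mu>\<close> is the measure of any
  Borel set containing exactly one element of each coset.\<close>

definition covolume :: "('g, 'x) monoid_scheme \<Rightarrow> 'g measure \<Rightarrow> 'g set \<Rightarrow> ennreal" where
  "covolume G \<mu> \<Gamma> =
     (THE v. \<exists>F\<in>sets \<mu>. (\<forall>x\<in>rcosets\<^bsub>G\<^esub> \<Gamma>. \<exists>!g. g \<in> F \<inter> x) \<and> v = emeasure \<mu> F)"

text \<open>A subgroup \<open>\<Gamma>\<close> of a group of self-maps acts by evaluation.\<close>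

definition stabilizer_sum :: "('a \<Rightarrow> 'a) monoid \<Rightarrow> 'a set \<Rightarrow> ('a \<Rightarrow> 'a) set \<Rightarrow> ennreal" where
  "stabilizer_sum G V \<Gamma> =
     (\<integral>\<^sup>+ v. 1 / of_nat (card (stabilizer (G\<lparr>carrier := \<Gamma>\<rparr>) (\<lambda>g. g) (SOME v'. v' \<in> v)))
        \<partial>count_space (orbits (G\<lparr>carrier := \<Gamma>\<rparr>) V (\<lambda>g. g)))"

definition serre_haar_measure ::
  "('a \<Rightarrow> 'a) monoid \<Rightarrow> ('a \<Rightarrow> 'a) topology \<Rightarrow> 'a set \<Rightarrow> ('a \<Rightarrow> 'a) measure \<Rightarrow> bool" where
  "serre_haar_measure G X V \<mu> \<longleftrightarrow>
     haar_measure G X \<mu> \<and>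
     (\<forall>\<Gamma>. discrete_subgroup G X \<Gamma> \<longrightarrow> covolume G \<mu> \<Gamma> = stabilizer_sum G V \<Gamma>)"

end

theory Submission
  imports Defs "HOL-Computational_Algebra.Primes"
begin

text \<open>
  The lattices are groups of lifts along a covering of a finite chamber system, and their covolumes
  are computed in the quotient.

  In a right-angled Coxeter group two reduced words for the same element differ only by exchanging
  commuting letters. Geometrically, if a chamber of the building has two descents with respect to a
  base chamber, then their types commute and the two projections close up to a square
  (\<open>gate_commute\<close>). The building is therefore simply connected as a chamber system: it
  can be coloured so that each \<open>i\<close>-panel shows every \<open>i\<close>-colour exactly once and a
  step across an \<open>i\<close>-panel changes the \<open>i\<close>-colour only
  (\<open>proper_colouring_exists\<close>), and a colour-preserving map to any other such
  coloured system in which commuting squares close up exists and is determined by one value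
  (\<open>colour_morphism_exists\<close>, \<open>colour_morphism_unique\<close>). In particular the
  building covers every finite connected coloured system \<open>Y\<close> with the right panel
  sizes, and every symmetry of \<open>Y\<close> lifts, with a prescribed value at one chamber
  (\<open>lift_exists\<close>).

  Let \<open>A\<close> be a finite group of symmetries of \<open>Y\<close> and \<open>\<Gamma>\<close> the
  group of all lifts of elements of \<open>A\<close>. Deck transformations act freely on the vertices
  of the Davis realisation, so the stabiliser in \<open>\<Gamma>\<close> of a vertex is isomorphic to
  the stabiliser in \<open>A\<close> of its image, and orbit counting in the quotient turns Serre's
  sum into the number of vertices of the quotient divided by \<open>\<bar>A\<bar>\<close>
  (\<open>stabilizer_sum_Lat\<close>).

  It remains to choose \<open>Y\<close> with few vertices and many symmetries of order \<open>p\<close>.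
  Let \<open>u\<close> be a free generator with \<open>p < q u\<close> and \<open>v\<close> a second one. Take
  \<open>N\<close> copies of the cube of all colour vectors \<open>x\<close> and reglue the
  \<open>v\<close>-panels on which \<open>x u = p\<close> so that they connect each copy to the next one. In
  every copy the \<open>p\<close> values \<open>x u < p\<close> can be rotated independently of the
  other copies, because the regluing does not see them. The covolume is
  \<open>N D / p ^ N\<close> with a positive integer \<open>D\<close> that does not depend on \<open>N\<close>, and
  the theorem follows on letting \<open>N\<close> grow through numbers coprime to \<open>p\<close>.

  That \<open>\<Gamma>\<close> is a uniform lattice is a statement about permutation groups: the
  compact-open topology on the automorphism group is the topology of pointwise convergence on
  vertices (\<open>AutX_open_iff\<close>), vertex stabilisers are compact (\<open>stab_compact\<close>),
  and a subgroup with finite vertex stabilisers and finitely many orbits of vertices is a uniform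
  lattice (\<open>uniform\<close>). Two elementary facts control the metric. Folding all chambers onto
  one shows that the intrinsic metric is Euclidean on every cell (\<open>ddist_cell\<close>), and the
  barycentric coordinates are Lipschitz functions that separate points
  (\<open>weight_lipschitz\<close>, \<open>weights_separate\<close>).
\<close>

(* Generators are indexed by {1..n}; the simplifier is to leave the lower bound as it stands. *)
declare One_nat_def [simp del]

section \<open>Reduced words in right-angled Coxeter groups\<close>

definition noncommuting :: "(nat \<Rightarrow> nat \<Rightarrow> enat) \<Rightarrow> nat \<Rightarrow> nat \<Rightarrow> bool" where
  "noncommuting m i k \<longleftrightarrow> i = k \<or> (m i k = \<infinity> \<and> m k i = \<infinity>)"

text \<open>A word up to exchanging commuting letters is determined by its restrictions to the pairs of
  letters that do not commute, a letter counting as paired with itself. These restrictions are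
  recorded in a heap: the entry at \<open>(a, b)\<close> is the subword of the letters
  \<open>a\<close> and \<open>b\<close>. Left multiplication by a generator removes the letter if it is on
  top of all entries that involve it, and puts it there otherwise.\<close>

type_synonym heap = "nat \<Rightarrow> nat \<Rightarrow> nat list"

definition affects :: "(nat \<Rightarrow> nat \<Rightarrow> enat) \<Rightarrow> nat \<Rightarrow> nat \<Rightarrow> nat \<Rightarrow> bool" where
  "affects m i a b \<longleftrightarrow> noncommuting m a b \<and> (i = a \<or> i = b)"

definition heap_push :: "(nat \<Rightarrow> nat \<Rightarrow> enat) \<Rightarrow> nat \<Rightarrow> heap \<Rightarrow> heap" where
  "heap_push m i \<omega> = (\<lambda>a b. if affects m i a b then i # \<omega> a b else \<omega> a b)"

definition heap_pop :: "(nat \<Rightarrow> nat \<Rightarrow> enat) \<Rightarrow> nat \<Rightarrow> heap \<Rightarrow> heap" where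
  "heap_pop m i \<omega> = (\<lambda>a b. if affects m i a b then tl (\<omega> a b) else \<omega> a b)"

definition on_top :: "(nat \<Rightarrow> nat \<Rightarrow> enat) \<Rightarrow> nat \<Rightarrow> heap \<Rightarrow> bool" where
  "on_top m i \<omega> \<longleftrightarrow> (\<forall>a b. affects m i a b \<longrightarrow> \<omega> a b \<noteq> [] \<and> hd (\<omega> a b) = i)"

definition heap_step :: "(nat \<Rightarrow> nat \<Rightarrow> enat) \<Rightarrow> nat \<Rightarrow> heap \<Rightarrow> heap" where
  "heap_step m i \<omega> = (if on_top m i \<omega> then heap_pop m i \<omega> else heap_push m i \<omega>)"

abbreviation empty_heap :: heap where "empty_heap \<equiv> \<lambda>a b. []"

text \<open>The heaps of reduced words: a letter is never pushed onto a heap that it already tops.\<close>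

inductive_set heaps :: "(nat \<Rightarrow> nat \<Rightarrow> enat) \<Rightarrow> heap set" for m where
  empty: "empty_heap \<in> heaps m"
| push: "\<omega> \<in> heaps m \<Longrightarrow> \<not> on_top m i \<omega> \<Longrightarrow> heap_push m i \<omega> \<in> heaps m"

lemma affects_self: "affects m i i i"
  by (simp add: affects_def noncommuting_def)

lemma on_top_nonempty: "on_top m i \<omega> \<Longrightarrow> \<omega> i i \<noteq> []"
  using affects_self unfolding on_top_def by metis

lemma affects_disjoint: "\<not> noncommuting m i k \<Longrightarrow> affects m i a b \<Longrightarrow> \<not> affects m k a b"
  by (auto simp: affects_def noncommuting_def)

lemma on_top_push: "on_top m i (heap_push m i \<omega>)"
  by (simp add: on_top_def heap_push_def)

lemma pop_push: "heap_pop m i (heap_push m i \<omega>) = \<omega>"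
  by (simp add: heap_pop_def heap_push_def fun_eq_iff)

lemma push_pop: "on_top m i \<omega> \<Longrightarrow> heap_push m i (heap_pop m i \<omega>) = \<omega>"
  unfolding heap_pop_def heap_push_def on_top_def fun_eq_iff by (metis list.collapse)

lemma on_top_independent:
  assumes "\<not> noncommuting m i k"
  shows "on_top m k (heap_push m i \<omega>) = on_top m k \<omega>" "on_top m k (heap_pop m i \<omega>) = on_top m k \<omega>"
  using affects_disjoint[OF assms] by (auto simp: on_top_def heap_push_def heap_pop_def)

lemma push_pop_independent:
  assumes "\<not> noncommuting m i k"
  shows "heap_push m i (heap_push m k \<omega>) = heap_push m k (heap_push m i \<omega>)"
    and "heap_push m i (heap_pop m k \<omega>) = heap_pop m k (heap_push m i \<omega>)"
    and "heap_pop m i (heap_pop m k \<omega>) = heap_pop m k (heap_pop m i \<omega>)"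
  using affects_disjoint[OF assms] by (auto simp: heap_push_def heap_pop_def fun_eq_iff)

lemma noncommuting_sym: "noncommuting m i k \<Longrightarrow> noncommuting m k i"
  by (auto simp: noncommuting_def)

lemma on_top_both_imp_independent:
  assumes "on_top m i \<omega>" "on_top m k \<omega>" "i \<noteq> k"
  shows "\<not> noncommuting m i k"
  using assms unfolding on_top_def affects_def by metis

text \<open>Two commuting letters occur in disjoint sets of entries, so their actions do not interact.\<close>

lemma heap_step_commute:
  assumes "\<not> noncommuting m i k"
  shows "heap_step m i (heap_step m k \<omega>) = heap_step m k (heap_step m i \<omega>)"
proof -
  have "\<not> noncommuting m k i" using assms noncommuting_sym by blast
  then show ?thesis
    using assms by (simp add: heap_step_def on_top_independent push_pop_independent)
qed

text \<open>Because a letter is only pushed when it is not on top, popping it uncovers a heap that it does not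
  top; this makes the action of a generator an involution. If \<open>i\<close> tops a heap whose last pushed letter is \<open>k \<noteq> i\<close>,
  then \<open>i\<close> and \<open>k\<close> commute, and the claim descends to the heap before that
  push.\<close>

lemma heap_pop_closed:
  assumes "\<omega> \<in> heaps m" "on_top m i \<omega>"
  shows "heap_pop m i \<omega> \<in> heaps m \<and> \<not> on_top m i (heap_pop m i \<omega>)"
  using assms
proof (induction rule: heaps.induct)
  case empty
  then show ?case using on_top_nonempty[of m i empty_heap] by simp
next
  case (push \<omega> k)
  show ?case
  proof (cases "i = k")
    case True
    then show ?thesis using push by (simp add: pop_push)
  next
    case False
    then have ind: "\<not> noncommuting m i k"
      using on_top_both_imp_independent push.prems on_top_push by blast
    then have ind': "\<not> noncommuting m k i" using noncommuting_sym by blast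
    have "on_top m i \<omega>" using push.prems on_top_independent(1)[OF ind'] by simp
    then have IH: "heap_pop m i \<omega> \<in> heaps m" "\<not> on_top m i (heap_pop m i \<omega>)"
      using push.IH by auto
    have eq: "heap_pop m i (heap_push m k \<omega>) = heap_push m k (heap_pop m i \<omega>)"
      using push_pop_independent(2)[OF ind'] by simp
    show ?thesis
      unfolding eq using IH push.hyps ind ind' by (simp add: heaps.push on_top_independent)
  qed
qed

lemma heap_step_closed: "\<omega> \<in> heaps m \<Longrightarrow> heap_step m i \<omega> \<in> heaps m"
  by (simp add: heap_step_def heap_pop_closed heaps.push)

lemma on_top_step: "\<omega> \<in> heaps m \<Longrightarrow> on_top m i (heap_step m i \<omega>) \<longleftrightarrow> \<not> on_top m i \<omega>"
  by (simp add: heap_step_def heap_pop_closed on_top_push)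

lemma heap_step_involution: "\<omega> \<in> heaps m \<Longrightarrow> heap_step m i (heap_step m i \<omega>) = \<omega>"
  using on_top_step[of \<omega> m i] by (auto simp: heap_step_def push_pop pop_push)

lemma on_top_step_independent:
  "\<not> noncommuting m i k \<Longrightarrow> on_top m k (heap_step m i \<omega>) \<longleftrightarrow> on_top m k \<omega>"
  by (simp add: heap_step_def on_top_independent)

definition heap_of :: "(nat \<Rightarrow> nat \<Rightarrow> enat) \<Rightarrow> nat list \<Rightarrow> heap \<Rightarrow> heap" where
  "heap_of m u \<omega> = foldr (heap_step m) u \<omega>"

lemma heap_of_simps [simp]:
  "heap_of m [] \<omega> = \<omega>" "heap_of m (i # u) \<omega> = heap_step m i (heap_of m u \<omega>)"
  "heap_of m (u @ v) \<omega> = heap_of m u (heap_of m v \<omega>)"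
  by (simp_all add: heap_of_def)

lemma heap_of_closed: "\<omega> \<in> heaps m \<Longrightarrow> heap_of m u \<omega> \<in> heaps m"
  by (induction u) (simp_all add: heap_step_closed)

definition heap_size :: "nat \<Rightarrow> heap \<Rightarrow> nat" where
  "heap_size n \<omega> = (\<Sum>i\<in>{1..n}. length (\<omega> i i))"

lemma affects_diag: "affects m i a a \<longleftrightarrow> i = a"
  by (simp add: affects_def noncommuting_def)

lemma heap_size_push:
  assumes "i \<in> {1..n}" shows "heap_size n (heap_push m i \<omega>) = Suc (heap_size n \<omega>)"
proof -
  have "heap_size n (heap_push m i \<omega>)
      = (\<Sum>a\<in>{1..n}. length (\<omega> a a) + (if a = i then 1 else 0))"
    unfolding heap_size_def by (rule sum.cong) (auto simp: heap_push_def affects_diag)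
  also have "\<dots> = heap_size n \<omega> + 1"
    using assms by (simp add: heap_size_def sum.distrib)
  finally show ?thesis by simp
qed

lemma heap_size_pop:
  assumes "i \<in> {1..n}" "on_top m i \<omega>"
  shows "Suc (heap_size n (heap_pop m i \<omega>)) = heap_size n \<omega>"
  using heap_size_push[OF assms(1), of m "heap_pop m i \<omega>"] push_pop[OF assms(2)] by simp

locale racg =
  fixes W :: "('w, 'x) monoid_scheme" (structure)
    and s :: "nat \<Rightarrow> 'w" and n :: nat and m :: "nat \<Rightarrow> nat \<Rightarrow> enat"
  assumes coxeter: "coxeter_system W s n m" and ra: "right_angled n m"
begin

sublocale group W
  using coxeter by (simp add: coxeter_system_def)

lemma gen_closed [simp]: "i \<in> {1..n} \<Longrightarrow> s i \<in> carrier W"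
  using coxeter by (auto simp: coxeter_system_def)

abbreviation "indep i k \<equiv> \<not> noncommuting m i k"

lemma m_sym: "i \<in> {1..n} \<Longrightarrow> k \<in> {1..n} \<Longrightarrow> m i k = m k i"
  using coxeter by (auto simp: coxeter_system_def coxeter_matrix_def)

lemma m_cases: "i \<in> {1..n} \<Longrightarrow> k \<in> {1..n} \<Longrightarrow> i \<noteq> k \<Longrightarrow> m i k = 2 \<or> m i k = \<infinity>"
  using ra by (auto simp: right_angled_def)

lemma indep_iff:
  "i \<in> {1..n} \<Longrightarrow> k \<in> {1..n} \<Longrightarrow> indep i k \<longleftrightarrow> i \<noteq> k \<and> m i k = 2"
  using m_cases[of i k] m_sym[of i k] unfolding noncommuting_def by (metis numeral_ne_infinity)

lemma dep_iff:
  "i \<in> {1..n} \<Longrightarrow> k \<in> {1..n} \<Longrightarrow> noncommuting m i k \<longleftrightarrow> i = k \<or> m i k = \<infinity>"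
  using m_sym[of i k] unfolding noncommuting_def by metis

lemma word_value_Nil [simp]: "word_value W s [] = \<one>"
  and word_value_Cons [simp]: "word_value W s (i # u) = s i \<otimes> word_value W s u"
  by (simp_all add: word_value_def)

lemma word_value_closed [simp]: "u \<in> lists {1..n} \<Longrightarrow> word_value W s u \<in> carrier W"
  by (induction u) auto

lemma word_value_append:
  "u \<in> lists {1..n} \<Longrightarrow> v \<in> lists {1..n} \<Longrightarrow>
   word_value W s (u @ v) = word_value W s u \<otimes> word_value W s v"
  by (induction u) (auto simp: m_assoc)

lemma word_value_eq_iff:
  "u \<in> lists {1..n} \<Longrightarrow> v \<in> lists {1..n} \<Longrightarrow>
   word_value W s u = word_value W s v \<longleftrightarrow> coxeter_cong n m u v"
  using coxeter by (auto simp: coxeter_system_def)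

lemma gen_square: "i \<in> {1..n} \<Longrightarrow> s i \<otimes> s i = \<one>"
proof -
  assume i: "i \<in> {1..n}"
  have "m i i = enat 1"
    using coxeter i by (simp add: coxeter_system_def coxeter_matrix_def one_enat_def)
  from coxeter_cong.relation[of i n i m, OF i i this] have "coxeter_cong n m [i, i] []"
    by (simp add: One_nat_def)
  then have "word_value W s [i, i] = word_value W s []"
    using word_value_eq_iff[of "[i, i]" "[]"] i by simp
  then show ?thesis using i by simp
qed

lemma gen_cancel: "i \<in> {1..n} \<Longrightarrow> w \<in> carrier W \<Longrightarrow> s i \<otimes> (s i \<otimes> w) = w"
  by (metis gen_closed gen_square l_one m_assoc)

lemma gen_inv: "i \<in> {1..n} \<Longrightarrow> inv (s i) = s i"
  using gen_square by (simp add: inv_equality)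

lemma special_subgroup_word:
  assumes "T \<subseteq> {1..n}"
  shows "special_subgroup W s T = word_value W s ` lists T"
proof
  show "special_subgroup W s T \<subseteq> word_value W s ` lists T"
  proof
    fix w assume "w \<in> special_subgroup W s T"
    then have "w \<in> generate W (s ` T)" by (simp add: special_subgroup_def)
    then show "w \<in> word_value W s ` lists T"
    proof (induction rule: generate.induct)
      case one
      show ?case by (rule image_eqI[of _ _ "[]"]) auto
    next
      case (incl h)
      then obtain i where "i \<in> T" "h = s i" by auto
      then show ?case using assms by (intro image_eqI[of _ _ "[i]"]) auto
    next
      case (inv h)
      then obtain i where "i \<in> T" "h = s i" by auto
      then show ?case using assms gen_inv by (intro image_eqI[of _ _ "[i]"]) auto
    next
      case (eng h1 h2)
      then obtain u v where "u \<in> lists T" "v \<in> lists T" "h1 = word_value W s u" "h2 = word_value W s v"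
        by auto
      moreover have "u \<in> lists {1..n}" "v \<in> lists {1..n}" using calculation assms by auto
      ultimately show ?case
        by (intro image_eqI[of _ _ "u @ v"]) (auto simp: word_value_append)
    qed
  qed
next
  show "word_value W s ` lists T \<subseteq> special_subgroup W s T"
  proof -
    have "u \<in> lists T \<Longrightarrow> word_value W s u \<in> generate W (s ` T)" for u
      by (induction u) (auto intro: generate.intros)
    then show ?thesis by (auto simp: special_subgroup_def)
  qed
qed

lemma carrier_word: "carrier W = word_value W s ` lists {1..n}"
  using special_subgroup_word[of "{1..n}"] coxeter
  by (simp add: coxeter_system_def special_subgroup_def)

text \<open>The generators act on heaps by involutions that commute whenever \<open>m i j = 2\<close>; these
  are all the relations of a right-angled presentation.\<close>

lemma heap_of_cong:
  assumes "coxeter_cong n m u v" "\<omega> \<in> heaps m"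
  shows "heap_of m u \<omega> = heap_of m v \<omega>"
  using assms
proof (induction arbitrary: \<omega> rule: coxeter_cong.induct)
  case (relation i j k)
  show ?case
  proof (cases "i = j")
    case True
    have "m i i = 1" using coxeter relation by (simp add: coxeter_system_def coxeter_matrix_def)
    then have "k = 1" using True relation by (simp add: one_enat_def)
    then show ?thesis using True relation by (simp add: heap_step_involution One_nat_def)
  next
    case False
    then have "m i j = 2" using m_cases[of i j] relation by simp
    moreover have "k = 2" using calculation relation by (simp add: numeral_eq_enat)
    ultimately have "indep i j" using False relation indep_iff by blast
    then show ?thesis
      using \<open>k = 2\<close> relation heap_step_commute[of m i j]
      by (simp add: numeral_2_eq_2 heap_step_involution heap_step_closed)
  qed
next
  case (append u v u' v')
  then show ?case by (simp add: heap_of_closed)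
qed auto

definition heap :: "'w \<Rightarrow> heap" where
  "heap w = heap_of m (SOME u. u \<in> lists {1..n} \<and> word_value W s u = w) empty_heap"

lemma heap_word:
  assumes "u \<in> lists {1..n}"
  shows "heap (word_value W s u) = heap_of m u empty_heap"
proof -
  define v where "v = (SOME v. v \<in> lists {1..n} \<and> word_value W s v = word_value W s u)"
  have "v \<in> lists {1..n} \<and> word_value W s v = word_value W s u"
    unfolding v_def by (rule someI[of _ u]) (use assms in simp)
  then have "coxeter_cong n m v u" using word_value_eq_iff assms by blast
  then show ?thesis unfolding heap_def v_def[symmetric] by (simp add: heap_of_cong heaps.empty)
qed

lemma heap_in: "w \<in> carrier W \<Longrightarrow> heap w \<in> heaps m"
  unfolding carrier_word by (metis (no_types, lifting) heap_of_closed heap_word heaps.empty imageE)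

lemma heap_mult: "i \<in> {1..n} \<Longrightarrow> w \<in> carrier W \<Longrightarrow> heap (s i \<otimes> w) = heap_step m i (heap w)"
proof -
  assume i: "i \<in> {1..n}" and "w \<in> carrier W"
  then obtain u where u: "u \<in> lists {1..n}" "w = word_value W s u" by (auto simp: carrier_word)
  then have "s i \<otimes> w = word_value W s (i # u)" by simp
  then show ?thesis using heap_word[of "i # u"] heap_word[of u] u i by simp
qed

lemma heap_one: "heap \<one> = empty_heap"
  using heap_word[of "[]"] by simp

definition descent :: "nat \<Rightarrow> 'w \<Rightarrow> bool" where
  "descent i w \<longleftrightarrow> on_top m i (heap w)"

lemma gen_commute:
  assumes "i \<in> {1..n}" "k \<in> {1..n}" "indep i k"
  shows "s i \<otimes> s k = s k \<otimes> s i"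
proof -
  have "m i k = enat 2" using assms indep_iff by (simp add: numeral_eq_enat)
  from coxeter_cong.relation[of i n k m, OF assms(1,2) this]
  have "coxeter_cong n m [i, k, i, k] []" by (simp add: numeral_2_eq_2)
  then have "word_value W s [i, k, i, k] = word_value W s []"
    using word_value_eq_iff[of "[i, k, i, k]" "[]"] assms by simp
  then have "s i \<otimes> (s k \<otimes> (s i \<otimes> s k)) = \<one>" using assms by simp
  then have "s k \<otimes> (s i \<otimes> s k) = s i"
    using gen_cancel[of i "s k \<otimes> (s i \<otimes> s k)"] assms by simp
  then show ?thesis using gen_cancel[of k "s i \<otimes> s k"] assms by simp
qed

lemma gen_left_commute:
  assumes "i \<in> {1..n}" "k \<in> {1..n}" "indep i k" "w \<in> carrier W"
  shows "s i \<otimes> (s k \<otimes> w) = s k \<otimes> (s i \<otimes> w)"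
proof -
  have "s i \<otimes> (s k \<otimes> w) = (s i \<otimes> s k) \<otimes> w" using assms by (simp add: m_assoc)
  then show ?thesis using assms gen_commute[OF assms(1-3)] by (simp add: m_assoc)
qed

lemma heap_size_le: "u \<in> lists {1..n} \<Longrightarrow> heap_size n (heap_of m u empty_heap) \<le> length u"
proof (induction u)
  case Nil
  show ?case by (simp add: heap_size_def)
next
  case (Cons a u)
  then have a: "a \<in> {1..n}" by simp
  show ?case
  proof (cases "on_top m a (heap_of m u empty_heap)")
    case True
    then show ?thesis using heap_size_pop[OF a True] Cons by (simp add: heap_step_def)
  next
    case False
    then show ?thesis using heap_size_push[OF a] Cons by (simp add: heap_step_def)
  qed
qed

text \<open>In a reduced word a letter on top of the heap can be exchanged with the letters before it until it
  comes first.\<close>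

lemma on_top_word:
  assumes "v \<in> lists {1..n}" "i \<in> {1..n}" "length v = heap_size n (heap_of m v empty_heap)"
    "on_top m i (heap_of m v empty_heap)"
  shows "\<exists>v'\<in>lists {1..n}. length v = Suc (length v') \<and> word_value W s v = s i \<otimes> word_value W s v'"
  using assms
proof (induction v)
  case Nil
  then show ?case using on_top_nonempty[of m i empty_heap] by simp
next
  case (Cons k v)
  let ?\<omega> = "heap_of m v empty_heap"
  have k: "k \<in> {1..n}" and v: "v \<in> lists {1..n}" using Cons.hyps by auto
  have "\<not> on_top m k ?\<omega>"
  proof
    assume "on_top m k ?\<omega>"
    then have "Suc (heap_size n (heap_of m (k # v) empty_heap)) = heap_size n ?\<omega>"
      using heap_size_pop[OF k] by (simp add: heap_step_def)
    then show False using Cons.prems(2) heap_size_le[OF v] by simp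
  qed
  then have step: "heap_of m (k # v) empty_heap = heap_push m k ?\<omega>" by (simp add: heap_step_def)
  then have len: "length v = heap_size n ?\<omega>" using Cons.prems heap_size_push[OF k] by simp
  show ?case
  proof (cases "i = k")
    case True
    then show ?thesis using v by auto
  next
    case False
    have ind: "indep i k"
      using on_top_both_imp_independent[of m i _ k] Cons.prems(3) step on_top_push False by metis
    then have ind': "indep k i" using noncommuting_sym by blast
    have "on_top m i ?\<omega>" using Cons.prems(3) step on_top_independent(1)[OF ind'] by simp
    then obtain v' where v': "v' \<in> lists {1..n}" "length v = Suc (length v')"
        "word_value W s v = s i \<otimes> word_value W s v'"
      using Cons.IH Cons.prems(1) len by blast
    then have "word_value W s (k # v) = s i \<otimes> word_value W s (k # v')"
      using gen_left_commute[OF k Cons.prems(1) ind'] by simp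
    then show ?thesis using v' k by (intro bexI[of _ "k # v'"]) auto
  qed
qed

lemma reduced_word_exists:
  assumes "u \<in> lists {1..n}"
  shows "\<exists>v\<in>lists {1..n}. word_value W s v = word_value W s u \<and>
     length v = heap_size n (heap_of m u empty_heap)"
  using assms
proof (induction u)
  case Nil
  then show ?case by (intro bexI[of _ "[]"]) (auto simp: heap_size_def)
next
  case (Cons i u)
  then obtain v where v: "v \<in> lists {1..n}" "word_value W s v = word_value W s u"
      "length v = heap_size n (heap_of m u empty_heap)" by auto
  have i: "i \<in> {1..n}" using Cons by simp
  have eq: "heap_of m v empty_heap = heap_of m u empty_heap"
    using heap_word v Cons by (metis Cons_in_lists_iff)
  show ?case
  proof (cases "on_top m i (heap_of m u empty_heap)")
    case True
    then obtain v' where v': "v' \<in> lists {1..n}" "length v = Suc (length v')"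
        "word_value W s v = s i \<otimes> word_value W s v'"
      using on_top_word[OF v(1) i] v eq by auto
    have "word_value W s (i # u) = word_value W s v'" 
      using v(2) v'(3) gen_cancel[OF i word_value_closed[OF v'(1)]] by simp
    moreover have "length v' = heap_size n (heap_of m (i # u) empty_heap)"
      using True v' v(3) heap_size_pop[OF i True] by (simp add: heap_step_def)
    ultimately show ?thesis using v' by auto
  next
    case False
    then show ?thesis using v i heap_size_push[OF i]
      by (intro bexI[of _ "i # v"]) (auto simp: heap_step_def)
  qed
qed

abbreviation "len \<equiv> word_length W s n"

text \<open>The length is the number of letters of the heap: a letter changes that number by one, and a
  word whose heap is smaller than the word can be shortened.\<close>

lemma len_eq: "w \<in> carrier W \<Longrightarrow> len w = heap_size n (heap w)"
proof -
  assume "w \<in> carrier W"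
  then obtain u where u: "u \<in> lists {1..n}" "w = word_value W s u" by (auto simp: carrier_word)
  show ?thesis unfolding word_length_def
  proof (rule Least_equality)
    show "\<exists>v\<in>lists {1..n}. length v = heap_size n (heap w) \<and> word_value W s v = w"
      using reduced_word_exists[OF u(1)] u heap_word by auto
  next
    fix y assume "\<exists>u\<in>lists {1..n}. length u = y \<and> word_value W s u = w"
    then show "heap_size n (heap w) \<le> y" using heap_word heap_size_le by metis
  qed
qed

lemma len_descent:
  assumes "i \<in> {1..n}" "w \<in> carrier W" "descent i w"
  shows "Suc (len (s i \<otimes> w)) = len w"
  using assms heap_size_pop[of i n m "heap w"]
  by (simp add: len_eq heap_mult heap_step_def descent_def)

lemma len_ascent:
  assumes "i \<in> {1..n}" "w \<in> carrier W" "\<not> descent i w"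
  shows "len (s i \<otimes> w) = Suc (len w)"
  using assms heap_size_push[of i n m "heap w"]
  by (simp add: len_eq heap_mult heap_step_def descent_def)

lemma descent_mult:
  assumes "i \<in> {1..n}" "w \<in> carrier W"
  shows "descent i (s i \<otimes> w) \<longleftrightarrow> \<not> descent i w"
  using assms on_top_step heap_in by (simp add: descent_def heap_mult)

text \<open>If the letters did not commute, the entry of the heap at \<open>(i, k)\<close> would have to begin with
  both of them.\<close>

lemma two_descents_indep:
  "descent i w \<Longrightarrow> descent k w \<Longrightarrow> i \<noteq> k \<Longrightarrow> indep i k"
  using on_top_both_imp_independent by (simp add: descent_def)

lemma descent_mult_indep:
  "i \<in> {1..n} \<Longrightarrow> w \<in> carrier W \<Longrightarrow> indep i k \<Longrightarrow> descent k (s i \<otimes> w) \<longleftrightarrow> descent k w"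
  by (simp add: descent_def heap_mult on_top_step_independent)

lemma descent_one: "\<not> descent i \<one>"
  using on_top_nonempty[of m i empty_heap] by (auto simp: descent_def heap_one)

lemma no_descent_imp_one:
  assumes "w \<in> carrier W" "\<And>i. i \<in> {1..n} \<Longrightarrow> \<not> descent i w"
  shows "w = \<one>"
proof -
  obtain u where u: "u \<in> lists {1..n}" "w = word_value W s u" using assms by (auto simp: carrier_word)
  obtain v where v: "v \<in> lists {1..n}" "word_value W s v = w" "length v = len w"
    using reduced_word_exists[OF u(1)] u heap_word len_eq assms(1) by metis
  show ?thesis
  proof (cases v)
    case Nil
    then show ?thesis using v by simp
  next
    case (Cons i v')
    then have i: "i \<in> {1..n}" and v': "v' \<in> lists {1..n}" using v by auto
    have "len (s i \<otimes> w) \<le> length v'"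
      using heap_size_le[OF v'] heap_word[OF v'] v Cons gen_cancel[OF i word_value_closed[OF v']]
        len_eq[OF word_value_closed[OF v']] by auto
    moreover have "len (s i \<otimes> w) = Suc (len w)" using len_ascent assms i by blast
    ultimately show ?thesis using v Cons by simp
  qed
qed

lemma gen_inj: "i \<in> {1..n} \<Longrightarrow> k \<in> {1..n} \<Longrightarrow> s i = s k \<Longrightarrow> i = k"
proof (rule ccontr)
  assume i: "i \<in> {1..n}" and k: "k \<in> {1..n}" and eq: "s i = s k" and ne: "i \<noteq> k"
  have e: "heap_step m j empty_heap = heap_push m j empty_heap" for j
    using on_top_nonempty[of m j empty_heap] by (auto simp: heap_step_def)
  have "heap (s j) = heap_push m j empty_heap" if "j \<in> {1..n}" for j
    using heap_word[of "[j]"] that e by simp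
  then have "heap_push m i empty_heap i i = heap_push m k empty_heap i i" using i k eq by metis
  then show False using ne by (simp add: heap_push_def affects_diag)
qed

lemma gen_ne_one: "i \<in> {1..n} \<Longrightarrow> s i \<noteq> \<one>"
  using descent_one descent_mult[of i \<one>] by auto

text \<open>Alternating words in two letters with \<open>m i k = \<infinity>\<close> never cancel.\<close>

lemma infinite_dihedral:
  assumes "i \<in> {1..n}" "k \<in> {1..n}" "i \<noteq> k" "noncommuting m i k" "T \<subseteq> {1..n}" "i \<in> T" "k \<in> T"
  shows "infinite (special_subgroup W s T)"
proof -
  define alt where "alt r = concat (replicate r [i, k])" for r :: nat
  have alt_in: "alt r \<in> lists T" for r
    using assms unfolding alt_def by (induction r) auto
  have alt_in': "alt r \<in> lists {1..n}" for r
    using alt_in assms by (meson in_listsI in_listsD subsetD lists_mono)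
  have aff: "affects m i i k" "affects m k i k" using assms by (auto simp: affects_def)
  have *: "heap_of m (alt r) empty_heap i k = alt r" for r
  proof (induction r)
    case 0
    show ?case by (simp add: alt_def)
  next
    case (Suc r)
    let ?\<omega> = "heap_of m (alt r) empty_heap"
    have ne: "\<not> on_top m k ?\<omega>"
    proof
      assume "on_top m k ?\<omega>"
      then have "alt r \<noteq> [] \<and> hd (alt r) = k" using aff Suc unfolding on_top_def by metis
      then show False using assms(3) by (cases r) (auto simp: alt_def)
    qed
    have "heap_step m k ?\<omega> i k = k # alt r"
      using ne aff Suc by (simp add: heap_step_def heap_push_def)
    moreover have "\<not> on_top m i (heap_step m k ?\<omega>)"
      using calculation aff(1) assms(3) unfolding on_top_def by (metis list.sel(1))
    ultimately have "heap_step m i (heap_step m k ?\<omega>) i k = i # k # alt r"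
      using aff by (simp add: heap_step_def heap_push_def)
    then show ?case by (simp add: alt_def)
  qed
  have len: "length (alt r) = 2 * r" for r
    unfolding alt_def by (induction r) auto
  have "inj (\<lambda>r. word_value W s (alt r))"
  proof (rule injI)
    fix r r' assume "word_value W s (alt r) = word_value W s (alt r')"
    then have "heap_of m (alt r) empty_heap = heap_of m (alt r') empty_heap"
      using heap_word[OF alt_in', of r] heap_word[OF alt_in', of r'] by simp
    then have "heap_of m (alt r) empty_heap i k = heap_of m (alt r') empty_heap i k" by (rule fun_cong[OF fun_cong])
    then have "alt r = alt r'" unfolding * .
    then have "length (alt r) = length (alt r')" by (rule arg_cong)
    then show "r = r'" unfolding len by linarith
  qed
  moreover have "range (\<lambda>r. word_value W s (alt r)) \<subseteq> special_subgroup W s T"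
    using alt_in special_subgroup_word[OF assms(5)] by auto
  ultimately show ?thesis
    using range_inj_infinite infinite_super by blast
qed

lemma spherical_imp_indep:
  assumes "T \<in> spherical_subsets W s n" "i \<in> T" "k \<in> T" "i \<noteq> k"
  shows "indep i k"
proof -
  have "T \<subseteq> {1..n}" "finite (special_subgroup W s T)" using assms by (auto simp: spherical_subsets_def)
  then show ?thesis using infinite_dihedral[of i k T] assms by blast
qed

lemma empty_spherical: "{} \<in> spherical_subsets W s n"
  by (simp add: spherical_subsets_def special_subgroup_word lists_empty)

lemma singleton_spherical: "i \<in> {1..n} \<Longrightarrow> {i} \<in> spherical_subsets W s n"
proof -
  assume i: "i \<in> {1..n}"
  have "word_value W s u \<in> {\<one>, s i}" if "u \<in> lists {i}" for u
    using that
  proof (induction u)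
    case (Cons a u)
    then show ?case using i gen_square by auto
  qed simp
  then have "special_subgroup W s {i} \<subseteq> {\<one>, s i}"
    using special_subgroup_word[of "{i}"] i by auto
  then show ?thesis using i finite_subset by (auto simp: spherical_subsets_def)
qed

lemma finite_spherical_subsets: "finite (spherical_subsets W s n)"
  by (rule finite_subset[of _ "Pow {1..n}"]) (auto simp: spherical_subsets_def)

end

section \<open>Panels, gates and residues of a right-angled building\<close>

locale ra_building = racg W s n m
  for W :: "('w, 'x) monoid_scheme" (structure) and s n m +
  fixes q :: "nat \<Rightarrow> nat" and C :: "'c set" and \<delta> :: "'c \<Rightarrow> 'c \<Rightarrow> 'w"
  assumes regular: "regular_building W s n q C \<delta>"
begin

abbreviation "I \<equiv> {1..n}"

lemma building: "building W s n C \<delta>"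
  using regular by (simp add: regular_building_def)

lemma chambers_nonempty: "C \<noteq> {}"
  using building by (simp add: building_def)

lemma delta_closed [simp]: "c \<in> C \<Longrightarrow> d \<in> C \<Longrightarrow> \<delta> c d \<in> carrier W"
  using building by (simp add: building_def)

lemma delta_one_iff: "c \<in> C \<Longrightarrow> d \<in> C \<Longrightarrow> \<delta> c d = \<one> \<longleftrightarrow> c = d"
  using building by (simp add: building_def)

lemma delta_step:
  assumes "c \<in> C" "d \<in> C" "c' \<in> C" "i \<in> I" "\<delta> c' c = s i"
  shows "\<delta> c' d = s i \<otimes> \<delta> c d \<or> \<delta> c' d = \<delta> c d"
    and "\<not> descent i (\<delta> c d) \<Longrightarrow> \<delta> c' d = s i \<otimes> \<delta> c d"
proof -
  have *: "\<delta> c' d \<in> {s i \<otimes> \<delta> c d, \<delta> c d} \<and>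
        (len (s i \<otimes> \<delta> c d) = len (\<delta> c d) + 1 \<longrightarrow> \<delta> c' d = s i \<otimes> \<delta> c d)"
    using building assms unfolding building_def by blast
  then show "\<delta> c' d = s i \<otimes> \<delta> c d \<or> \<delta> c' d = \<delta> c d" by blast
  show "\<delta> c' d = s i \<otimes> \<delta> c d" if "\<not> descent i (\<delta> c d)"
    using * len_ascent[of i "\<delta> c d"] that assms by simp
qed

lemma delta_extend:
  assumes "c \<in> C" "d \<in> C" "i \<in> I"
  obtains c' where "c' \<in> C" "\<delta> c' c = s i" "\<delta> c' d = s i \<otimes> \<delta> c d"
proof -
  have "\<forall>c\<in>C. \<forall>d\<in>C. \<forall>i\<in>I. \<exists>c'\<in>C. \<delta> c' c = s i \<and> \<delta> c' d = s i \<otimes> \<delta> c d"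
    using building unfolding building_def by (elim conjE)
  from bspec[OF bspec[OF bspec[OF this assms(1)] assms(2)] assms(3)] show ?thesis
    using that by (elim bexE conjE)
qed

definition adj :: "nat \<Rightarrow> 'c \<Rightarrow> 'c \<Rightarrow> bool" where
  "adj i c d \<longleftrightarrow> c \<in> C \<and> d \<in> C \<and> (c = d \<or> \<delta> c d = s i)"

lemma adj_closed: "adj i c d \<Longrightarrow> c \<in> C" "adj i c d \<Longrightarrow> d \<in> C"
  by (simp_all add: adj_def)

lemma adj_refl: "c \<in> C \<Longrightarrow> adj i c c"
  by (simp add: adj_def)

text \<open>The axioms give no symmetry of \<open>\<delta>\<close> directly; it comes from comparing \<open>c\<close> and
  \<open>d\<close> as seen from \<open>c\<close> itself.\<close>

lemma adj_sym: "i \<in> I \<Longrightarrow> adj i c d \<Longrightarrow> adj i d c"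
proof -
  assume i: "i \<in> I" and a: "adj i c d"
  show ?thesis
  proof (cases "c = d")
    case False
    have cd: "c \<in> C" "d \<in> C" "\<delta> c d = s i" using a False by (auto simp: adj_def)
    have "\<delta> c c = \<one>" "\<delta> d c \<noteq> \<one>" using cd delta_one_iff False by auto
    then have "s i \<otimes> \<delta> d c = \<one>" using delta_step(1)[OF cd(2,1,1) i cd(3)] by metis
    then have "\<delta> d c = s i" using gen_cancel[of i "\<delta> d c"] cd i by simp
    then show ?thesis using cd by (simp add: adj_def)
  qed (use a in simp)
qed

lemma adj_delta:
  assumes "adj i c d" "x \<in> C" "i \<in> I"
  shows "\<delta> c x = \<delta> d x \<or> \<delta> c x = s i \<otimes> \<delta> d x"
  using assms delta_step(1)[of d x c i] by (auto simp: adj_def)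

lemma adj_trans: "i \<in> I \<Longrightarrow> adj i c d \<Longrightarrow> adj i d e \<Longrightarrow> adj i c e"
proof -
  assume i: "i \<in> I" and a: "adj i c d" "adj i d e"
  show ?thesis
  proof (cases "d = e")
    case False
    have cl: "c \<in> C" "d \<in> C" "e \<in> C" and "\<delta> d e = s i" using a False by (auto simp: adj_def)
    then have "\<delta> c e = s i \<or> \<delta> c e = \<one>" using adj_delta[OF a(1), of e] i gen_square by auto
    then show ?thesis using cl delta_one_iff by (auto simp: adj_def)
  qed (use a in simp)
qed

lemma adj_two_types: "i \<in> I \<Longrightarrow> k \<in> I \<Longrightarrow> i \<noteq> k \<Longrightarrow> adj i c d \<Longrightarrow> adj k c d \<Longrightarrow> c = d"
  using gen_inj unfolding adj_def by metis

lemma panel_finite: "i \<in> I \<Longrightarrow> c \<in> C \<Longrightarrow> finite {d. adj i c d}"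
  and panel_card: "i \<in> I \<Longrightarrow> c \<in> C \<Longrightarrow> card {d. adj i c d} = q i"
proof -
  assume "i \<in> I" "c \<in> C"
  moreover have "{d. adj i c d} = {d \<in> C. d = c \<or> \<delta> c d = s i}"
    using \<open>c \<in> C\<close> by (auto simp: adj_def)
  ultimately show "finite {d. adj i c d}" "card {d. adj i c d} = q i"
    using regular by (auto simp: regular_building_def)
qed

lemma panel_gate_exists:
  assumes "i \<in> I" "c \<in> C" "x \<in> C"
  shows "\<exists>!g. adj i c g \<and> \<not> descent i (\<delta> g x)"
proof (rule ex_ex1I)
  show "\<exists>g. adj i c g \<and> \<not> descent i (\<delta> g x)"
  proof (cases "descent i (\<delta> c x)")
    case True
    obtain c' where c': "c' \<in> C" "\<delta> c' c = s i" "\<delta> c' x = s i \<otimes> \<delta> c x"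
      using delta_extend[of c x i] assms by blast
    have "adj i c c'" using c' assms adj_sym[of i c' c] by (simp add: adj_def)
    moreover have "\<not> descent i (\<delta> c' x)" using c' True descent_mult[of i "\<delta> c x"] assms by simp
    ultimately show ?thesis by blast
  qed (use adj_refl assms in blast)
next
  fix g h assume g: "adj i c g \<and> \<not> descent i (\<delta> g x)" and h: "adj i c h \<and> \<not> descent i (\<delta> h x)"
  have gh: "adj i g h" using g h adj_sym[of i c g] adj_trans[of i g c h] assms by blast
  show "g = h"
  proof (rule ccontr)
    assume "g \<noteq> h"
    then have "\<delta> g x = s i \<otimes> \<delta> h x"
      using gh delta_step(2)[of h x g i] h assms by (auto simp: adj_def)
    then show False using g h descent_mult[of i "\<delta> h x"] gh assms by (simp add: adj_def)
  qed
qed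

text \<open>The chamber of the \<open>i\<close>-panel of \<open>c\<close> nearest to the base chamber
  \<open>x\<close>.\<close>

definition gate :: "'c \<Rightarrow> nat \<Rightarrow> 'c \<Rightarrow> 'c" where
  "gate x i c = (THE g. adj i c g \<and> \<not> descent i (\<delta> g x))"

lemma gate:
  assumes "i \<in> I" "c \<in> C" "x \<in> C"
  shows "adj i c (gate x i c)" "\<not> descent i (\<delta> (gate x i c) x)"
  using theI'[OF panel_gate_exists[OF assms]] unfolding gate_def by auto

lemma gate_unique:
  "i \<in> I \<Longrightarrow> x \<in> C \<Longrightarrow> adj i c g \<Longrightarrow> \<not> descent i (\<delta> g x) \<Longrightarrow> gate x i c = g"
  using panel_gate_exists[of i c x] gate[of i c x] adj_closed(1)[of i c g] by blast

lemma gate_closed: "i \<in> I \<Longrightarrow> c \<in> C \<Longrightarrow> x \<in> C \<Longrightarrow> gate x i c \<in> C"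
  using gate(1) adj_closed(2) by blast

lemma gate_adj: "i \<in> I \<Longrightarrow> x \<in> C \<Longrightarrow> adj i c d \<Longrightarrow> gate x i d = gate x i c"
  by (meson adj_closed(1) adj_sym adj_trans gate(1) gate(2) gate_unique)

lemma gate_fixed: "i \<in> I \<Longrightarrow> c \<in> C \<Longrightarrow> x \<in> C \<Longrightarrow> gate x i c = c \<longleftrightarrow> \<not> descent i (\<delta> c x)"
  by (metis adj_refl gate(2) gate_unique)

lemma delta_gate:
  assumes "i \<in> I" "c \<in> C" "x \<in> C" "descent i (\<delta> c x)"
  shows "\<delta> c x = s i \<otimes> \<delta> (gate x i c) x" "\<delta> (gate x i c) x = s i \<otimes> \<delta> c x"
    "Suc (len (\<delta> (gate x i c) x)) = len (\<delta> c x)"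
proof -
  have g: "adj i c (gate x i c)" "\<not> descent i (\<delta> (gate x i c) x)" using gate assms by auto
  then show 1: "\<delta> c x = s i \<otimes> \<delta> (gate x i c) x"
    using adj_delta[OF g(1) assms(3,1)] assms by auto
  then show 2: "\<delta> (gate x i c) x = s i \<otimes> \<delta> c x" using gen_cancel gate_closed assms by simp
  then show "Suc (len (\<delta> (gate x i c) x)) = len (\<delta> c x)" using len_descent assms by simp
qed

lemma descent_of_nongate:
  assumes "i \<in> I" "x \<in> C" "adj i c d" "d \<noteq> gate x i c"
  shows "descent i (\<delta> d x)"
  using assms gate_adj gate_fixed adj_closed by metis

text \<open>A gallery of type \<open>(i, k)\<close> with commuting letters has Weyl distance \<open>s i s k = s k s i\<close>,
  and the extension axiom realises it by a gallery of type \<open>(k, i)\<close>.\<close>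

lemma square:
  assumes ik: "i \<in> I" "k \<in> I" "indep i k" and "adj i c d" "adj k d e"
  shows "\<exists>d'. adj k c d' \<and> adj i d' e"
proof (cases "c = d \<or> d = e")
  case True
  then show ?thesis using assms adj_refl adj_closed by metis
next
  case False
  then have cl: "c \<in> C" "d \<in> C" "e \<in> C" and cd: "\<delta> c d = s i" and de: "\<delta> d e = s k"
    using assms by (auto simp: adj_def)
  have "indep k i" using ik noncommuting_sym by blast
  then have "\<not> descent i (s k)"
    using descent_mult_indep[of k \<one> i] ik descent_one by simp
  then have ce: "\<delta> c e = s i \<otimes> s k" using delta_step(2)[of d e c i] cl cd de ik by simp
  obtain c' where c': "c' \<in> C" "\<delta> c' c = s k" "\<delta> c' e = s k \<otimes> \<delta> c e"
    using delta_extend[of c e k] cl ik by blast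
  have "\<delta> c' e = s i" using c' ce gen_commute[OF ik] gen_cancel[of k "s i"] ik by simp
  then have "adj i c' e" using c' cl by (simp add: adj_def)
  moreover have "adj k c c'" using c' cl adj_sym[of k c' c] ik by (simp add: adj_def)
  ultimately show ?thesis by blast
qed

lemma descent_gate_indep:
  assumes "i \<in> I" "k \<in> I" "c \<in> C" "x \<in> C" "indep i k" "descent i (\<delta> c x)"
  shows "descent k (\<delta> (gate x i c) x) \<longleftrightarrow> descent k (\<delta> c x)"
  using assms delta_gate(2)[of i c x] descent_mult_indep[of i "\<delta> c x" k] by simp

text \<open>The square through the two gates of \<open>c\<close> has a fourth corner. Seen from \<open>x\<close> it
  cannot be at the distance of either gate, since that would identify two generators, so it is the
  gate of both gates. This is the confluence on which the constructions by recursion on the distance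
  from \<open>x\<close> rest.\<close>

lemma gate_commute:
  assumes ik: "i \<in> I" "k \<in> I" "i \<noteq> k" and c: "c \<in> C" "x \<in> C"
    and di: "descent i (\<delta> c x)" and dk: "descent k (\<delta> c x)"
  shows "gate x k (gate x i c) = gate x i (gate x k c)"
proof -
  let ?g = "gate x i c" and ?h = "gate x k c" and ?w = "\<delta> c x"
  have ind: "indep i k" "indep k i" using two_descents_indep di dk ik noncommuting_sym by blast+
  have g: "adj i ?g c" and h: "adj k c ?h" using gate adj_sym ik c by auto
  obtain d where d: "adj k ?g d" "adj i d ?h" using square[OF ik(1,2) ind(1) g h] by blast
  have cl: "?g \<in> C" "?h \<in> C" "d \<in> C" using g h d adj_closed by auto
  have gw: "\<delta> ?g x = s i \<otimes> ?w" and hw: "\<delta> ?h x = s k \<otimes> ?w" using delta_gate di dk ik c by auto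
  have dg: "descent k (\<delta> ?g x)" using descent_gate_indep ind ik c di dk by blast
  have nd: "\<delta> d x \<noteq> \<delta> ?g x"
  proof
    assume e: "\<delta> d x = \<delta> ?g x"
    have "\<delta> d x = s k \<otimes> ?w \<or> \<delta> d x = s i \<otimes> (s k \<otimes> ?w)"
      using adj_delta[OF d(2) c(2) ik(1)] hw by simp
    then have "s i \<otimes> ?w = s k \<otimes> ?w \<or> s i \<otimes> ?w = s i \<otimes> (s k \<otimes> ?w)" using e gw by simp
    then have "s i \<otimes> ?w = s k \<otimes> ?w \<or> ?w = s k \<otimes> ?w"
      using ik c l_cancel_one[of "s i" ?w] gen_cancel[OF ik(1)] by (metis delta_closed gen_closed m_closed)
    then have "s i = s k \<or> s k = \<one>"
      using ik c r_cancel_one'[of ?w "s k"] right_cancel[of ?w "s i" "s k"] by auto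
    then show False using ik gen_inj[of i k] gen_ne_one[of k] by blast
  qed
  have dw: "\<delta> d x = s k \<otimes> (s i \<otimes> ?w)"
    using adj_delta[OF adj_sym[OF ik(2) d(1)] c(2) ik(2)] nd gw by auto
  have "\<not> descent k (\<delta> d x)"
    using dw descent_mult[of k "s i \<otimes> ?w"] dg gw ik c by simp
  then have 1: "gate x k ?g = d" using gate_unique d ik c by blast
  have "\<not> descent i (\<delta> d x)"
    using dw descent_mult_indep[of k "s i \<otimes> ?w" i] descent_mult[of i ?w] di ind ik c by simp
  then have "gate x i ?h = d" using gate_unique[OF ik(1) c(2) adj_sym[OF ik(1) d(2)]] by blast
  with 1 show ?thesis by simp
qed

definition residue :: "nat set \<Rightarrow> 'c \<Rightarrow> 'c \<Rightarrow> bool" where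
  "residue T c d \<longleftrightarrow> c \<in> C \<and> (\<lambda>c d. \<exists>i\<in>T. adj i c d)\<^sup>*\<^sup>* c d"

lemma residue_refl: "c \<in> C \<Longrightarrow> residue T c c"
  by (simp add: residue_def)

lemma residue_closed: "residue T c d \<Longrightarrow> c \<in> C" "residue T c d \<Longrightarrow> d \<in> C"
proof -
  assume a: "residue T c d"
  then show "c \<in> C" by (simp add: residue_def)
  have "(\<lambda>c d. \<exists>i\<in>T. adj i c d)\<^sup>*\<^sup>* c d" "c \<in> C" using a by (auto simp: residue_def)
  then show "d \<in> C" by (induction rule: rtranclp_induct) (auto dest: adj_closed)
qed

lemma residue_trans: "residue T c d \<Longrightarrow> residue T d e \<Longrightarrow> residue T c e"
  unfolding residue_def by (meson rtranclp_trans)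

lemma residue_adj: "i \<in> T \<Longrightarrow> adj i c d \<Longrightarrow> residue T c d"
  unfolding residue_def by (auto dest: adj_closed intro!: r_into_rtranclp)

lemma residue_sym:
  assumes "T \<subseteq> I" "residue T c d" shows "residue T d c"
proof -
  have "(\<lambda>c d. \<exists>i\<in>T. adj i c d)\<^sup>*\<^sup>* c d" "c \<in> C" using assms by (auto simp: residue_def)
  then show ?thesis
  proof (induction rule: rtranclp_induct)
    case (step d e)
    then obtain i where "i \<in> T" "adj i d e" by blast
    then have "residue T e d" using adj_sym[of i d e] residue_adj assms by blast
    then show ?case using step residue_trans by blast
  qed (rule residue_refl)
qed

lemma residue_mono: "T \<subseteq> U \<Longrightarrow> residue T c d \<Longrightarrow> residue U c d"
proof -
  assume "T \<subseteq> U" "residue T c d"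
  moreover from this have "(\<lambda>c d. \<exists>i\<in>T. adj i c d) \<le> (\<lambda>c d. \<exists>i\<in>U. adj i c d)" by auto
  ultimately show ?thesis using rtranclp_mono unfolding residue_def by blast
qed

lemma residue_empty: "residue {} c d \<longleftrightarrow> c \<in> C \<and> c = d"
proof -
  have "(\<lambda>c d :: 'c. False)\<^sup>*\<^sup>* c d \<longleftrightarrow> c = d"
    by (metis rtranclp.rtrancl_refl rtranclp.cases)
  then show ?thesis by (simp add: residue_def)
qed

lemma residue_induct [consumes 1, case_names base step]:
  assumes "residue T c d" "P d"
    "\<And>c e i. i \<in> T \<Longrightarrow> adj i c e \<Longrightarrow> residue T e d \<Longrightarrow> P e \<Longrightarrow> P c"
  shows "P c"
proof -
  have "(\<lambda>c d. \<exists>i\<in>T. adj i c d)\<^sup>*\<^sup>* c d" "c \<in> C" using assms(1) by (auto simp: residue_def)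
  then show ?thesis
  proof (induction rule: converse_rtranclp_induct)
    case (step c e)
    then obtain i where i: "i \<in> T" "adj i c e" by blast
    then have "e \<in> C" using adj_closed by blast
    then have "residue T e d" using step by (simp add: residue_def)
    then show ?case using assms(3) i step \<open>e \<in> C\<close> by blast
  qed (use assms in blast)
qed

lemma residue_iff_delta:
  assumes T: "T \<subseteq> I" and cd: "c \<in> C" "d \<in> C"
  shows "\<delta> c d \<in> special_subgroup W s T \<longleftrightarrow> residue T c d"
proof
  assume "\<delta> c d \<in> special_subgroup W s T"
  then obtain u where u: "u \<in> lists T" "\<delta> c d = word_value W s u"
    using special_subgroup_word[OF T] by auto
  have "c \<in> C \<Longrightarrow> \<delta> c d = word_value W s u \<Longrightarrow> residue T c d"
    using u(1)
  proof (induction u arbitrary: c)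
    case Nil
    then show ?case using cd delta_one_iff residue_refl by auto
  next
    case (Cons i u)
    then have i: "i \<in> T" "i \<in> I" and u: "u \<in> lists I" using T by auto
    obtain c' where c': "c' \<in> C" "\<delta> c' c = s i" "\<delta> c' d = s i \<otimes> \<delta> c d"
      using delta_extend[of c d i] Cons cd i by blast
    then have "\<delta> c' d = word_value W s u"
      using Cons.prems i u gen_cancel[of i "word_value W s u"] by simp
    then have "residue T c' d" using Cons c' by simp
    moreover have "adj i c c'" using c' Cons.prems adj_sym[of i c' c] i by (simp add: adj_def)
    ultimately show ?case using residue_adj residue_trans i by blast
  qed
  then show "residue T c d" using cd u by blast
next
  assume "residue T c d"
  then show "\<delta> c d \<in> special_subgroup W s T"
  proof (induction rule: residue_induct)
    case base
    have "\<delta> d d = \<one>" using cd delta_one_iff by blast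
    then show ?case by (simp add: special_subgroup_def generate.one)
  next
    case (step c e i)
    then have "\<delta> c d = \<delta> e d \<or> \<delta> c d = s i \<otimes> \<delta> e d" using adj_delta[of i c e d] cd T by blast
    moreover have "s i \<otimes> \<delta> e d \<in> special_subgroup W s T"
      using step unfolding special_subgroup_def by (auto intro: generate.intros)
    ultimately show ?case using step by auto
  qed
qed

lemma gallery_connected: "c \<in> C \<Longrightarrow> d \<in> C \<Longrightarrow> residue I c d"
  using residue_iff_delta[of I c d] special_subgroup_word[of I] carrier_word delta_closed[of c d]
  by blast

text \<open>Galleries of reduced type are mapped to galleries of the same type, and a reduced type determines
  the Weyl distance.\<close>

lemma delta_preserved:
  assumes f: "\<And>c. c \<in> C \<Longrightarrow> f c \<in> C" and inj: "inj_on f C"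
    and adj: "\<And>i c d. i \<in> I \<Longrightarrow> adj i c d \<Longrightarrow> adj i (f c) (f d)"
    and cd: "c \<in> C" "d \<in> C"
  shows "\<delta> (f c) (f d) = \<delta> c d"
  using cd
proof (induction "len (\<delta> c d)" arbitrary: c rule: less_induct)
  case less
  show ?case
  proof (cases "\<exists>i\<in>I. descent i (\<delta> c d)")
    case True
    then obtain i where i: "i \<in> I" "descent i (\<delta> c d)" by blast
    let ?g = "gate d i c"
    note g = gate_closed[OF i(1) less.prems] gate[OF i(1) less.prems]
    have "Suc (len (\<delta> ?g d)) = len (\<delta> c d)" and gd: "\<delta> c d = s i \<otimes> \<delta> ?g d"
      using delta_gate[OF i(1) less.prems i(2)] by blast+
    then have lt: "len (\<delta> ?g d) < len (\<delta> c d)" by linarith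
    have IH: "\<delta> (f ?g) (f d) = \<delta> ?g d" 
      using less.hyps[OF lt g(1) less.prems(2)] .
    have "c \<noteq> ?g" using g(3) i(2) by metis
    then have "f c \<noteq> f ?g" using inj_onD[OF inj _ less.prems(1) g(1)] by blast
    then have "\<delta> (f c) (f ?g) = s i" using adj[OF i(1) g(2)] unfolding adj_def by blast
    then have "\<delta> (f c) (f d) = s i \<otimes> \<delta> ?g d"
      using delta_step(2)[of "f ?g" "f d" "f c" i] IH g(1,3) f less.prems i(1) by simp
    then show ?thesis using gd by simp
  next
    case False
    then have "c = d" using no_descent_imp_one[of "\<delta> c d"] delta_one_iff less.prems by auto
    then show ?thesis using delta_one_iff f less.prems by metis
  qed
qed

end

section \<open>Colourings and maps out of the building\<close>

definition chamber_system ::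
  "nat set \<Rightarrow> (nat \<Rightarrow> nat \<Rightarrow> bool) \<Rightarrow> 'y set \<Rightarrow> (nat \<Rightarrow> 'y \<Rightarrow> 'y \<Rightarrow> bool) \<Rightarrow> bool" where
  "chamber_system I R X E \<longleftrightarrow>
     (\<forall>i\<in>I. (\<forall>y z. E i y z \<longrightarrow> y \<in> X \<and> z \<in> X \<and> E i z y) \<and> (\<forall>y\<in>X. E i y y) \<and>
        (\<forall>x y z. E i x y \<longrightarrow> E i y z \<longrightarrow> E i x z)) \<and>
     (\<forall>i\<in>I. \<forall>k\<in>I. R i k \<longrightarrow> (\<forall>x y z. E i x y \<longrightarrow> E k y z \<longrightarrow> (\<exists>y'. E k x y' \<and> E i y' z)))"

text \<open>Each panel of type \<open>i\<close> shows every \<open>i\<close>-colour once, and the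
  \<open>k\<close>-colour is constant on it for every other \<open>k\<close>, whether or not \<open>i\<close> and
  \<open>k\<close> commute.\<close>

definition proper_colouring ::
  "nat set \<Rightarrow> (nat \<Rightarrow> nat) \<Rightarrow> 'y set \<Rightarrow> (nat \<Rightarrow> 'y \<Rightarrow> 'y \<Rightarrow> bool) \<Rightarrow> ('y \<Rightarrow> nat \<Rightarrow> nat) \<Rightarrow> bool" where
  "proper_colouring I q X E col \<longleftrightarrow>
     (\<forall>y\<in>X. \<forall>i\<in>I. col y i < q i \<and> (\<forall>x<q i. \<exists>z. E i y z \<and> col z i = x)) \<and>
     (\<forall>i\<in>I. \<forall>y z. E i y z \<longrightarrow>
        (col y i = col z i \<longrightarrow> y = z) \<and> (\<forall>k\<in>I. k \<noteq> i \<longrightarrow> col y k = col z k))"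

definition colour_morphism where
  "colour_morphism I X E col X' E' col' f \<longleftrightarrow>
     (\<forall>y\<in>X. f y \<in> X' \<and> (\<forall>i\<in>I. col' (f y) i = col y i)) \<and>
     (\<forall>i\<in>I. \<forall>y z. E i y z \<longrightarrow> E' i (f y) (f z))"

lemma chamber_systemD:
  assumes "chamber_system I R X E" "i \<in> I"
  shows "E i y z \<Longrightarrow> y \<in> X" "E i y z \<Longrightarrow> z \<in> X" "E i y z \<Longrightarrow> E i z y" "y \<in> X \<Longrightarrow> E i y y"
    "E i x y \<Longrightarrow> E i y z \<Longrightarrow> E i x z"
    "k \<in> I \<Longrightarrow> R i k \<Longrightarrow> E i x y \<Longrightarrow> E k y z \<Longrightarrow> \<exists>y'. E k x y' \<and> E i y' z"
  using assms unfolding chamber_system_def by metis+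

lemma proper_colouringD:
  assumes "proper_colouring I q X E col" "i \<in> I"
  shows "y \<in> X \<Longrightarrow> col y i < q i" "y \<in> X \<Longrightarrow> x < q i \<Longrightarrow> \<exists>z. E i y z \<and> col z i = x"
    "E i y z \<Longrightarrow> col y i = col z i \<Longrightarrow> y = z"
    "E i y z \<Longrightarrow> k \<in> I \<Longrightarrow> k \<noteq> i \<Longrightarrow> col y k = col z k"
  using assms unfolding proper_colouring_def by metis+

lemma colour_morphismD:
  assumes "colour_morphism I X E col X' E' col' f"
  shows "y \<in> X \<Longrightarrow> f y \<in> X'" "y \<in> X \<Longrightarrow> i \<in> I \<Longrightarrow> col' (f y) i = col y i"
    "i \<in> I \<Longrightarrow> E i y z \<Longrightarrow> E' i (f y) (f z)"
  using assms unfolding colour_morphism_def by metis+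

lemma length_recursion:
  fixes L :: "'a \<Rightarrow> nat" and F :: "('a \<Rightarrow> 'b) \<Rightarrow> 'a \<Rightarrow> 'b"
  shows "\<exists>f. \<forall>d. f d = F (\<lambda>e. if L e < L d then f e else undefined) d"
proof -
  have "wfrec (Wellfounded.measure L) F d = F (\<lambda>e. if L e < L d then wfrec (Wellfounded.measure L) F e else undefined) d" for d
    by (subst wfrec[OF wf_measure]) (simp add: cut_def)
  then show ?thesis by blast
qed

lemma injection_with_value:
  assumes "finite P" "card P = r" "g \<in> P" "x < (r::nat)"
  shows "\<exists>b. inj_on b P \<and> b ` P \<subseteq> {..<r} \<and> b g = x"
proof -
  obtain h where h: "bij_betw h P {0..<r}" using ex_bij_betw_finite_nat[OF assms(1)] assms(2) by auto
  let ?b = "\<lambda>y. Transposition.transpose (h g) x (h y)"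
  have hg: "h g < r" using h assms(3) by (auto dest: bij_betwE)
  have "inj_on (Transposition.transpose (h g) x) (h ` P)"
    by (rule inj_on_inverseI[of _ "Transposition.transpose (h g) x"]) simp
  then have "inj_on ?b P"
    using comp_inj_on[OF bij_betw_imp_inj_on[OF h], of "Transposition.transpose (h g) x"]
    by (simp add: comp_def)
  moreover have "?b ` P \<subseteq> {..<r}"
    using h hg assms(4) by (auto simp: Transposition.transpose_def dest: bij_betwE)
  moreover have "?b g = x" by simp
  ultimately show ?thesis by blast
qed

context ra_building
begin

lemma building_chamber_system: "chamber_system I indep C adj"
  unfolding chamber_system_def
proof (intro conjI ballI allI impI)
  fix i x y z assume "i \<in> I" "adj i x y" "adj i y z"
  then show "adj i x z" by (rule adj_trans)
next
  fix i k x y z assume "i \<in> I" "k \<in> I" "indep i k" "adj i x y" "adj k y z"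
  then show "\<exists>y'. adj k x y' \<and> adj i y' z" by (rule square)
qed (use adj_closed adj_sym adj_refl in blast)+

lemma q_pos: "i \<in> I \<Longrightarrow> 0 < q i"
proof -
  assume i: "i \<in> I"
  obtain c where c: "c \<in> C" using chambers_nonempty by blast
  have "c \<in> {d. adj i c d}" using adj_refl c by simp
  then show ?thesis using panel_card[OF i c] panel_finite[OF i c] card_gt_0_iff by (metis empty_iff)
qed

text \<open>The \<open>i\<close>-colour of a chamber is read off at its gate along a descent different from
  \<open>i\<close>, for as long as there is one; \<open>gate_commute\<close> shows that the order of the
  descents does not matter. When \<open>i\<close> is the only descent, the colours of the panel are
  chosen freely subject to the colour of its gate.\<close>

lemma proper_colouring_exists: "\<exists>col. proper_colouring I q C adj col"
proof -
  obtain o1 where o1: "o1 \<in> C" using chambers_nonempty by blast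
  define L where "L d = len (\<delta> d o1)" for d
  define D where "D i d \<longleftrightarrow> descent i (\<delta> d o1)" for i d
  define G where "G i d = gate o1 i d" for i d
  define other where "other i d = (SOME k. k \<in> I \<and> k \<noteq> i \<and> D k d)" for i d
  define pick where "pick P r g x = (SOME b. inj_on b P \<and> b ` P \<subseteq> {..<r} \<and> b g = x)"
    for P :: "'c set" and r :: nat and g and x :: nat
  obtain col where col: "\<And>d. col d = (\<lambda>f d i.
      if \<exists>k. k \<in> I \<and> k \<noteq> i \<and> D k d then f (G (other i d) d) i
      else if D i d then pick {c. adj i d c} (q i) (G i d) (f (G i d) i) d else (0::nat))
      (\<lambda>e. if L e < L d then col e else undefined) d"
    using length_recursion[where L = L and F = "\<lambda>f d i.
      if \<exists>k. k \<in> I \<and> k \<noteq> i \<and> D k d then f (G (other i d) d) i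
      else if D i d then pick {c. adj i d c} (q i) (G i d) (f (G i d) i) d else (0::nat)"] by blast
  have Gcl: "G i d \<in> C" and Gadj: "adj i d (G i d)" and GD: "\<not> D i (G i d)" if "i \<in> I" "d \<in> C" for i d
    using gate_closed gate that o1 by (auto simp: G_def D_def)
  have Glt: "L (G i d) < L d" if "i \<in> I" "d \<in> C" "D i d" for i d
    using delta_gate(3)[OF that(1,2) o1] that(3) unfolding L_def D_def G_def by linarith
  have Gcomm: "G k (G i d) = G i (G k d)"
    if "i \<in> I" "k \<in> I" "i \<noteq> k" "d \<in> C" "D i d" "D k d" for i k d
    using gate_commute[OF that(1-4) o1] that(5,6) by (simp add: D_def G_def)
  have DG: "D k (G i d)" if "i \<in> I" "k \<in> I" "i \<noteq> k" "d \<in> C" "D i d" "D k d" for i k d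
    using descent_gate_indep[OF that(1,2,4) o1] that two_descents_indep by (simp add: D_def G_def)
  have other: "other i d \<in> I \<and> other i d \<noteq> i \<and> D (other i d) d"
    if "k \<in> I" "k \<noteq> i" "D k d" for i k d
    unfolding other_def by (rule someI[of _ k]) (use that in blast)
  have col1: "col d i = col (G (other i d) d) i" if "d \<in> C" "k \<in> I" "k \<noteq> i" "D k d" for d i k
  proof -
    have "L (G (other i d) d) < L d" using Glt other that by blast
    then show ?thesis using that by (subst col) auto
  qed
  have col2: "col d i = pick {c. adj i d c} (q i) (G i d) (col (G i d) i) d"
    if "d \<in> C" "i \<in> I" "\<not> (\<exists>k. k \<in> I \<and> k \<noteq> i \<and> D k d)" "D i d" for d i
    by (subst col) (simp only: that(3,4) if_False if_True Glt[OF that(2,1,4)])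
  have col3: "col d i = 0" if "\<not> (\<exists>k. k \<in> I \<and> k \<noteq> i \<and> D k d)" "\<not> D i d" for d i
    by (subst col) (simp only: that if_False)
  have desc: "col d i = col (G k d) i" if "d \<in> C" "k \<in> I" "k \<noteq> i" "D k d" for d i k
    using that
  proof (induction "L d" arbitrary: d k rule: less_induct)
    case less
    define h where "h = other i d"
    have h: "h \<in> I" "h \<noteq> i" "D h d" using other[of k i d] less.prems unfolding h_def by auto
    have e: "col d i = col (G h d) i" using col1 less.prems unfolding h_def by blast
    show ?case
    proof (cases "h = k")
      case False
      have "col (G h d) i = col (G k (G h d)) i"
        using less.hyps[OF Glt[OF h(1) less.prems(1) h(3)] Gcl[OF h(1) less.prems(1)] less.prems(2,3)]
          DG[OF h(1) less.prems(2) False less.prems(1) h(3) less.prems(4)] by blast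
      also have "\<dots> = col (G h (G k d)) i"
        using Gcomm[OF h(1) less.prems(2) False less.prems(1) h(3) less.prems(4)] by simp
      also have "\<dots> = col (G k d) i"
        using less.hyps[OF Glt[OF less.prems(2,1,4)] Gcl[OF less.prems(2,1)] h(1,2)]
          DG[OF less.prems(2) h(1) False[symmetric] less.prems(1,4) h(3)] by simp
      finally show ?thesis using e by simp
    qed (use e in simp)
  qed
  have pick: "inj_on (pick P r g x) P \<and> pick P r g x ` P \<subseteq> {..<r} \<and> pick P r g x g = x"
    if "finite P" "card P = r" "g \<in> P" "x < r" for P r g x
    using someI_ex[OF injection_with_value[OF that]] unfolding pick_def .
  have bound: "col d i < q i" if "d \<in> C" "i \<in> I" for d i
    using that
  proof (induction "L d" arbitrary: d rule: less_induct)
    case less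
    consider (a) k where "k \<in> I" "k \<noteq> i" "D k d"
      | (b) "\<not> (\<exists>k. k \<in> I \<and> k \<noteq> i \<and> D k d)" "D i d"
      | (c) "\<not> (\<exists>k. k \<in> I \<and> k \<noteq> i \<and> D k d)" "\<not> D i d" by blast
    then show ?case
    proof cases
      case a
      then show ?thesis
        using desc[OF less.prems(1) a] less.hyps[OF Glt[OF a(1) less.prems(1) a(3)]] Gcl[OF a(1)] less.prems
        by simp
    next
      case b
      have lt: "col (G i d) i < q i"
        using less.hyps[OF Glt[OF less.prems(2,1) b(2)]] Gcl less.prems by blast
      have "pick {c. adj i d c} (q i) (G i d) (col (G i d) i) ` {c. adj i d c} \<subseteq> {..<q i}"
        using pick[of "{c. adj i d c}" "q i" "G i d" "col (G i d) i"] lt Gadj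
          panel_finite panel_card less.prems by simp
      then show ?thesis using col2[OF less.prems b] adj_refl less.prems(1) by auto
    next
      case c
      then show ?thesis using col3 q_pos less.prems by simp
    qed
  qed
  have inj: "inj_on (\<lambda>d. col d i) {d. adj i g d}" if "g \<in> C" "i \<in> I" "\<not> D i g" for g i
    using that
  proof (induction "L g" arbitrary: g rule: less_induct)
    case (less g)
    let ?P = "{d. adj i g d}"
    have gate: "G i d = g" if "d \<in> ?P" for d
      using that less.prems gate_unique[of i o1 d g] adj_sym o1 by (auto simp: G_def D_def)
    have nongate: "D i d" if "d \<in> ?P" "d \<noteq> g" for d
    proof -
      have "gate o1 i g = g" using gate[of g] adj_refl less.prems by (simp add: G_def)
      then show ?thesis
        using descent_of_nongate[of i o1 g d] that o1 less.prems by (simp add: D_def)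
    qed
    show ?case
    proof (cases "\<exists>d k. d \<in> ?P \<and> d \<noteq> g \<and> k \<in> I \<and> k \<noteq> i \<and> D k d")
      case True
      then obtain d0 k where d0: "adj i g d0" "d0 \<noteq> g" "D k d0" and k: "k \<in> I" "k \<noteq> i" by blast
      have i0: "D i d0" using nongate d0 by simp
      have "indep i k" using two_descents_indep i0 d0(3) k by (simp add: D_def)
      have Dk: "D k d" if "d \<in> ?P" for d
      proof -
        have "D k g"
          using DG[OF less.prems(2) k(1) k(2)[symmetric] _ i0 d0(3)] adj_closed d0 gate[of d0] by simp
        moreover have "D k d \<longleftrightarrow> D k (G i d)" if "d \<noteq> g"
          using descent_gate_indep[of i k d o1] less.prems k o1 adj_closed \<open>d \<in> ?P\<close> \<open>indep i k\<close>
            nongate[OF \<open>d \<in> ?P\<close> that] by (simp add: D_def G_def)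
        ultimately show ?thesis using gate[OF that] by blast
      qed
      let ?g = "G k g"
      have gP: "g \<in> ?P" using adj_refl less.prems by simp
      have g': "?g \<in> C" "L ?g < L g" using Gcl Glt less.prems k Dk gP by auto
      have "indep k i" using \<open>indep i k\<close> noncommuting_sym by blast
      then have g'': "\<not> D i ?g"
        using descent_gate_indep[of k i g o1] less.prems k o1 Dk[OF gP] by (simp add: D_def G_def)
      have IH: "inj_on (\<lambda>d. col d i) {d. adj i ?g d}"
        using less.hyps[OF g'(2,1) less.prems(2) g''] .
      have adjG: "adj i ?g (G k d)" if "d \<in> ?P" for d
      proof (cases "d = g")
        case False
        have dC: "d \<in> C" using that adj_closed by blast
        have "G i (G k d) = G k (G i d)"
          using Gcomm[of i k d] less.prems k dC nongate[OF that False] Dk[OF that] by simp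
        then have "G i (G k d) = ?g" using gate that by simp
        then show ?thesis using Gadj[of i "G k d"] adj_sym less.prems Gcl[OF k(1) dC] by metis
      qed (use adj_refl g' in simp)
      show ?thesis
      proof (rule inj_onI)
        fix d d' assume d: "d \<in> ?P" "d' \<in> ?P" and eq: "col d i = col d' i"
        have dC: "d \<in> C" "d' \<in> C" using d adj_closed by auto
        have "col (G k d) i = col (G k d') i"
          using desc[OF dC(1) k Dk[OF d(1)]] desc[OF dC(2) k Dk[OF d(2)]] eq by simp
        then have "G k d = G k d'" using IH adjG d by (auto dest: inj_onD)
        then have "adj k d d'" using Gadj[OF k(1)] dC adj_sym adj_trans k by metis
        moreover have "adj i d d'"
          using d adj_sym[of i g d] adj_trans[of i d g d'] less.prems by simp
        ultimately show "d = d'" using adj_two_types k less.prems by blast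
      qed
    next
      case False
      let ?b = "pick ?P (q i) g (col g i)"
      have b: "inj_on ?b ?P" "?b g = col g i"
        using pick[of ?P "q i" g "col g i"] bound adj_refl less.prems panel_finite panel_card by auto
      have "col d i = ?b d" if d: "d \<in> ?P" for d
      proof (cases "d = g")
        case dg: False
        have "{c. adj i d c} = ?P" using d adj_sym adj_trans less.prems(2) by blast
        moreover have "d \<in> C" using d adj_closed by blast
        ultimately show ?thesis
          using col2[of d i] False d dg nongate[OF d dg] less.prems gate[OF d] by auto
      qed (use b in simp)
      then show ?thesis using inj_on_cong[of ?P "\<lambda>d. col d i" ?b] b(1) by blast
    qed
  qed
  have inj': "d = e" if "i \<in> I" "adj i d e" "col d i = col e i" for i d e
  proof -
    have d: "d \<in> C" using that adj_closed by blast
    have g: "G i d \<in> C" "\<not> D i (G i d)" "adj i (G i d) d"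
      using Gcl GD Gadj adj_sym that d by blast+
    then have "adj i (G i d) e" using adj_trans that by blast
    then show ?thesis using inj[OF g(1) that(1) g(2)] g(3) that(3) by (auto dest: inj_onD)
  qed
  have const: "col d k = col e k" if "i \<in> I" "k \<in> I" "k \<noteq> i" "adj i d e" for i k d e
  proof -
    have "col d k = col (G i d) k" if "d \<in> C" for d
    proof (cases "D i d")
      case False
      then show ?thesis using gate_fixed[of i d o1] that o1 \<open>i \<in> I\<close> by (simp add: D_def G_def)
    qed (use desc that \<open>i \<in> I\<close> \<open>k \<noteq> i\<close> in metis)
    moreover have "G i d = G i e" using gate_adj[of i o1 d e] that o1 by (simp add: G_def)
    ultimately show ?thesis using that adj_closed by metis
  qed
  have surj: "\<exists>e. adj i d e \<and> col e i = x" if "d \<in> C" "i \<in> I" "x < q i" for d i x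
  proof -
    have "(\<lambda>e. col e i) ` {e. adj i d e} \<subseteq> {..<q i}" using bound that adj_closed by auto
    moreover have "inj_on (\<lambda>e. col e i) {e. adj i d e}"
    proof (rule inj_onI)
      fix a b assume "a \<in> {e. adj i d e}" "b \<in> {e. adj i d e}" "col a i = col b i"
      then show "a = b" using inj'[OF that(2)] adj_trans[OF that(2) adj_sym[OF that(2)]] by blast
    qed
    then have "card ((\<lambda>e. col e i) ` {e. adj i d e}) = q i"
      using panel_card that by (simp add: card_image)
    ultimately have "(\<lambda>e. col e i) ` {e. adj i d e} = {..<q i}"
      by (simp add: card_subset_eq)
    then have "x \<in> (\<lambda>e. col e i) ` {e. adj i d e}" using that by simp
    then show ?thesis by blast
  qed
  show ?thesis
    unfolding proper_colouring_def
  proof (intro exI[of _ col] conjI ballI allI impI)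
    fix i k d e assume "i \<in> I" "adj i d e" "k \<in> I" "k \<noteq> i"
    then show "col d k = col e k" using const by blast
  qed (use bound surj inj' in blast)+
qed

text \<open>The value at a chamber is forced by the value at any of its gates: it is the neighbour with the
  required colour. Two descents lead to the same value because squares of the two systems
  correspond, and a chamber of a panel is determined by its colour.\<close>

lemma colour_morphism_exists:
  assumes col: "proper_colouring I q C adj col"
    and X: "chamber_system I indep X E" and col': "proper_colouring I q X E col'"
    and base: "o1 \<in> C" "x0 \<in> X" "\<And>i. i \<in> I \<Longrightarrow> col' x0 i = col o1 i"
  shows "\<exists>f. colour_morphism I C adj col X E col' f \<and> f o1 = x0"
proof -
  note XD = chamber_systemD[OF X] and cD = proper_colouringD[OF col] and cD' = proper_colouringD[OF col']
  define L where "L d = len (\<delta> d o1)" for d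
  define D where "D i d \<longleftrightarrow> descent i (\<delta> d o1)" for i d
  define G where "G i d = gate o1 i d" for i d
  define ch where "ch d = (SOME k. k \<in> I \<and> D k d)" for d
  define nxt where "nxt y i x = (SOME z. E i y z \<and> col' z i = x)" for y i x
  obtain f where f: "\<And>d. f d = (\<lambda>f d. if \<exists>k. k \<in> I \<and> D k d then nxt (f (G (ch d) d)) (ch d) (col d (ch d)) else x0)
      (\<lambda>e. if L e < L d then f e else undefined) d"
    using length_recursion[where L = L and F = "\<lambda>f d. if \<exists>k. k \<in> I \<and> D k d
       then nxt (f (G (ch d) d)) (ch d) (col d (ch d)) else x0"] by blast
  have Gcl: "G i d \<in> C" and Gadj: "adj i d (G i d)" if "i \<in> I" "d \<in> C" for i d
    using gate_closed gate that base by (auto simp: G_def)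
  have Glt: "L (G i d) < L d" if "i \<in> I" "d \<in> C" "D i d" for i d
    using delta_gate(3)[OF that(1,2) base(1)] that(3) unfolding L_def D_def G_def by linarith
  have Gcomm: "G k (G i d) = G i (G k d)"
    if "i \<in> I" "k \<in> I" "i \<noteq> k" "d \<in> C" "D i d" "D k d" for i k d
    using gate_commute[OF that(1-4) base(1)] that(5,6) by (simp add: D_def G_def)
  have DG: "D k (G i d)" if "i \<in> I" "k \<in> I" "i \<noteq> k" "d \<in> C" "D i d" "D k d" for i k d
    using descent_gate_indep[OF that(1,2,4) base(1)] that two_descents_indep by (simp add: D_def G_def)
  have main: "f d \<in> X \<and> (\<forall>i\<in>I. col' (f d) i = col d i) \<and> (\<forall>i\<in>I. D i d \<longrightarrow> E i (f (G i d)) (f d))"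
    if "d \<in> C" for d
    using that
  proof (induction "L d" arbitrary: d rule: less_induct)
    case less
    show ?case
    proof (cases "\<exists>k. k \<in> I \<and> D k d")
      case False
      have "d = o1"
        using no_descent_imp_one[of "\<delta> d o1"] delta_one_iff False base less.prems by (auto simp: D_def)
      moreover have "f d = x0" by (subst f) (simp only: False if_False)
      ultimately show ?thesis using base False by auto
    next
      case True
      define h where "h = ch d"
      have h: "h \<in> I" "D h d" using someI_ex[OF True] unfolding h_def ch_def by auto
      let ?g = "G h d"
      have lt: "L ?g < L d" using Glt h less.prems by blast
      have gC: "?g \<in> C" using Gcl h less.prems by blast
      note IHg = less.hyps[OF lt gC]
      have fd: "f d = nxt (f ?g) h (col d h)" using True lt by (subst f) (simp add: h_def)
      have "\<exists>z. E h (f ?g) z \<and> col' z h = col d h"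
        using cD'(2)[OF h(1)] IHg cD(1)[OF h(1) less.prems] by blast
      then have n: "E h (f ?g) (f d)" "col' (f d) h = col d h"
        using someI_ex[of "\<lambda>z. E h (f ?g) z \<and> col' z h = col d h"] unfolding fd nxt_def by auto
      have colr: "col' (f d) i = col d i" if "i \<in> I" for i
      proof (cases "i = h")
        case False
        have "col' (f d) i = col' (f ?g) i" using cD'(4)[OF h(1) n(1) that False] by simp
        also have "\<dots> = col ?g i" using IHg that by blast
        also have "\<dots> = col d i" using cD(4)[OF h(1) Gadj[OF h(1) less.prems] that False] by simp
        finally show ?thesis .
      qed (use n in simp)
      have "E i (f (G i d)) (f d)" if i: "i \<in> I" "D i d" for i
      proof (cases "i = h")
        case False
        let ?e = "G i ?g" and ?k = "G i d"
        have Di: "D i ?g" using DG[OF h(1) i(1) _ less.prems h(2) i(2)] False by simp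
        have Dh: "D h ?k" using DG[OF i(1) h(1) False less.prems i(2) h(2)] .
        have e: "?e = G h ?k" using Gcomm[OF h(1) i(1) _ less.prems h(2) i(2)] False by simp
        have kC: "?k \<in> C" using Gcl i less.prems by blast
        note IHk = less.hyps[OF Glt[OF i(1) less.prems i(2)] kC]
        have E1: "E i (f ?e) (f ?g)" using IHg i(1) Di by blast
        have E2: "E h (f ?e) (f ?k)" using IHk h(1) Dh e by simp
        have ind: "indep i h" using two_descents_indep i(2) h(2) False by (simp add: D_def)
        obtain z where z: "E h (f ?e) z" "E i z (f d)"
          using XD(6)[OF i(1) h(1) ind E1 n(1)] by blast
        have "E h (f ?k) z" using XD(3,5)[OF h(1)] E2 z(1) by blast
        moreover have "col' (f ?k) h = col' z h"
        proof -
          have "col' z h = col d h" using cD'(4)[OF i(1) z(2) h(1)] False n(2) by simp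
          also have "\<dots> = col ?k h" using cD(4)[OF i(1) Gadj[OF i(1) less.prems] h(1)] False by simp
          finally show ?thesis using IHk h by simp
        qed
        ultimately have "f ?k = z" using cD'(3)[OF h(1)] by blast
        then show ?thesis using z by simp
      qed (use n in simp)
      moreover have "f d \<in> X" using XD(2)[OF h(1) n(1)] .
      ultimately show ?thesis using colr by blast
    qed
  qed
  have E: "E i (f c) (f d)" if i: "i \<in> I" and a: "adj i c d" for i c d
  proof -
    have "E i (f (G i c)) (f c)" if "c \<in> C" for c
    proof (cases "D i c")
      case False
      then have "G i c = c" using gate_fixed[OF i that base(1)] by (simp add: D_def G_def)
      then show ?thesis using XD(4)[OF i] main that by simp
    qed (use main that i in blast)
    moreover have "G i c = G i d" using gate_adj[OF i base(1) a] by (simp add: G_def)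
    ultimately show ?thesis using XD(3,5)[OF i] adj_closed a by metis
  qed
  have "\<not> D i o1" for i using delta_one_iff[OF base(1) base(1)] descent_one by (simp add: D_def)
  then have "f o1 = x0" by (subst f) simp
  moreover have "colour_morphism I C adj col X E col' f"
    unfolding colour_morphism_def using main E by blast
  ultimately show ?thesis by blast
qed

lemma colour_morphism_unique:
  assumes col': "proper_colouring I q X E col'" and X: "chamber_system I indep X E"
    and f: "colour_morphism I C adj col X E col' f" and g: "colour_morphism I C adj col X E col' g"
    and o1: "o1 \<in> C" "f o1 = g o1" and c: "c \<in> C"
  shows "f c = g c"
proof -
  have "residue I c o1" using gallery_connected c o1 by blast
  then show ?thesis
  proof (induction rule: residue_induct)
    case base
    show ?case by (rule o1)
  next
    case (step c e i)
    have "E i (f c) (f e)" "E i (g c) (f e)"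
      using colour_morphismD(3)[OF f step(1,2)] colour_morphismD(3)[OF g step(1,2)] step(4) by auto
    then have "E i (f c) (g c)" using chamber_systemD(3,5)[OF X step(1)] by blast
    moreover have "col' (f c) i = col' (g c) i"
      using colour_morphismD(2)[OF f] colour_morphismD(2)[OF g] step adj_closed by metis
    ultimately show ?case using proper_colouringD(3)[OF col' step(1)] by blast
  qed
qed

end

context ra_building
begin

lemma residue_colour:
  assumes col: "proper_colouring I q C adj col" and "T \<subseteq> I" "residue T c d" "k \<in> I" "k \<notin> T"
  shows "col c k = col d k"
  using assms(3)
proof (induction rule: residue_induct)
  case (step c e i)
  then have "col c k = col e k" using proper_colouringD(4)[OF col _ step(2), of k] assms(2,4,5) by blast
  then show ?case using step(4) by simp
qed (rule HOL.refl)

lemma residue_with_colours: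
  assumes col: "proper_colouring I q C adj col" and T: "T \<subseteq> I" and c: "c \<in> C"
    and x: "\<And>i. i \<in> T \<Longrightarrow> x i < q i"
  shows "\<exists>d. residue T c d \<and> (\<forall>i\<in>T. col d i = x i)"
proof -
  have "finite T" using T finite_subset by blast
  then show ?thesis using T x
  proof (induction T rule: finite_induct)
    case empty
    then show ?case using residue_refl c by blast
  next
    case (insert k T)
    then obtain d where d: "residue T c d" "\<forall>i\<in>T. col d i = x i" by auto
    have k: "k \<in> I" "x k < q k" using insert.prems by auto
    obtain e where e: "adj k d e" "col e k = x k"
      using proper_colouringD(2)[OF col k(1) residue_closed(2)[OF d(1)] k(2)] by blast
    have i: "col e i = x i" if "i \<in> T" for i
    proof -
      have "i \<in> I" "i \<noteq> k" using that insert.prems(1) insert.hyps(2) by blast+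
      then have "col d i = col e i" using proper_colouringD(4)[OF col k(1) e(1)] by blast
      then show ?thesis using that d(2) by simp
    qed
    have "residue (insert k T) c e"
      using d(1) e(1) residue_mono[of T "insert k T"] residue_adj[of k "insert k T"] residue_trans
      by blast
    then show ?case using e(2) i by blast
  qed
qed

text \<open>In a residue whose types commute with \<open>i\<close>, all steps of type \<open>i\<close> of a gallery
  can be moved to its beginning.\<close>

lemma residue_split:
  assumes T: "T \<subseteq> I" and ind: "\<And>k. k \<in> T \<Longrightarrow> k \<noteq> i \<Longrightarrow> indep i k" and i: "i \<in> T" and r: "residue T c d"
  shows "\<exists>e. adj i c e \<and> residue (T - {i}) e d"
  using r
proof (induction rule: residue_induct)
  case base
  show ?case using adj_refl residue_refl residue_closed[OF r] by blast
next
  case (step c f k)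
  then obtain e where e: "adj i f e" "residue (T - {i}) e d" by blast
  have I: "i \<in> I" "k \<in> I" using i step T by auto
  show ?case
  proof (cases "k = i")
    case True
    then show ?thesis using e step adj_trans[OF I(1), of c f e] by blast
  next
    case False
    then have "indep k i" using ind[OF step(1)] noncommuting_sym by blast
    then obtain g where "adj i c g" "adj k g e" using square[OF I(2,1) _ step(2) e(1)] by blast
    moreover have "residue (T - {i}) g e" using residue_adj[of k "T - {i}" g e] \<open>adj k g e\<close> step False by blast
    ultimately show ?thesis using e(2) residue_trans by blast
  qed
qed

lemma residue_colour_inj:
  assumes col: "proper_colouring I q C adj col" and T: "T \<subseteq> I"
    and ind: "\<And>i k. i \<in> T \<Longrightarrow> k \<in> T \<Longrightarrow> i \<noteq> k \<Longrightarrow> indep i k"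
    and "residue T c d" "\<And>i. i \<in> T \<Longrightarrow> col c i = col d i"
  shows "c = d"
proof -
  have "finite T" using T finite_subset by blast
  then show ?thesis using T ind assms(4,5)
  proof (induction T rule: finite_induct)
    case empty
    then show ?case by (simp add: residue_empty)
  next
    case (insert i T)
    have i: "i \<in> I" using insert.prems by blast
    obtain e where e: "adj i c e" "residue (insert i T - {i}) e d"
      using residue_split[OF insert.prems(1) _ _ insert.prems(3), of i] insert.prems(2) by blast
    have r: "residue T e d" using e(2) insert.hyps by simp
    have "col e i = col d i" using residue_colour[OF col _ r i] insert by blast
    then have "c = e" using proper_colouringD(3)[OF col i e(1)] insert.prems(4) by simp
    then show ?case using insert.IH insert.prems r by blast
  qed
qed

lemma residue_finite:
  assumes T: "T \<subseteq> I" and ind: "\<And>i k. i \<in> T \<Longrightarrow> k \<in> T \<Longrightarrow> i \<noteq> k \<Longrightarrow> indep i k"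
  shows "finite {d. residue T c d}"
proof (cases "c \<in> C")
  case True
  obtain col where col: "proper_colouring I q C adj col" using proper_colouring_exists by blast
  have fT: "finite T" using T finite_subset by blast
  have "inj_on (\<lambda>d. restrict (col d) T) {d. residue T c d}"
  proof (rule inj_onI)
    fix d e assume d: "d \<in> {d. residue T c d}" "e \<in> {d. residue T c d}"
      and eq: "restrict (col d) T = restrict (col e) T"
    have "residue T d e" using d residue_sym[OF T] residue_trans by blast
    moreover have "col d i = col e i" if "i \<in> T" for i
      using fun_cong[OF eq, of i] that by simp
    ultimately show "d = e" using residue_colour_inj[OF col T ind] by blast
  qed
  moreover have "(\<lambda>d. restrict (col d) T) ` {d. residue T c d} \<subseteq> PiE T (\<lambda>i. {..<q i})"
  proof (rule image_subsetI, rule restrict_PiE[THEN iffD2], rule Pi_I)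
    fix d i assume "d \<in> {d. residue T c d}" "i \<in> T"
    then show "col d i \<in> {..<q i}"
      using proper_colouringD(1)[OF col, of i d] T residue_closed(2)[of T c d] by blast
  qed
  moreover have "finite (PiE T (\<lambda>i. {..<q i}))" by (rule finite_PiE[OF fT]) simp
  ultimately show ?thesis 
    by (rule inj_on_finite)
next
  case False
  then show ?thesis by (simp add: residue_def)
qed

end

section \<open>Lifting symmetries through a covering\<close>

text \<open>A covering \<open>\<kappa>\<close> of a coloured chamber system \<open>Y\<close> by the building, and a group
  \<open>A\<close> of automorphisms of \<open>Y\<close>. The automorphisms need not
  preserve the colouring. They are total functions of which only the values on \<open>Y\<close> matter,
  so the group axioms are stated pointwise on \<open>Y\<close>.\<close>

locale lifted_symmetries = ra_building W s n m q C \<delta>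
  for W :: "('w, 'x) monoid_scheme" (structure) and s n m q and C :: "'c set" and \<delta> +
  fixes Y :: "'y set" and E :: "nat \<Rightarrow> 'y \<Rightarrow> 'y \<Rightarrow> bool" and colY :: "'y \<Rightarrow> nat \<Rightarrow> nat"
    and A :: "('y \<Rightarrow> 'y) set" and col :: "'c \<Rightarrow> nat \<Rightarrow> nat" and \<kappa> :: "'c \<Rightarrow> 'y"
  assumes Y_system: "chamber_system I indep Y E" and Y_colouring: "proper_colouring I q Y E colY"
    and A_closed: "a \<in> A \<Longrightarrow> y \<in> Y \<Longrightarrow> a y \<in> Y"
    and A_adj: "a \<in> A \<Longrightarrow> i \<in> I \<Longrightarrow> E i y z \<Longrightarrow> E i (a y) (a z)"
    and A_one: "\<exists>a\<in>A. \<forall>y\<in>Y. a y = y"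
    and A_mult: "a \<in> A \<Longrightarrow> b \<in> A \<Longrightarrow> \<exists>c\<in>A. \<forall>y\<in>Y. c y = a (b y)"
    and A_inv: "a \<in> A \<Longrightarrow> \<exists>b\<in>A. \<forall>y\<in>Y. a (b y) = y \<and> b (a y) = y"
    and A_faithful: "a \<in> A \<Longrightarrow> b \<in> A \<Longrightarrow> (\<And>y. y \<in> Y \<Longrightarrow> a y = b y) \<Longrightarrow> a = b"
    and C_colouring: "proper_colouring I q C adj col"
    and cover: "colour_morphism I C adj col Y E colY \<kappa>" and cover_onto: "\<kappa> ` C = Y"
begin

lemma cover_closed: "c \<in> C \<Longrightarrow> \<kappa> c \<in> Y"
  using colour_morphismD(1)[OF cover] .

lemma cover_colour: "c \<in> C \<Longrightarrow> i \<in> I \<Longrightarrow> colY (\<kappa> c) i = col c i"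
  using colour_morphismD(2)[OF cover] .

text \<open>A symmetry need not preserve colours, but it transports one proper colouring into another. A lift
  is a colour morphism between the two colourings of the building obtained in this way.\<close>

lemma symmetry_colouring:
  assumes a: "a \<in> A"
  shows "proper_colouring I q Y E (\<lambda>y. colY (a y))"
  unfolding proper_colouring_def
proof (intro conjI ballI allI impI)
  note cD = proper_colouringD[OF Y_colouring] and XD = chamber_systemD[OF Y_system]
  obtain b where b: "b \<in> A" "\<And>y. y \<in> Y \<Longrightarrow> a (b y) = y" "\<And>y. y \<in> Y \<Longrightarrow> b (a y) = y"
    using A_inv[OF a] by blast
  fix i assume i: "i \<in> I"
  {
    fix y assume y: "y \<in> Y"
    show "colY (a y) i < q i" using cD(1)[OF i A_closed[OF a y]] .
    fix x assume "x < q i"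
    then obtain z where z: "E i (a y) z" "colY z i = x" using cD(2)[OF i A_closed[OF a y]] by blast
    have "E i y (b z)" using A_adj[OF b(1) i z(1)] b(3)[OF y] by simp
    moreover have "colY (a (b z)) i = x" using b(2) XD(2)[OF i z(1)] z(2) by simp
    ultimately show "\<exists>z. E i y z \<and> colY (a z) i = x" by blast
  next
    fix y z assume e: "E i y z" and "colY (a y) i = colY (a z) i"
    then have "a y = a z" using cD(3)[OF i] A_adj[OF a i e] by blast
    then show "y = z" using b(3) XD(1,2)[OF i e] by metis
  next
    fix y z k assume "E i y z" "k \<in> I" "k \<noteq> i"
    then show "colY (a y) k = colY (a z) k" using cD(4)[OF i A_adj[OF a i]] by blast
  }
qed

lemma pullback_colouring:
  assumes c1: "proper_colouring I q Y E col1"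
  shows "proper_colouring I q C adj (\<lambda>c. col1 (\<kappa> c))"
  unfolding proper_colouring_def
proof (intro conjI ballI allI impI)
  note cD = proper_colouringD[OF c1] and XD = chamber_systemD[OF Y_system]
  note cY = proper_colouringD[OF Y_colouring] and cC = proper_colouringD[OF C_colouring]
  note ad = colour_morphismD(3)[OF cover]
  fix i assume i: "i \<in> I"
  {
    fix c assume c: "c \<in> C"
    show "col1 (\<kappa> c) i < q i" using cD(1)[OF i cover_closed[OF c]] .
    fix x assume "x < q i"
    then obtain z where z: "E i (\<kappa> c) z" "col1 z i = x" using cD(2)[OF i cover_closed[OF c]] by blast
    obtain d where d: "adj i c d" "col d i = colY z i"
      using cC(2)[OF i c cY(1)[OF i XD(2)[OF i z(1)]]] by blast
    have "E i (\<kappa> d) z" using XD(3,5)[OF i] ad[OF i d(1)] z(1) by blast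
    moreover have "colY (\<kappa> d) i = colY z i" using cover_colour adj_closed d i by metis
    ultimately have "\<kappa> d = z" using cY(3)[OF i] by blast
    then show "\<exists>d. adj i c d \<and> col1 (\<kappa> d) i = x" using d z by blast
  next
    fix c d assume a: "adj i c d" and "col1 (\<kappa> c) i = col1 (\<kappa> d) i"
    then have "\<kappa> c = \<kappa> d" using cD(3)[OF i ad[OF i a]] by blast
    then have "col c i = col d i" using cover_colour adj_closed a i by metis
    then show "c = d" using cC(3)[OF i a] by blast
  next
    fix c d k assume "adj i c d" "k \<in> I" "k \<noteq> i"
    then show "col1 (\<kappa> c) k = col1 (\<kappa> d) k" using cD(4)[OF i ad[OF i]] by blast
  }
qed

lemma lift_unique:
  assumes g: "\<And>i d e. i \<in> I \<Longrightarrow> adj i d e \<Longrightarrow> adj i (g d) (g e)" "\<And>d. d \<in> C \<Longrightarrow> g d \<in> C"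
    and h: "\<And>i d e. i \<in> I \<Longrightarrow> adj i d e \<Longrightarrow> adj i (h d) (h e)" "\<And>d. d \<in> C \<Longrightarrow> h d \<in> C"
    and eq: "\<And>d. d \<in> C \<Longrightarrow> \<kappa> (g d) = \<kappa> (h d)" and c: "c \<in> C" "g c = h c" and d: "d \<in> C"
  shows "g d = h d"
proof -
  have 1: "colour_morphism I C adj (\<lambda>d. col (g d)) C adj col g"
    using g by (simp add: colour_morphism_def)
  have "col (h d) i = col (g d) i" if "d \<in> C" "i \<in> I" for d i
    using cover_colour[OF g(2)[OF that(1)] that(2)] cover_colour[OF h(2)[OF that(1)] that(2)] eq[OF that(1)]
    by simp
  then have 2: "colour_morphism I C adj (\<lambda>d. col (g d)) C adj col h"
    using h unfolding colour_morphism_def by blast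
  show ?thesis
    using colour_morphism_unique[of C adj col "\<lambda>d. col (g d)" g h c d] C_colouring
      building_chamber_system 1 2 c d by blast
qed

lemma lift_map_exists:
  assumes a: "a \<in> A" and c: "c \<in> C" "c' \<in> C" "\<kappa> c' = a (\<kappa> c)"
  shows "\<exists>g. (\<forall>d\<in>C. g d \<in> C \<and> \<kappa> (g d) = a (\<kappa> d)) \<and> g c = c' \<and>
    (\<forall>i\<in>I. \<forall>d e. adj i d e \<longrightarrow> adj i (g d) (g e))"
proof -
  let ?c1 = "\<lambda>d. colY (a (\<kappa> d))" and ?c2 = "\<lambda>d. colY (\<kappa> d)"
  have c1: "proper_colouring I q C adj ?c1"
    by (rule pullback_colouring[OF symmetry_colouring[OF a]])
  have c2: "proper_colouring I q C adj ?c2" by (rule pullback_colouring[OF Y_colouring])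
  obtain g where g: "colour_morphism I C adj ?c1 C adj ?c2 g" "g c = c'"
    using colour_morphism_exists[OF c1 building_chamber_system c2 c(1,2)] c(3) by auto
  note gD = colour_morphismD[OF g(1)]
  have "\<kappa> (g d) = a (\<kappa> d)" if d: "d \<in> C" for d
  proof -
    have 1: "colour_morphism I C adj ?c1 Y E colY (\<lambda>d. \<kappa> (g d))"
      unfolding colour_morphism_def using gD cover_closed colour_morphismD(3)[OF cover] by blast
    have 2: "colour_morphism I C adj ?c1 Y E colY (\<lambda>d. a (\<kappa> d))"
      unfolding colour_morphism_def
      using A_closed[OF a] cover_closed A_adj[OF a] colour_morphismD(3)[OF cover] by blast
    show ?thesis
      using colour_morphism_unique[OF Y_colouring Y_system 1 2 c(1) _ d] g(2) c(3) by simp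
  qed
  then show ?thesis using gD g(2) by (intro exI[of _ g]) blast
qed

definition lifts :: "('c \<Rightarrow> 'c) set" where
  "lifts = {g \<in> extensional C. bij_betw g C C \<and> (\<forall>i\<in>I. \<forall>c d. adj i c d \<longrightarrow> adj i (g c) (g d)) \<and>
     (\<exists>a\<in>A. \<forall>c\<in>C. \<kappa> (g c) = a (\<kappa> c))}"

lemma liftsD:
  assumes "g \<in> lifts"
  shows "bij_betw g C C" "c \<in> C \<Longrightarrow> g c \<in> C" "i \<in> I \<Longrightarrow> adj i c d \<Longrightarrow> adj i (g c) (g d)"
    "\<exists>a\<in>A. \<forall>c\<in>C. \<kappa> (g c) = a (\<kappa> c)" "g \<in> extensional C"
  using assms by (auto simp: lifts_def dest: bij_betwE)

text \<open>Lifts of \<open>a\<close> and of its inverse compose to lifts of the identity with a fixed chamber,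
  which are trivial by uniqueness; hence lifts are bijective.\<close>

lemma lift_exists:
  assumes a: "a \<in> A" and c: "c \<in> C" "c' \<in> C" "\<kappa> c' = a (\<kappa> c)"
  shows "\<exists>g\<in>lifts. g c = c' \<and> (\<forall>d\<in>C. \<kappa> (g d) = a (\<kappa> d))"
proof -
  obtain b where b: "b \<in> A" "\<And>y. y \<in> Y \<Longrightarrow> a (b y) = y" "\<And>y. y \<in> Y \<Longrightarrow> b (a y) = y"
    using A_inv[OF a] by blast
  obtain g where g: "\<And>d. d \<in> C \<Longrightarrow> g d \<in> C" "\<And>d. d \<in> C \<Longrightarrow> \<kappa> (g d) = a (\<kappa> d)" "g c = c'"
      "\<And>i d e. i \<in> I \<Longrightarrow> adj i d e \<Longrightarrow> adj i (g d) (g e)"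
    using lift_map_exists[OF a c] by blast
  have "\<kappa> c = b (\<kappa> c')" using b(3)[OF cover_closed[OF c(1)]] c(3) by simp
  from lift_map_exists[OF b(1) c(2,1) this]
  obtain h where h: "\<And>d. d \<in> C \<Longrightarrow> h d \<in> C" "\<And>d. d \<in> C \<Longrightarrow> \<kappa> (h d) = b (\<kappa> d)" "h c' = c"
      "\<And>i d e. i \<in> I \<Longrightarrow> adj i d e \<Longrightarrow> adj i (h d) (h e)" by blast
  have hg: "h (g d) = d" if "d \<in> C" for d
    by (rule lift_unique[of "\<lambda>d. h (g d)" "\<lambda>d. d" c])
      (use g h b(3) cover_closed c that in auto)
  have gh: "g (h d) = d" if "d \<in> C" for d
    by (rule lift_unique[of "\<lambda>d. g (h d)" "\<lambda>d. d" c'])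
      (use g h b(2) cover_closed c that in auto)
  have "bij_betw (restrict g C) C C"
    by (rule bij_betw_byWitness[of _ h]) (use g h hg gh in auto)
  then have "restrict g C \<in> lifts"
    unfolding lifts_def using g a adj_closed by fastforce
  then show ?thesis using g c by (intro bexI[of _ "restrict g C"]) auto
qed

lemma lifts_eqI:
  assumes "g \<in> lifts" "h \<in> lifts" "\<And>d. d \<in> C \<Longrightarrow> \<kappa> (g d) = \<kappa> (h d)" "c \<in> C" "g c = h c"
  shows "g = h"
proof (rule extensionalityI[OF liftsD(5)[OF assms(1)] liftsD(5)[OF assms(2)]])
  fix d assume "d \<in> C"
  then show "g d = h d"
    using lift_unique[of g h c d] liftsD(2,3)[OF assms(1)] liftsD(2,3)[OF assms(2)] assms(3-5) by blast
qed

lemma lifts_one: "(\<lambda>c\<in>C. c) \<in> lifts"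
proof -
  have "bij_betw (\<lambda>c\<in>C. c) C C" by (simp add: bij_betw_def inj_on_def)
  moreover obtain a where "a \<in> A" "\<forall>y\<in>Y. a y = y" using A_one by blast
  then have "\<exists>a\<in>A. \<forall>c\<in>C. \<kappa> (restrict (\<lambda>c. c) C c) = a (\<kappa> c)"
    using cover_closed by (intro bexI[of _ a]) simp_all
  moreover have "adj i (restrict (\<lambda>c. c) C x) (restrict (\<lambda>c. c) C y)" if "adj i x y" for i x y
    using that adj_closed[OF that] by simp
  ultimately show ?thesis unfolding lifts_def by auto
qed

lemma lifts_mult:
  assumes "g \<in> lifts" "h \<in> lifts" shows "compose C g h \<in> lifts"
proof -
  obtain a b where a: "a \<in> A" "\<forall>c\<in>C. \<kappa> (g c) = a (\<kappa> c)" and b: "b \<in> A" "\<forall>c\<in>C. \<kappa> (h c) = b (\<kappa> c)"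
    using liftsD(4) assms by metis
  obtain c where c: "c \<in> A" "\<forall>y\<in>Y. c y = a (b y)" using A_mult a b by blast
  have "bij_betw (compose C g h) C C"
    using bij_betw_compose[of h C C g C] liftsD(1) assms by blast
  moreover have "\<forall>d\<in>C. \<kappa> (compose C g h d) = c (\<kappa> d)"
    using a b c liftsD(2)[OF assms(2)] cover_closed by (simp add: compose_def)
  moreover have "adj i (compose C g h x) (compose C g h y)" if "i \<in> I" "adj i x y" for i x y
    using that adj_closed liftsD(3)[OF assms(1)] liftsD(3)[OF assms(2)] by (simp add: compose_def)
  moreover have "compose C g h \<in> extensional C" by simp
  ultimately show ?thesis using c(1) unfolding lifts_def by blast
qed

lemma lifts_inv:
  assumes g: "g \<in> lifts"
  shows "\<exists>h\<in>lifts. \<forall>c\<in>C. g (h c) = c \<and> h (g c) = c"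
proof -
  obtain a where a: "a \<in> A" "\<forall>c\<in>C. \<kappa> (g c) = a (\<kappa> c)" using liftsD(4)[OF g] by blast
  obtain b where b: "b \<in> A" "\<And>y. y \<in> Y \<Longrightarrow> a (b y) = y" "\<And>y. y \<in> Y \<Longrightarrow> b (a y) = y"
    using A_inv[OF a(1)] by blast
  obtain c where c: "c \<in> C" using chambers_nonempty by blast
  have gc: "g c \<in> C" using liftsD(2)[OF g c] .
  obtain h where h: "h \<in> lifts" "h (g c) = c" "\<forall>d\<in>C. \<kappa> (h d) = b (\<kappa> d)"
    using lift_exists[OF b(1) gc c] a(2) b(3) c cover_closed by metis
  have hg: "h (g d) = d" if "d \<in> C" for d
    by (rule lift_unique[of "\<lambda>d. h (g d)" "\<lambda>d. d" c])
      (use liftsD(2,3)[OF g] liftsD(2,3)[OF h(1)] h a b(3) cover_closed c that in auto)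
  have gh: "g (h d) = d" if "d \<in> C" for d
    by (rule lift_unique[of "\<lambda>d. g (h d)" "\<lambda>d. d" "g c"])
      (use liftsD(2,3)[OF g] liftsD(2,3)[OF h(1)] h a b(2) cover_closed gc that in auto)
  show ?thesis using h(1) hg gh by blast
qed

lemma lifts_delta:
  assumes "g \<in> lifts" "c \<in> C" "d \<in> C" shows "\<delta> (g c) (g d) = \<delta> c d"
  using delta_preserved[of g c d] liftsD[OF assms(1)] assms by (simp add: bij_betw_def)

lemma same_orbit: "c \<in> C \<Longrightarrow> d \<in> C \<Longrightarrow> \<kappa> c = \<kappa> d \<Longrightarrow> \<exists>g\<in>lifts. g c = d"
  using A_one lift_exists cover_closed by metis

end

section \<open>A finite chamber system with many symmetries\<close>

text \<open>A chamber is a pair of an index \<open>t < N\<close> of a copy and a vector \<open>x\<close> of colours. In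
  \<open>panel_label\<close>, which labels the panels of type \<open>i\<close>, the coordinate \<open>x i\<close> is
  erased. The label of a \<open>v\<close>-panel with \<open>x u = p\<close> moreover moves the chamber with
  \<open>x v = 0\<close> to the next copy, so that this chamber shares its panel with chambers of that
  copy. The relation \<open>R\<close> says which types commute; it does not involve the free types
  \<open>u\<close> and \<open>v\<close>, so the twist breaks no square.\<close>

locale twisted_cubes =
  fixes J :: "nat set" and q :: "nat \<Rightarrow> nat" and R :: "nat \<Rightarrow> nat \<Rightarrow> bool"
    and u v p N :: nat
  assumes finite_J: "finite J" and uv: "u \<in> J" "v \<in> J" "u \<noteq> v"
    and p: "0 < p" "p < q u" and qv: "2 \<le> q v" and N: "0 < N"
    and q_positive: "i \<in> J \<Longrightarrow> 0 < q i"
    and R_free: "i \<in> J \<Longrightarrow> k \<in> J \<Longrightarrow> R i k \<Longrightarrow> i \<noteq> k \<and> i \<noteq> u \<and> i \<noteq> v \<and> k \<noteq> u \<and> k \<noteq> v"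
begin

definition cells :: "(nat \<times> (nat \<Rightarrow> nat)) set" where
  "cells = {..<N} \<times> PiE J (\<lambda>i. {..<q i})"

definition panel_label :: "nat \<Rightarrow> nat \<times> (nat \<Rightarrow> nat) \<Rightarrow> nat \<times> (nat \<Rightarrow> nat)" where
  "panel_label i y =
     (if i = v \<and> snd y u = p \<and> snd y v = 0 then Suc (fst y) mod N else fst y, (snd y)(i := 0))"

definition near :: "nat \<Rightarrow> nat \<times> (nat \<Rightarrow> nat) \<Rightarrow> nat \<times> (nat \<Rightarrow> nat) \<Rightarrow> bool" where
  "near i y z \<longleftrightarrow> y \<in> cells \<and> z \<in> cells \<and> panel_label i y = panel_label i z"

definition rotate_low :: "(nat \<Rightarrow> nat) \<Rightarrow> nat \<times> (nat \<Rightarrow> nat) \<Rightarrow> nat \<times> (nat \<Rightarrow> nat)" where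
  "rotate_low f y =
     (fst y, (snd y)(u := if snd y u < p then (snd y u + f (fst y)) mod p else snd y u))"

definition symmetries :: "(nat \<times> (nat \<Rightarrow> nat) \<Rightarrow> nat \<times> (nat \<Rightarrow> nat)) set" where
  "symmetries = (\<lambda>f. restrict (rotate_low f) cells) ` PiE {..<N} (\<lambda>_. {..<p})"

lemma cells_iff: "(t, x) \<in> cells \<longleftrightarrow> t < N \<and> x \<in> PiE J (\<lambda>i. {..<q i})"
  by (simp add: cells_def)

lemma cells_update: "(t, x) \<in> cells \<Longrightarrow> i \<in> J \<Longrightarrow> a < q i \<Longrightarrow> t' < N \<Longrightarrow> (t', x(i := a)) \<in> cells"
  by (auto simp: cells_def PiE_def Pi_def extensional_def)

lemma near_other:
  "i \<noteq> v \<Longrightarrow> near i (t, x) (t', x') \<longleftrightarrow>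
    (t, x) \<in> cells \<and> (t', x') \<in> cells \<and> t = t' \<and> x(i := 0) = x'(i := 0)"
  by (auto simp: near_def panel_label_def)

lemma near_coordinates:
  assumes "near i (t, x) (t', x')" "k \<noteq> i" shows "x k = x' k"
proof -
  have "x(i := 0) = x'(i := 0)" using assms(1) by (simp add: near_def panel_label_def)
  from fun_cong[OF this, of k] show ?thesis using assms(2) by simp
qed

lemma Suc_mod_inj: "t < N \<Longrightarrow> t' < N \<Longrightarrow> Suc t mod N = Suc t' mod N \<Longrightarrow> t = t'"
  by (cases "Suc t = N"; cases "Suc t' = N") auto

lemma cells_system: "chamber_system J R cells near"
  unfolding chamber_system_def
proof (intro conjI ballI allI impI)
  fix i k x y z assume ik: "i \<in> J" "k \<in> J" "R i k" and xy: "near i x y" and yz: "near k y z"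
  obtain t a t' b t'' c where e: "x = (t, a)" "y = (t', b)" "z = (t'', c)" by (metis surj_pair)
  have f: "i \<noteq> v" "k \<noteq> v" "i \<noteq> k" using R_free ik by blast+
  have 1: "(t, a) \<in> cells" "(t', b) \<in> cells" "t = t'" "a(i := 0) = b(i := 0)"
    using xy f near_other by (auto simp: e)
  have 2: "(t'', c) \<in> cells" "t' = t''" "b(k := 0) = c(k := 0)"
    using yz f near_other by (auto simp: e)
  have c: "c k < q k" "t < N" using 2 1 ik by (auto simp: cells_def PiE_def Pi_def)
  let ?d = "a(k := c k)"
  have d: "(t, ?d) \<in> cells" using cells_update[OF 1(1) ik(2) c] .
  have "near k x (t, ?d)" using near_other[OF f(2)] d 1 by (simp add: e)
  moreover have "?d(i := 0) = c(i := 0)"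
  proof
    fix j show "(?d(i := 0)) j = (c(i := 0)) j"
      using fun_cong[OF 1(4), of j] fun_cong[OF 2(3), of j] by (auto split: if_splits)
  qed
  then have "near i (t, ?d) z" using near_other[OF f(1)] d 1 2 by (simp add: e)
  ultimately show "\<exists>y'. near k x y' \<and> near i y' z" by blast
qed (auto simp: near_def)

lemma cells_colouring: "proper_colouring J q cells near snd"
  unfolding proper_colouring_def
proof (intro conjI ballI allI impI)
  fix i assume i: "i \<in> J"
  {
    fix y assume y: "y \<in> cells"
    obtain t x where e: "y = (t, x)" by (metis surj_pair)
    show "snd y i < q i" using y i by (auto simp: e cells_def PiE_def Pi_def)
    fix a assume a: "a < q i"
    have t: "t < N" using y by (simp add: e cells_iff)
    show "\<exists>z. near i y z \<and> snd z i = a"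
    proof (cases "i = v \<and> x u = p")
      case False
      have "(t, x(i := a)) \<in> cells" using cells_update y i a t by (simp add: e)
      moreover have "panel_label i (t, x(i := a)) = panel_label i (t, x)"
        using False uv by (auto simp: panel_label_def)
      ultimately show ?thesis using y by (intro exI[of _ "(t, x(i := a))"]) (simp add: near_def e)
    next
      case True
      define h where "h = (if x v = 0 then Suc t mod N else t)"
      \<comment> \<open>The copy preceding \<open>h\<close> cyclically, since the chamber with \<open>x v = 0\<close> is labelled by the next copy.\<close>
      define r where "r = (if a = 0 then (h + N - 1) mod N else h)"
      have hN: "h < N" using t N by (simp add: h_def)
      have "Suc ((h + N - 1) mod N) mod N = h"
        using hN N by (simp add: mod_Suc_eq)
      then have r: "r < N" "(if a = 0 then Suc r mod N else r) = h"
        using hN N by (auto simp: r_def)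
      have "(r, x(i := a)) \<in> cells" using cells_update y i a r by (simp add: e)
      moreover have "panel_label i (r, x(i := a)) = panel_label i (t, x)"
        using True uv r by (auto simp: panel_label_def h_def)
      ultimately show ?thesis using y by (intro exI[of _ "(r, x(i := a))"]) (simp add: near_def e)
    qed
  next
    fix y z assume n: "near i y z" and eq: "snd y i = snd z i"
    obtain t x t' x' where e: "y = (t, x)" "z = (t', x')" by (metis surj_pair)
    have "x k = x' k" for k using near_coordinates[of i t x t' x' k] n eq by (cases "k = i") (auto simp: e)
    then have x: "x = x'" by blast
    have tN: "t < N" "t' < N" using n by (auto simp: near_def e cells_iff)
    have "(if i = v \<and> x u = p \<and> x v = 0 then Suc t mod N else t) =
        (if i = v \<and> x u = p \<and> x v = 0 then Suc t' mod N else t')"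
    proof -
      have "fst (panel_label i (t, x)) = fst (panel_label i (t', x))" using n x by (simp add: near_def e)
      then show ?thesis unfolding panel_label_def fst_conv snd_conv .
    qed
    then have "t = t'" using Suc_mod_inj[OF tN] by (simp split: if_split_asm)
    then show "y = z" using x e by simp
  next
    fix y z k assume "near i y z" "k \<in> J" "k \<noteq> i"
    then show "snd y k = snd z k" using near_coordinates by (cases y; cases z) auto
  }
qed

text \<open>Within one copy all coordinates can be changed after moving to \<open>x u = 0\<close>, where the
  \<open>v\<close>-panels are untwisted; here \<open>0 < p\<close> is used. A panel with \<open>x u = p\<close> leads
  to the next copy, since it contains a chamber with \<open>x v = 0\<close> and, because of \<open>2 \<le> q v\<close>,
  one with \<open>x v = 1\<close>.\<close>

lemma cells_connected:
  assumes S: "S \<subseteq> cells" "S \<noteq> {}" and closed: "\<And>i y z. i \<in> J \<Longrightarrow> y \<in> S \<Longrightarrow> near i y z \<Longrightarrow> z \<in> S"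
  shows "S = cells"
proof -
  have pos: "0 < q i" if "i \<in> J" for i using q_positive that .
  have upd: "(t, x(i := a)) \<in> S" if "(t, x) \<in> S" "i \<in> J" "a < q i" "i \<noteq> v \<or> x u \<noteq> p" for t x i a
  proof -
    have c: "(t, x) \<in> cells" "t < N" using that S cells_iff by auto
    then have "(t, x(i := a)) \<in> cells" using cells_update that by blast
    moreover have "panel_label i (t, x(i := a)) = panel_label i (t, x)"
      using that uv by (auto simp: panel_label_def)
    ultimately show ?thesis using closed[OF that(2,1)] c by (simp add: near_def)
  qed
  have all: "(t, z) \<in> S" if "(t, x) \<in> S" "(t, z) \<in> cells" for t x z
  proof -
    have xc: "x \<in> extensional J" and zc: "z \<in> extensional J" "\<And>i. i \<in> J \<Longrightarrow> z i < q i"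
      using that S by (auto simp: cells_def PiE_def Pi_def)
    have "(t, \<lambda>i. if i \<in> F then z i else if i = u then 0 else x i) \<in> S" if "finite F" "F \<subseteq> J - {u}" for F
      using that
    proof (induction F rule: finite_induct)
      case empty
      have "(\<lambda>i. if i \<in> {} then z i else if i = u then 0 else x i) = x(u := 0)" by auto
      then show ?case using upd[OF \<open>(t, x) \<in> S\<close> uv(1) pos[OF uv(1)]] uv by simp
    next
      case (insert k F)
      let ?w = "\<lambda>i. if i \<in> F then z i else if i = u then 0 else x i"
      have k: "k \<in> J" "k \<noteq> u" "z k < q k" using insert.prems zc by auto
      have w: "(t, ?w) \<in> S" using insert by auto
      have "?w u \<noteq> p" using insert.prems p by auto
      then have "(t, ?w(k := z k)) \<in> S" using upd[OF w k(1,3)] by blast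
      moreover have "?w(k := z k) = (\<lambda>i. if i \<in> insert k F then z i else if i = u then 0 else x i)"
        by (auto simp: fun_eq_iff)
      ultimately show ?case by simp
    qed
    from this[of "J - {u}"] finite_J
    have "(t, \<lambda>i. if i \<in> J - {u} then z i else if i = u then 0 else x i) \<in> S" (is "(t, ?w) \<in> S") by simp
    then have "(t, ?w(u := z u)) \<in> S" using upd uv(1,3) zc(2)[OF uv(1)] by blast
    moreover have "?w(u := z u) = z"
      using xc zc(1) by (auto simp: fun_eq_iff extensional_def)
    ultimately show ?thesis by simp
  qed
  have nxt: "(Suc t mod N, z) \<in> S" if "(t, x) \<in> S" "(Suc t mod N, z) \<in> cells" for t x z
  proof -
    have xc: "(t, x) \<in> cells" "t < N" using that S cells_iff by auto
    let ?y = "x(u := p, v := 0)" and ?y' = "x(u := p, v := 1)"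
    have 1: "(t, ?y) \<in> cells"
      using cells_update[OF cells_update[OF xc(1) uv(1) p(2) xc(2)] uv(2) pos[OF uv(2)] xc(2)] .
    have lt: "Suc t mod N < N" using N by simp
    have 2: "(Suc t mod N, ?y') \<in> cells"
      using cells_update[OF cells_update[OF xc(1) uv(1) p(2) xc(2)] uv(2) _ lt] qv by simp
    have "near v (t, ?y) (Suc t mod N, ?y')"
      using 1 2 uv by (auto simp: near_def panel_label_def fun_eq_iff)
    then have "(Suc t mod N, ?y') \<in> S" using closed uv all[OF that(1) 1] by blast
    then show ?thesis using all that by blast
  qed
  obtain t0 x0 where t0: "(t0, x0) \<in> S" using S by auto
  have t0N: "t0 < N" using t0 S cells_iff by blast
  have reach: "\<exists>x. ((t0 + r) mod N, x) \<in> S" for r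
  proof (induction r)
    case 0
    then show ?case using t0 t0N by auto
  next
    case (Suc r)
    then obtain x where x: "((t0 + r) mod N, x) \<in> S" by blast
    have e: "Suc ((t0 + r) mod N) mod N = (t0 + Suc r) mod N" by (simp add: mod_Suc_eq)
    have "x \<in> PiE J (\<lambda>i. {..<q i})" using x S cells_iff by blast
    then have "(Suc ((t0 + r) mod N) mod N, x) \<in> cells" using cells_iff N by simp
    then show ?case using nxt[OF x] e by metis
  qed
  show ?thesis
  proof (rule equalityI[OF S(1)], rule subsetI)
    fix y assume y: "y \<in> cells"
    obtain t x where e: "y = (t, x)" by (metis surj_pair)
    have t: "t < N" using y by (simp add: e cells_iff)
    have "(t0 + (t + N - t0)) mod N = t" using t t0N by simp
    then obtain x' where "(t, x') \<in> S" using reach[of "t + N - t0"] by metis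
    then show "y \<in> S" using all y e by simp
  qed
qed

lemma rotate_low_closed: "y \<in> cells \<Longrightarrow> rotate_low f y \<in> cells"
proof -
  assume y: "y \<in> cells"
  obtain t x where e: "y = (t, x)" by (metis surj_pair)
  have x: "t < N" "x u < q u" using y uv by (auto simp: e cells_def PiE_def Pi_def)
  have "(if x u < p then (x u + f t) mod p else x u) < q u"
    using p x mod_less_divisor[OF p(1), of "x u + f t"] by (auto intro: less_trans)
  then show ?thesis
    using cells_update[OF _ uv(1) _ x(1)] y unfolding rotate_low_def e fst_conv snd_conv by blast
qed

text \<open>A rotation by an amount depending on \<open>t\<close> respects the panels because the panels that meet
  several copies lie in \<open>x u = p\<close>, where it is the identity.\<close>

lemma rotate_low_near: "near i y z \<Longrightarrow> near i (rotate_low f y) (rotate_low f z)"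
proof -
  assume n: "near i y z"
  obtain t x t' x' where e: "y = (t, x)" "z = (t', x')" by (metis surj_pair)
  have cl: "rotate_low f y \<in> cells" "rotate_low f z \<in> cells"
    using n rotate_low_closed by (auto simp: near_def)
  have lab: "panel_label i (t, x) = panel_label i (t', x')" using n by (simp add: near_def e)
  then have xx: "x(i := 0) = x'(i := 0)" by (simp add: panel_label_def)
  have co: "x k = x' k" if "k \<noteq> i" for k using fun_cong[OF xx, of k] that by simp
  have "panel_label i (rotate_low f y) = panel_label i (rotate_low f z)"
  proof (cases "i = u")
    case True
    have "t = t'" using lab True uv by (simp add: panel_label_def)
    then show ?thesis using True uv xx by (simp add: panel_label_def rotate_low_def e)
  next
    case iu: False
    then have u: "x u = x' u" using co uv by auto
    show ?thesis
    proof (cases "x u < p")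
      case True
      have "t = t'" using lab True u by (auto simp: panel_label_def)
      moreover have "(x u + f t) mod p \<noteq> p" using p by (metis mod_less_divisor less_irrefl)
      ultimately show ?thesis
        using True u iu co by (auto simp: panel_label_def rotate_low_def e fun_eq_iff)
    next
      case False
      then have "rotate_low f y = y" "rotate_low f z = z" using u by (auto simp: rotate_low_def e)
      then show ?thesis using lab by (simp add: e)
    qed
  qed
  then show ?thesis using cl by (simp add: near_def)
qed

lemma rotate_low_compose:
  "rotate_low f (rotate_low g y) = rotate_low (\<lambda>t. (f t + g t) mod p) y"
  using p by (auto simp: rotate_low_def fun_eq_iff mod_simps add_ac)

lemma rotate_low_zero: "rotate_low (\<lambda>t. 0) y = y"
  by (cases y) (auto simp: rotate_low_def fun_eq_iff)

lemma rotate_low_cong: "y \<in> cells \<Longrightarrow> (\<And>t. t < N \<Longrightarrow> f t = g t) \<Longrightarrow> rotate_low f y = rotate_low g y"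
  by (auto simp: rotate_low_def cells_def)

lemma rotate_low_symmetry:
  assumes "\<And>t. t < N \<Longrightarrow> f t < p"
  shows "restrict (rotate_low f) cells \<in> symmetries"
proof -
  have "restrict f {..<N} \<in> PiE {..<N} (\<lambda>_. {..<p})" using assms by auto
  moreover have "restrict (rotate_low f) cells = restrict (rotate_low (restrict f {..<N})) cells"
    by (rule restrict_ext) (rule rotate_low_cong, auto)
  ultimately show ?thesis unfolding symmetries_def by blast
qed

lemma symmetriesE:
  assumes "a \<in> symmetries"
  obtains f where "f \<in> PiE {..<N} (\<lambda>_. {..<p})" "a = restrict (rotate_low f) cells"
  using assms unfolding symmetries_def by blast

lemma symmetries_one: "\<exists>a\<in>symmetries. \<forall>y\<in>cells. a y = y"
proof -
  have 1: "restrict (rotate_low (\<lambda>_. 0)) cells \<in> symmetries"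
    by (rule rotate_low_symmetry) (rule p(1))
  show ?thesis by (rule bexI[OF _ 1]) (simp add: rotate_low_zero)
qed

lemma symmetries_mult:
  assumes "a \<in> symmetries" "b \<in> symmetries" shows "\<exists>c\<in>symmetries. \<forall>y\<in>cells. c y = a (b y)"
proof -
  obtain f where f: "a = restrict (rotate_low f) cells" using symmetriesE[OF assms(1)] by blast
  obtain g where g: "b = restrict (rotate_low g) cells" using symmetriesE[OF assms(2)] by blast
  show ?thesis
    using rotate_low_symmetry[of "\<lambda>t. (f t + g t) mod p"] p
    by (intro bexI[of _ "restrict (rotate_low (\<lambda>t. (f t + g t) mod p)) cells"])
      (auto simp: f g rotate_low_compose rotate_low_closed)
qed

lemma symmetries_inv:
  assumes "a \<in> symmetries" shows "\<exists>b\<in>symmetries. \<forall>y\<in>cells. a (b y) = y \<and> b (a y) = y"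
proof -
  obtain f where f: "f \<in> PiE {..<N} (\<lambda>_. {..<p})" "a = restrict (rotate_low f) cells"
    using symmetriesE[OF assms] by blast
  define g where "g t = (p - f t) mod p" for t
  have fp: "f t < p" if "t < N" for t using f(1) that by auto
  have "(f t + g t) mod p = 0" "(g t + f t) mod p = 0" if "t < N" for t
    using fp[OF that] by (simp_all add: g_def mod_simps)
  then have "rotate_low f (rotate_low g y) = y" "rotate_low g (rotate_low f y) = y" if "y \<in> cells" for y
    unfolding rotate_low_compose using rotate_low_cong[OF that, of _ "\<lambda>t. 0"] rotate_low_zero by auto
  moreover have "restrict (rotate_low g) cells \<in> symmetries"
    using rotate_low_symmetry[of g] p by (simp add: g_def)
  ultimately show ?thesis
    by (intro bexI[of _ "restrict (rotate_low g) cells"]) (auto simp: f rotate_low_closed)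
qed

lemma symmetries_closed: "a \<in> symmetries \<Longrightarrow> y \<in> cells \<Longrightarrow> a y \<in> cells"
  by (elim symmetriesE) (simp add: rotate_low_closed)

lemma symmetries_near: "a \<in> symmetries \<Longrightarrow> near i y z \<Longrightarrow> near i (a y) (a z)"
proof -
  assume "a \<in> symmetries" and n: "near i y z"
  then obtain f where f: "a = restrict (rotate_low f) cells" using symmetriesE by blast
  have "y \<in> cells" "z \<in> cells" using n by (auto simp: near_def)
  then show ?thesis using rotate_low_near[OF n, of f] f by simp
qed

lemma symmetries_extensional: "a \<in> symmetries \<Longrightarrow> a \<in> extensional cells"
  by (elim symmetriesE) simp

lemma card_symmetries: "card symmetries = p ^ N"
proof -
  have "inj_on (\<lambda>f. restrict (rotate_low f) cells) (PiE {..<N} (\<lambda>_. {..<p}))"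
  proof (rule inj_onI)
    fix f g assume f: "f \<in> PiE {..<N} (\<lambda>_. {..<p})" and g: "g \<in> PiE {..<N} (\<lambda>_. {..<p})"
      and eq: "restrict (rotate_low f) cells = restrict (rotate_low g) cells"
    show "f = g"
    proof (rule PiE_ext[OF f g])
      fix t assume t: "t \<in> {..<N}"
      let ?y = "(t, \<lambda>i. if i \<in> J then 0 else undefined)"
      have y: "?y \<in> cells" using t q_positive by (auto simp: cells_def)
      have "rotate_low f ?y = rotate_low g ?y" using fun_cong[OF eq, of ?y] y by simp
      then have "snd (rotate_low f ?y) u = snd (rotate_low g ?y) u" by simp
      then have "f t mod p = g t mod p" using uv p by (simp add: rotate_low_def)
      moreover have "f t < p" "g t < p" using f g t by auto
      ultimately show "f t = g t" by simp
    qed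
  qed
  then have "card symmetries = card (PiE {..<N} (\<lambda>_. {..<p}))"
    unfolding symmetries_def by (rule card_image)
  also have "\<dots> = p ^ N" by (simp add: card_PiE)
  finally show ?thesis .
qed

text \<open>Colours invariant under all symmetries. They select one chamber in each residue of spherical
  type, and this selection is compatible with the group of lifts.\<close>

definition base_colour :: "nat \<Rightarrow> nat" where
  "base_colour i = (if i = u then p else 0)"

lemma base_colour_less: "i \<in> J \<Longrightarrow> base_colour i < q i"
  using p q_positive by (simp add: base_colour_def)

lemma symmetries_base_colour:
  assumes "a \<in> symmetries" "y \<in> cells"
  shows "snd (a y) i = base_colour i \<longleftrightarrow> snd y i = base_colour i"
proof -
  obtain f where "a = restrict (rotate_low f) cells" using symmetriesE[OF assms(1)] by blast
  moreover have "(snd y u + f (fst y)) mod p \<noteq> p" using p by (metis mod_less_divisor less_irrefl)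
  ultimately show ?thesis using assms(2) by (auto simp: rotate_low_def base_colour_def)
qed

lemma card_base_coloured:
  assumes "T \<subseteq> J"
  shows "card {y \<in> cells. \<forall>i\<in>T. snd y i = base_colour i} = N * (\<Prod>i\<in>J - T. q i)"
proof -
  have "{y \<in> cells. \<forall>i\<in>T. snd y i = base_colour i}
      = {..<N} \<times> PiE J (\<lambda>i. if i \<in> T then {base_colour i} else {..<q i})"
  proof (intro Set.set_eqI iffI)
    fix y assume "y \<in> {y \<in> cells. \<forall>i\<in>T. snd y i = base_colour i}"
    then show "y \<in> {..<N} \<times> PiE J (\<lambda>i. if i \<in> T then {base_colour i} else {..<q i})"
      by (cases y) (simp add: cells_iff PiE_iff)
  next
    fix y assume y: "y \<in> {..<N} \<times> PiE J (\<lambda>i. if i \<in> T then {base_colour i} else {..<q i})"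
    obtain t x where e: "y = (t, x)" by (metis surj_pair)
    have x: "x \<in> extensional J" "\<And>i. i \<in> J \<Longrightarrow> x i \<in> (if i \<in> T then {base_colour i} else {..<q i})"
      using y unfolding e PiE_iff mem_Times_iff by auto
    have "x i < q i" if "i \<in> J" for i
      using x(2)[OF that] base_colour_less[OF that] by (simp split: if_split_asm)
    moreover have "x i = base_colour i" if "i \<in> T" for i
      using x(2)[of i] that assms by (simp add: subsetD)
    ultimately show "y \<in> {y \<in> cells. \<forall>i\<in>T. snd y i = base_colour i}"
      using x(1) y by (simp add: e cells_iff PiE_iff)
  qed
  then have "card {y \<in> cells. \<forall>i\<in>T. snd y i = base_colour i}
      = N * (\<Prod>i\<in>J. card (if i \<in> T then {base_colour i} else {..<q i}))"
    by (simp add: card_cartesian_product card_PiE finite_J)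
  also have "(\<Prod>i\<in>J. card (if i \<in> T then {base_colour i} else {..<q i})) = (\<Prod>i\<in>J. if i \<in> T then 1 else q i)"
    by (rule prod.cong) auto
  also have "\<dots> = (\<Prod>i\<in>J - T. q i)"
    by (rule prod.mono_neutral_cong_right) (use finite_J in auto)
  finally show ?thesis .
qed

lemma finite_cells: "finite cells"
  unfolding cells_def using finite_J by (auto intro: finite_PiE)

end

section \<open>The metric of the Davis realisation\<close>

lemma closed_simplex_mono:
  assumes "k \<in> closed_simplex \<sigma>" "\<sigma> \<subseteq> \<tau>" "finite \<tau>"
  shows "k \<in> closed_simplex \<tau>"
proof -
  have "(\<Sum>T\<in>\<tau>. k T) = (\<Sum>T\<in>\<sigma>. k T)"
    by (rule sum.mono_neutral_right) (use assms in \<open>auto simp: closed_simplex_def bary_support_def\<close>)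
  then show ?thesis using assms by (auto simp: closed_simplex_def)
qed

lemma closed_simplex_nonneg: "k \<in> closed_simplex \<sigma> \<Longrightarrow> 0 \<le> k T"
  by (simp add: closed_simplex_def)

lemma closed_simplex_outside: "k \<in> closed_simplex \<sigma> \<Longrightarrow> T \<notin> \<sigma> \<Longrightarrow> k T = 0"
  by (auto simp: closed_simplex_def bary_support_def)

lemma closed_simplex_sum: "k \<in> closed_simplex \<sigma> \<Longrightarrow> (\<Sum>T\<in>\<sigma>. k T) = 1"
  by (simp add: closed_simplex_def)

lemma bary_support_vertex: "bary_support (bary_vertex T) = {T}"
  by (auto simp: bary_support_def bary_vertex_def)

lemma bary_vertex_simplex: "finite \<sigma> \<Longrightarrow> bary_vertex T \<in> closed_simplex \<sigma> \<longleftrightarrow> T \<in> \<sigma>"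
proof -
  assume "finite \<sigma>"
  then have "(\<Sum>U\<in>\<sigma>. bary_vertex T U) = (if T \<in> \<sigma> then 1 else 0)"
    by (simp add: bary_vertex_def)
  then show ?thesis by (auto simp: closed_simplex_def bary_support_vertex) (simp add: bary_vertex_def)
qed

lemma bary_vertex_inj: "bary_vertex T = bary_vertex U \<longleftrightarrow> T = U"
  by (metis bary_support_vertex singleton_inject)

lemma simplex_dist_nonneg: "0 \<le> simplex_dist l n k k'"
  by (simp add: simplex_dist_def L2_set_nonneg)

lemma simplex_dist_sym: "simplex_dist l n k k' = simplex_dist l n k' k"
  unfolding simplex_dist_def L2_set_def by (simp add: power2_commute)

lemma simplex_dist_triangle:
  "simplex_dist l n k k'' \<le> simplex_dist l n k k' + simplex_dist l n k' k''"
  using L2_set_triangle_ineq[of "\<lambda>i. cube_coord l n k i - cube_coord l n k' i"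
      "\<lambda>i. cube_coord l n k' i - cube_coord l n k'' i" "{1..n}"]
  by (simp add: simplex_dist_def)

lemma simplex_dist_refl: "simplex_dist l n k k = 0"
  by (simp add: simplex_dist_def L2_set_def)

lemma cube_coord_diff_le:
  assumes "i \<in> {1..n}"
  shows "\<bar>cube_coord l n k i - cube_coord l n k' i\<bar> \<le> simplex_dist l n k k'"
proof -
  have "cube_coord l n k i - cube_coord l n k' i \<le> simplex_dist l n k k'" for k k'
    unfolding simplex_dist_def
    by (rule member_le_L2_set[of "{1..n}" i "\<lambda>i. cube_coord l n k i - cube_coord l n k' i"])
      (use assms in simp_all)
  from this[of k k'] this[of k' k] show ?thesis by (simp add: simplex_dist_sym abs_le_iff)
qed

context racg
begin

abbreviation "Sph \<equiv> spherical_subsets W s n"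
abbreviation "simplices \<equiv> chamber_simplices W s n"
abbreviation "chamb \<equiv> chamber W s n"

lemma simplicesD:
  assumes "\<sigma> \<in> simplices"
  shows "\<sigma> \<subseteq> Sph" "finite \<sigma>" "\<sigma> \<noteq> {}" "T \<in> \<sigma> \<Longrightarrow> U \<in> \<sigma> \<Longrightarrow> T \<subseteq> U \<or> U \<subseteq> T" "T \<in> \<sigma> \<Longrightarrow> T \<subseteq> {1..n}"
  using assms by (auto simp: chamber_simplices_def poset_simplices_def spherical_subsets_def)

lemma simplicesI:
  "\<sigma> \<subseteq> Sph \<Longrightarrow> \<sigma> \<noteq> {} \<Longrightarrow> (\<And>T U. T \<in> \<sigma> \<Longrightarrow> U \<in> \<sigma> \<Longrightarrow> T \<subseteq> U \<or> U \<subseteq> T) \<Longrightarrow> \<sigma> \<in> simplices"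
  using finite_subset[OF _ finite_spherical_subsets]
  by (simp add: chamber_simplices_def poset_simplices_def)

lemma simplices_subset: "\<sigma> \<in> simplices \<Longrightarrow> \<tau> \<subseteq> \<sigma> \<Longrightarrow> \<tau> \<noteq> {} \<Longrightarrow> \<tau> \<in> simplices"
proof (rule simplicesI)
  fix T U assume "\<sigma> \<in> simplices" "\<tau> \<subseteq> \<sigma>" "T \<in> \<tau>" "U \<in> \<tau>"
  then show "T \<subseteq> U \<or> U \<subseteq> T" using simplicesD(4)[of \<sigma> T U] by blast
qed (use simplicesD(1) in blast)+

lemma simplices_chain: "\<sigma> \<in> simplices \<Longrightarrow> subset.chain UNIV \<sigma>"
  using simplicesD(4) by (auto simp: subset.chain_def)

lemma chamber_iff: "k \<in> chamb \<longleftrightarrow> (\<exists>\<sigma>\<in>simplices. k \<in> closed_simplex \<sigma>)"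
  by (auto simp: chamber_def)

lemma chamber_support:
  assumes "k \<in> chamb"
  shows "bary_support k \<in> simplices" "k \<in> closed_simplex (bary_support k)"
proof -
  obtain \<sigma> where \<sigma>: "\<sigma> \<in> simplices" "k \<in> closed_simplex \<sigma>" using assms chamber_iff by blast
  have sub: "bary_support k \<subseteq> \<sigma>" using \<sigma> by (simp add: closed_simplex_def)
  have "bary_support k \<noteq> {}"
  proof
    assume "bary_support k = {}"
    then have "k T = 0" for T by (auto simp: bary_support_def)
    then show False using closed_simplex_sum[OF \<sigma>(2)] by simp
  qed
  then show "bary_support k \<in> simplices" using simplices_subset[OF \<sigma>(1) sub] by blast
  have "(\<Sum>T\<in>\<sigma>. k T) = (\<Sum>T\<in>bary_support k. k T)"
    by (rule sum.mono_neutral_right) (use sub simplicesD(2)[OF \<sigma>(1)] in \<open>auto simp: bary_support_def\<close>)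
  then show "k \<in> closed_simplex (bary_support k)" using \<sigma>(2) by (simp add: closed_simplex_def)
qed

definition low :: "(nat set \<Rightarrow> real) \<Rightarrow> nat set" where
  "low k = \<Inter> (bary_support k)"

lemma low_in_support: "k \<in> chamb \<Longrightarrow> low k \<in> bary_support k"
proof -
  assume "k \<in> chamb"
  then have s: "bary_support k \<in> simplices" by (rule chamber_support)
  show ?thesis
    unfolding low_def by (rule Inter_in_chain[OF simplicesD(2,3)[OF s] simplices_chain[OF s]])
qed

lemma low_subset: "T \<in> bary_support k \<Longrightarrow> low k \<subseteq> T"
  by (auto simp: low_def)

lemma low_sub_I: "k \<in> chamb \<Longrightarrow> low k \<subseteq> {1..n}"
  using low_in_support chamber_support(1) simplicesD(5) by blast

lemma low_vertex: "low (bary_vertex T) = T"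
  by (simp add: low_def bary_support_vertex)

text \<open>The type \<open>i\<close> vertex can be added to the supporting chain of \<open>k\<close>, without
  meeting the vertex \<open>{}\<close>, exactly when \<open>i\<close> lies in the smallest member of the
  chain. Hence two copies of \<open>k\<close> are identified exactly when their chambers lie in a common
  residue of type \<open>low k\<close>.\<close>

lemma mirror_iff:
  assumes k: "k \<in> chamb" and i: "i \<in> {1..n}"
  shows "k \<in> mirror W s n i \<longleftrightarrow> i \<in> low k"
proof
  assume "k \<in> mirror W s n i"
  then obtain \<sigma> where \<sigma>: "\<sigma> \<in> simplices" "{i} \<in> \<sigma>" "{} \<notin> \<sigma>" "k \<in> closed_simplex \<sigma>"
    by (auto simp: mirror_def)
  have "i \<in> T" if "T \<in> bary_support k" for T
  proof -
    have T: "T \<in> \<sigma>" using that \<sigma>(4) by (auto simp: closed_simplex_def)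
    then have "T \<noteq> {}" "T \<subseteq> {i} \<or> {i} \<subseteq> T" using \<sigma>(3) simplicesD(4)[OF \<sigma>(1) T \<sigma>(2)] by auto
    then show ?thesis by blast
  qed
  then show "i \<in> low k" by (simp add: low_def)
next
  assume "i \<in> low k"
  then have iT: "i \<in> T" if "T \<in> bary_support k" for T using that by (simp add: low_def)
  note cs = chamber_support[OF k]
  have \<sigma>: "insert {i} (bary_support k) \<in> simplices"
  proof (rule simplicesI)
    show "insert {i} (bary_support k) \<subseteq> Sph"
      using simplicesD(1)[OF cs(1)] singleton_spherical[OF i] by blast
    fix T U assume "T \<in> insert {i} (bary_support k)" "U \<in> insert {i} (bary_support k)"
    then show "T \<subseteq> U \<or> U \<subseteq> T" using simplicesD(4)[OF cs(1), of T U] iT by blast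
  qed simp
  have "k \<in> closed_simplex (insert {i} (bary_support k))"
    by (rule closed_simplex_mono[OF cs(2)]) (use simplicesD(2)[OF cs(1)] in auto)
  then show "k \<in> mirror W s n i" unfolding mirror_def using \<sigma> iT by blast
qed

lemma mirrors_low: "k \<in> chamb \<Longrightarrow> {i \<in> {1..n}. k \<in> mirror W s n i} = low k"
  using mirror_iff low_sub_I by blast

lemma cube_coord_simplex:
  assumes \<sigma>: "\<sigma> \<in> simplices" and k: "k \<in> closed_simplex \<sigma>"
  shows "cube_coord l n k i = (\<Sum>T\<in>\<sigma>. k T * (if i \<in> T then l / 2 else 0))"
  unfolding cube_coord_def
  by (rule sum.mono_neutral_right)
    (use simplicesD(5)[OF \<sigma>] closed_simplex_outside[OF k] in auto)

text \<open>For a proper nonempty upper part \<open>F\<close> of a chain there is an index \<open>i\<close> that lies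
  in all members of \<open>F\<close> and in no other member. Up to the factor \<open>l / 2\<close>, the
  sum of the weights over \<open>F\<close> is the \<open>i\<close>-th Euclidean coordinate.\<close>

lemma upper_sum_le:
  assumes \<sigma>: "\<sigma> \<in> simplices" and k: "k \<in> closed_simplex \<sigma>" "k' \<in> closed_simplex \<sigma>" and l: "0 < l"
    and F: "F \<subseteq> \<sigma>" "\<And>T U. T \<in> F \<Longrightarrow> U \<in> \<sigma> \<Longrightarrow> T \<subseteq> U \<Longrightarrow> U \<in> F"
  shows "\<bar>(\<Sum>T\<in>F. k T) - (\<Sum>T\<in>F. k' T)\<bar> \<le> 2 / l * simplex_dist l n k k'"
proof (cases "F = {} \<or> F = \<sigma>")
  case True
  then have "(\<Sum>T\<in>F. k T) = (\<Sum>T\<in>F. k' T)" using closed_simplex_sum k by fastforce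
  then show ?thesis using l simplex_dist_nonneg by simp
next
  case False
  have fin: "finite \<sigma>" "finite F" using simplicesD(2)[OF \<sigma>] F(1) finite_subset by auto
  have "subset.chain UNIV F" "subset.chain UNIV (\<sigma> - F)"
    using simplices_chain[OF \<sigma>] F(1) unfolding subset.chain_def by blast+
  then have in1: "\<Inter> F \<in> F" and in2: "\<Union> (\<sigma> - F) \<in> \<sigma> - F"
    using Inter_in_chain[of F] Union_in_chain[of "\<sigma> - F"] fin False F(1) by auto
  have "\<not> \<Inter> F \<subseteq> \<Union> (\<sigma> - F)" using F(2)[OF in1, of "\<Union> (\<sigma> - F)"] in2 by blast
  then obtain i where i: "i \<in> \<Inter> F" "i \<notin> \<Union> (\<sigma> - F)" by blast
  have iI: "i \<in> {1..n}" using i(1) in1 F(1) simplicesD(5)[OF \<sigma>] by blast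
  have eq: "cube_coord l n h i = l / 2 * (\<Sum>T\<in>F. h T)" if "h \<in> closed_simplex \<sigma>" for h
  proof -
    have "cube_coord l n h i = (\<Sum>T\<in>\<sigma>. h T * (if i \<in> T then l / 2 else 0))"
      by (rule cube_coord_simplex[OF \<sigma> that])
    also have "\<dots> = (\<Sum>T\<in>F. h T * (l / 2))"
      by (rule sum.mono_neutral_cong_right) (use fin F(1) i in auto)
    finally show ?thesis by (simp add: sum_distrib_left mult.commute)
  qed
  have "cube_coord l n k i - cube_coord l n k' i = l / 2 * ((\<Sum>T\<in>F. k T) - (\<Sum>T\<in>F. k' T))"
    by (simp only: eq[OF k(1)] eq[OF k(2)] right_diff_distrib)
  then have "l / 2 * \<bar>(\<Sum>T\<in>F. k T) - (\<Sum>T\<in>F. k' T)\<bar> = \<bar>cube_coord l n k i - cube_coord l n k' i\<bar>"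
    using l by (simp only: abs_mult)
  also have "\<dots> \<le> simplex_dist l n k k'" by (rule cube_coord_diff_le[OF iI])
  finally show ?thesis using l by (simp add: field_simps)
qed

text \<open>A single weight is the difference of the sums over two upper parts of the chain.\<close>

lemma barycentric_lipschitz:
  assumes \<sigma>: "\<sigma> \<in> simplices" and k: "k \<in> closed_simplex \<sigma>" "k' \<in> closed_simplex \<sigma>" and l: "0 < l"
  shows "\<bar>k T - k' T\<bar> \<le> 4 / l * simplex_dist l n k k'"
proof (cases "T \<in> \<sigma>")
  case False
  then have "k T = 0" "k' T = 0" using closed_simplex_outside[OF k(1)] closed_simplex_outside[OF k(2)] by simp_all
  moreover have "0 \<le> 4 / l * simplex_dist l n k k'" using l simplex_dist_nonneg by simp
  ultimately show ?thesis by simp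
next
  case True
  let ?F = "{U \<in> \<sigma>. T \<subseteq> U}" and ?G = "{U \<in> \<sigma>. T \<subset> U}"
  have fin: "finite \<sigma>" using simplicesD(2)[OF \<sigma>] .
  have "?F = insert T ?G" using True by auto
  then have e: "(\<Sum>U\<in>?F. h U) = h T + (\<Sum>U\<in>?G. h U)" for h :: "nat set \<Rightarrow> real" using fin by simp
  have "\<bar>(\<Sum>T\<in>?F. k T) - (\<Sum>T\<in>?F. k' T)\<bar> \<le> 2 / l * simplex_dist l n k k'"
    by (rule upper_sum_le[OF \<sigma> k l]) auto
  moreover have "\<bar>(\<Sum>T\<in>?G. k T) - (\<Sum>T\<in>?G. k' T)\<bar> \<le> 2 / l * simplex_dist l n k k'"
    by (rule upper_sum_le[OF \<sigma> k l]) auto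
  ultimately have "\<bar>k T - k' T\<bar> \<le> 2 / l * simplex_dist l n k k' + 2 / l * simplex_dist l n k k'"
    using e[of k] e[of k'] by linarith
  then show ?thesis by (simp add: field_simps)
qed

lemma simplex_dist_zero_imp_eq:
  assumes "\<sigma> \<in> simplices" "k \<in> closed_simplex \<sigma>" "k' \<in> closed_simplex \<sigma>" "0 < l" "simplex_dist l n k k' = 0"
  shows "k = k'"
proof
  fix T show "k T = k' T" using barycentric_lipschitz[OF assms(1-4), of T] assms(5) by simp
qed

text \<open>If \<open>P\<close> and \<open>P'\<close> have equal distances to all vertices, then \<open>P - P'\<close> is
  orthogonal to \<open>P + P' - 2 c\<close> for every vertex \<open>c\<close>; averaging with the weights of
  \<open>P\<close> shows that it is orthogonal to \<open>P' - P\<close>.\<close>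

lemma simplex_point_determined:
  assumes \<sigma>: "\<sigma> \<in> simplices" and k: "k \<in> closed_simplex \<sigma>" "k' \<in> closed_simplex \<sigma>" and l: "0 < l"
    and eq: "\<And>T. T \<in> \<sigma> \<Longrightarrow> simplex_dist l n k (bary_vertex T) = simplex_dist l n k' (bary_vertex T)"
  shows "k = k'"
proof -
  define P where "P = cube_coord l n k"
  define P' where "P' = cube_coord l n k'"
  define c where "c T i = (if i \<in> T then l / 2 else 0)" for T :: "nat set" and i
  have fin: "finite \<sigma>" using simplicesD(2)[OF \<sigma>] .
  have Pc: "P i = (\<Sum>T\<in>\<sigma>. k T * c T i)" for i
    using cube_coord_simplex[OF \<sigma> k(1)] by (simp add: P_def c_def)
  have cc: "cube_coord l n (bary_vertex T) i = c T i" if "T \<in> \<sigma>" for T i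
  proof -
    have "bary_vertex T \<in> closed_simplex \<sigma>" using bary_vertex_simplex[OF fin] that by blast
    from cube_coord_simplex[OF \<sigma> this]
    have "cube_coord l n (bary_vertex T) i = (\<Sum>U\<in>\<sigma>. bary_vertex T U * c U i)" by (simp add: c_def)
    also have "\<dots> = (\<Sum>U\<in>\<sigma>. if U = T then c T i else 0)"
      by (rule sum.cong) (auto simp: bary_vertex_def)
    finally have "cube_coord l n (bary_vertex T) i = (\<Sum>U\<in>\<sigma>. if U = T then c T i else 0)" .
    then show ?thesis using that fin by simp
  qed
  have z: "(\<Sum>i\<in>{1..n}. (P i - P' i) * (P i + P' i - 2 * c T i)) = 0" if T: "T \<in> \<sigma>" for T
  proof -
    have "(\<Sum>i\<in>{1..n}. (P i - c T i)\<^sup>2) = (\<Sum>i\<in>{1..n}. (P' i - c T i)\<^sup>2)"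
      using eq[OF T] unfolding simplex_dist_def L2_set_def cc[OF T] P_def P'_def by simp
    then have "(\<Sum>i\<in>{1..n}. (P i - c T i)\<^sup>2 - (P' i - c T i)\<^sup>2) = 0" by (simp add: sum_subtractf)
    then show ?thesis by (simp add: power2_eq_square algebra_simps)
  qed
  have "(\<Sum>T\<in>\<sigma>. k T * (\<Sum>i\<in>{1..n}. (P i - P' i) * (P i + P' i - 2 * c T i))) = 0"
    using z by simp
  moreover have "(\<Sum>T\<in>\<sigma>. k T * (\<Sum>i\<in>{1..n}. (P i - P' i) * (P i + P' i - 2 * c T i)))
      = (\<Sum>i\<in>{1..n}. (P i - P' i) * ((P i + P' i) * (\<Sum>T\<in>\<sigma>. k T) - 2 * (\<Sum>T\<in>\<sigma>. k T * c T i)))"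
    unfolding sum_distrib_left sum_subtractf[symmetric]
    by (subst sum.swap) (intro sum.cong HOL.refl, simp add: algebra_simps)
  moreover have "\<dots> = (\<Sum>i\<in>{1..n}. (P i - P' i) * ((P i + P' i) - 2 * P i))"
    by (simp add: closed_simplex_sum[OF k(1)] flip: Pc)
  moreover have "\<dots> = - (\<Sum>i\<in>{1..n}. (P i - P' i)\<^sup>2)"
    unfolding sum_negf[symmetric] by (intro sum.cong HOL.refl) (simp add: power2_eq_square algebra_simps)
  ultimately have "(\<Sum>i\<in>{1..n}. (P i - P' i)\<^sup>2) = 0" by linarith
  then have "simplex_dist l n k k' = 0" by (simp add: simplex_dist_def L2_set_def P_def P'_def)
  then show ?thesis using simplex_dist_zero_imp_eq[OF \<sigma> k l] by blast
qed

end

locale davis = ra_building W s n m q C \<delta>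
  for W :: "('w, 'x) monoid_scheme" (structure) and s n m q and C :: "'c set" and \<delta> +
  fixes l :: real
  assumes l_pos: "0 < l"
begin

abbreviation "Pt \<equiv> davis_realization W s n C \<delta>"
abbreviation "cls \<equiv> davis_class W s n C \<delta>"
abbreviation "ddist \<equiv> davis_dist l W s n C \<delta>"
abbreviation "str \<equiv> davis_string l W s n C \<delta>"
abbreviation "sdist \<equiv> simplex_dist l n"
abbreviation "Vt \<equiv> davis_vertices W s n C \<delta>"
abbreviation "Cells \<equiv> davis_cells W s n C \<delta>"

definition vx :: "'c \<Rightarrow> nat set \<Rightarrow> 'c davis_point" where
  "vx c T = cls c (bary_vertex T)"

definition cell :: "'c \<Rightarrow> nat set set \<Rightarrow> 'c davis_point set" where
  "cell c \<sigma> = cls c ` closed_simplex \<sigma>"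

lemma rel_iff:
  "((c, k), (c', k')) \<in> davis_rel W s n C \<delta> \<longleftrightarrow> k \<in> chamb \<and> k = k' \<and> residue (low k) c c'"
  using residue_iff_delta[OF low_sub_I] residue_closed mirrors_low[of k]
  by (auto simp: davis_rel_def)

lemma cls_eq_set: "k \<in> chamb \<Longrightarrow> cls c k = {c'. residue (low k) c c'} \<times> {k}"
  unfolding davis_class_def Image_singleton by (auto simp: rel_iff)

lemma Pt_iff: "x \<in> Pt \<longleftrightarrow> (\<exists>c\<in>C. \<exists>k\<in>chamb. x = cls c k)"
  unfolding davis_realization_def quotient_def davis_class_def by auto

lemma cls_in: "c \<in> C \<Longrightarrow> k \<in> chamb \<Longrightarrow> cls c k \<in> Pt"
  using Pt_iff by blast

lemma cls_eq_iff:
  assumes "c \<in> C" "c' \<in> C" "k \<in> chamb" "k' \<in> chamb"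
  shows "cls c k = cls c' k' \<longleftrightarrow> k = k' \<and> residue (low k) c c'"
proof
  assume "cls c k = cls c' k'"
  moreover have "(c', k') \<in> cls c' k'" using assms residue_refl by (simp add: cls_eq_set)
  ultimately have "(c', k') \<in> cls c k" by simp
  then show "k = k' \<and> residue (low k) c c'" using assms by (simp add: cls_eq_set)
next
  assume a: "k = k' \<and> residue (low k) c c'"
  then have "residue (low k) c d \<longleftrightarrow> residue (low k) c' d" for d
    using residue_sym[OF low_sub_I[OF assms(3)]] residue_trans by blast
  then show "cls c k = cls c' k'" using a assms by (simp add: cls_eq_set)
qed

lemma simplex_in_chamber: "\<sigma> \<in> simplices \<Longrightarrow> k \<in> closed_simplex \<sigma> \<Longrightarrow> k \<in> chamb"
  using chamber_iff by blast

lemma vertex_in_chamber: "T \<in> Sph \<Longrightarrow> bary_vertex T \<in> chamb"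
proof -
  assume "T \<in> Sph"
  then have "{T} \<in> simplices" by (intro simplicesI) auto
  then show ?thesis using simplex_in_chamber[of "{T}"] bary_vertex_simplex[of "{T}" T] by simp
qed

lemma Sph_sub_I: "T \<in> Sph \<Longrightarrow> T \<subseteq> I"
  by (simp add: spherical_subsets_def)

lemma vx_eq_iff:
  "c \<in> C \<Longrightarrow> c' \<in> C \<Longrightarrow> T \<in> Sph \<Longrightarrow> T' \<in> Sph \<Longrightarrow> vx c T = vx c' T' \<longleftrightarrow> T = T' \<and> residue T c c'"
  by (simp add: vx_def cls_eq_iff vertex_in_chamber bary_vertex_inj low_vertex)

lemma Vt_iff: "v \<in> Vt \<longleftrightarrow> (\<exists>c\<in>C. \<exists>T\<in>Sph. v = vx c T)"
  by (auto simp: davis_vertices_def vx_def)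

lemma Vt_sub_Pt: "Vt \<subseteq> Pt"
  by (auto simp: Vt_iff vx_def cls_in vertex_in_chamber)

lemma Cells_iff: "K \<in> Cells \<longleftrightarrow> (\<exists>c\<in>C. \<exists>\<sigma>\<in>simplices. K = cell c \<sigma>)"
  by (auto simp: davis_cells_def cell_def)

lemma cell_sub: "c \<in> C \<Longrightarrow> \<sigma> \<in> simplices \<Longrightarrow> cell c \<sigma> \<subseteq> Pt"
  using cls_in simplex_in_chamber by (auto simp: cell_def)

lemma vx_in_cell:
  assumes "c \<in> C" "c' \<in> C" "\<sigma> \<in> simplices" "T \<in> Sph"
  shows "vx c' T \<in> cell c \<sigma> \<longleftrightarrow> T \<in> \<sigma> \<and> residue T c c'"
proof
  assume "vx c' T \<in> cell c \<sigma>"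
  then obtain k where k: "k \<in> closed_simplex \<sigma>" "cls c' (bary_vertex T) = cls c k" by (auto simp: cell_def vx_def)
  have kc: "k \<in> chamb" using simplex_in_chamber assms(3) k(1) .
  have "bary_vertex T = k" "residue T c' c"
    using k(2) cls_eq_iff[OF assms(2,1) vertex_in_chamber[OF assms(4)] kc] by (auto simp: low_vertex)
  then show "T \<in> \<sigma> \<and> residue T c c'"
    using k(1) bary_vertex_simplex[OF simplicesD(2)[OF assms(3)]] residue_sym Sph_sub_I assms(4) by blast
next
  assume a: "T \<in> \<sigma> \<and> residue T c c'"
  then have "vx c' T = vx c T" using vx_eq_iff residue_sym Sph_sub_I assms by blast
  moreover have "bary_vertex T \<in> closed_simplex \<sigma>"
    using a bary_vertex_simplex[OF simplicesD(2)[OF assms(3)]] by blast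
  ultimately show "vx c' T \<in> cell c \<sigma>" by (auto simp: cell_def vx_def)
qed

lemma vx_mem_cell: "c \<in> C \<Longrightarrow> \<sigma> \<in> simplices \<Longrightarrow> T \<in> \<sigma> \<Longrightarrow> vx c T \<in> cell c \<sigma>"
  using vx_in_cell[of c c \<sigma> T] residue_refl simplicesD(1) by blast

lemma simplices_Sph: "\<sigma> \<in> simplices \<Longrightarrow> T \<in> \<sigma> \<Longrightarrow> T \<in> Sph"
  using simplicesD(1) by blast

lemma cell_eqI:
  assumes "c \<in> C" "c' \<in> C" "\<sigma> \<in> simplices" "\<And>T. T \<in> \<sigma> \<Longrightarrow> residue T c c'"
  shows "cell c \<sigma> = cell c' \<sigma>"
proof -
  have "cls c k = cls c' k" if k: "k \<in> closed_simplex \<sigma>" for k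
  proof -
    have kc: "k \<in> chamb" using simplex_in_chamber assms(3) k .
    have "low k \<in> \<sigma>" using low_in_support[OF kc] k by (auto simp: closed_simplex_def)
    then show ?thesis using cls_eq_iff[OF assms(1,2) kc kc] assms(4) by blast
  qed
  then show ?thesis unfolding cell_def by (rule image_cong[OF HOL.refl])
qed

lemma cell_vertices: "c \<in> C \<Longrightarrow> \<sigma> \<in> simplices \<Longrightarrow> cell c \<sigma> \<inter> Vt = vx c ` \<sigma>"
proof (intro equalityI subsetI)
  fix v assume a: "c \<in> C" "\<sigma> \<in> simplices" "v \<in> cell c \<sigma> \<inter> Vt"
  then obtain c' T where v: "c' \<in> C" "T \<in> Sph" "v = vx c' T" using Vt_iff by blast
  then have "T \<in> \<sigma>" "residue T c c'" using vx_in_cell[OF a(1) v(1) a(2) v(2)] a(3) by auto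
  then show "v \<in> vx c ` \<sigma>" using vx_eq_iff[OF a(1) v(1) v(2) v(2)] v(3) by auto
next
  fix v assume a: "c \<in> C" "\<sigma> \<in> simplices" "v \<in> vx c ` \<sigma>"
  then obtain T where T: "T \<in> \<sigma>" "v = vx c T" by blast
  then have "v \<in> Vt" using Vt_iff a simplices_Sph by blast
  then show "v \<in> cell c \<sigma> \<inter> Vt" using vx_mem_cell a T by blast
qed

lemma cell_eq_of_vertices:
  assumes "c \<in> C" "c' \<in> C" "\<sigma> \<in> simplices" "\<sigma>' \<in> simplices" "cell c \<sigma> \<inter> Vt = cell c' \<sigma>' \<inter> Vt"
  shows "cell c \<sigma> = cell c' \<sigma>'" "\<sigma> = \<sigma>'"
proof -
  have eq: "vx c ` \<sigma> = vx c' ` \<sigma>'" using assms cell_vertices by simp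
  have 1: "T \<in> \<sigma>' \<and> residue T c c'" if T: "T \<in> \<sigma>" for T
  proof -
    have "vx c T \<in> vx c' ` \<sigma>'" using eq T by blast
    then obtain T' where T': "T' \<in> \<sigma>'" "vx c T = vx c' T'" by blast
    then show ?thesis
      using vx_eq_iff[OF assms(1,2) simplices_Sph[OF assms(3) T] simplices_Sph[OF assms(4) T'(1)]] T' by blast
  qed
  have 2: "T \<in> \<sigma>" if T: "T \<in> \<sigma>'" for T
  proof -
    have "vx c' T \<in> vx c ` \<sigma>" using eq T by blast
    then obtain T' where T': "T' \<in> \<sigma>" "vx c' T = vx c T'" by blast
    then show ?thesis
      using vx_eq_iff[OF assms(2,1) simplices_Sph[OF assms(4) T] simplices_Sph[OF assms(3) T'(1)]] T' by blast
  qed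
  show "\<sigma> = \<sigma>'" using 1 2 by blast
  then show "cell c \<sigma> = cell c' \<sigma>'" using cell_eqI[OF assms(1-3)] 1 by blast
qed

text \<open>All representatives of a point have the same second component. The weight of a point at the
  vertex of type \<open>T\<close> of the chamber \<open>c\<close> is its barycentric coordinate at that
  vertex in the simplicial complex underlying the Davis realisation.\<close>

definition coord :: "'c davis_point \<Rightarrow> nat set \<Rightarrow> real" where
  "coord x = snd (SOME e. e \<in> x)"

definition weight :: "'c \<Rightarrow> nat set \<Rightarrow> 'c davis_point \<Rightarrow> real" where
  "weight c T x = (if \<exists>e\<in>x. residue T c (fst e) then coord x T else 0)"

lemma coord_cls: "c \<in> C \<Longrightarrow> k \<in> chamb \<Longrightarrow> coord (cls c k) = k"
proof -
  assume a: "c \<in> C" "k \<in> chamb"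
  then have "(c, k) \<in> cls c k" using residue_refl by (simp add: cls_eq_set)
  then have "(SOME e. e \<in> cls c k) \<in> cls c k" by (rule someI)
  then show ?thesis using a by (auto simp: coord_def cls_eq_set)
qed

lemma weight_cls:
  assumes "c \<in> C" "k \<in> chamb"
  shows "weight c0 T (cls c k) = (if residue T c0 c then k T else 0)"
proof (cases "k T = 0")
  case True
  then show ?thesis by (simp add: weight_def coord_cls assms)
next
  case False
  then have lt: "low k \<subseteq> T" using low_subset by (simp add: bary_support_def)
  have "(\<exists>e\<in>cls c k. residue T c0 (fst e)) \<longleftrightarrow> residue T c0 c"
  proof
    assume "\<exists>e\<in>cls c k. residue T c0 (fst e)"
    then obtain d where d: "residue (low k) c d" "residue T c0 d" using assms by (auto simp: cls_eq_set)
    then have "residue T d c"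
      using residue_mono[OF lt] residue_sym[OF low_sub_I[OF assms(2)]] by blast
    then show "residue T c0 c" using d residue_trans by blast
  next
    assume "residue T c0 c"
    moreover have "(c, k) \<in> cls c k" using assms residue_refl by (simp add: cls_eq_set)
    ultimately show "\<exists>e\<in>cls c k. residue T c0 (fst e)" by (intro bexI[of _ "(c, k)"]) auto
  qed
  then show ?thesis by (simp add: weight_def coord_cls assms)
qed

lemma str_nonneg: "str x z r \<Longrightarrow> 0 \<le> r"
  by (induction rule: davis_string.induct) (auto simp: simplex_dist_nonneg)

lemma str_trans: "str x y r \<Longrightarrow> str y z r' \<Longrightarrow> str x z (r + r')"
proof (induction rule: davis_string.induct)
  case (Cons c \<sigma> k k' z r)
  then show ?case using davis_string.Cons[OF Cons.hyps(1-4)] by (simp add: add.assoc)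
qed simp

lemma str_step:
  assumes "c \<in> C" "\<sigma> \<in> simplices" "k \<in> closed_simplex \<sigma>" "k' \<in> closed_simplex \<sigma>"
  shows "str (cls c k) (cls c k') (sdist k k')"
  using davis_string.Cons[OF assms davis_string.Nil[OF cls_in[OF assms(1) simplex_in_chamber[OF assms(2,4)]]], of l]
  by simp

lemma str_sym: "str x y r \<Longrightarrow> str y x r"
proof (induction rule: davis_string.induct)
  case (Nil x)
  then show ?case by (rule davis_string.Nil)
next
  case (Cons c \<sigma> k k' z r)
  then show ?case
    using str_trans[OF Cons.IH str_step[OF Cons.hyps(1,2,4,3)]]
    by (simp add: simplex_dist_sym add.commute)
qed

lemma str_to_centre:
  assumes "c \<in> C" "k \<in> chamb"
  shows "\<exists>r. str (cls c k) (vx c {}) r"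
proof -
  note cs = chamber_support[OF assms(2)]
  \<comment> \<open>The vertex of type \<open>{}\<close> can be joined to every simplex of the chamber.\<close>
  let ?\<sigma> = "insert {} (bary_support k)"
  have \<sigma>: "?\<sigma> \<in> simplices"
    using simplicesD(1)[OF cs(1)] empty_spherical simplicesD(4)[OF cs(1)] by (intro simplicesI) auto
  have fin: "finite ?\<sigma>" using simplicesD(2)[OF \<sigma>] .
  have "k \<in> closed_simplex ?\<sigma>" using closed_simplex_mono[OF cs(2) _ fin] by blast
  moreover have "bary_vertex {} \<in> closed_simplex ?\<sigma>" using bary_vertex_simplex[OF fin] by blast
  ultimately show ?thesis using str_step[OF assms(1) \<sigma>] by (auto simp: vx_def)
qed

lemma str_exists:
  assumes "x \<in> Pt" "y \<in> Pt" shows "\<exists>r. str x y r"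
proof -
  obtain c k where x: "c \<in> C" "k \<in> chamb" "x = cls c k" using assms(1) unfolding Pt_iff by blast
  obtain c' k' where y: "c' \<in> C" "k' \<in> chamb" "y = cls c' k'" using assms(2) unfolding Pt_iff by blast
  have "residue I c c'" using gallery_connected x y by blast
  then have "\<exists>r. str (vx c {}) (vx c' {}) r"
  proof (induction rule: residue_induct)
    case base
    have "vx c' {} \<in> Pt" using cls_in y vertex_in_chamber empty_spherical by (simp add: vx_def)
    then show ?case using davis_string.Nil by blast
  next
    case (step d e i)
    have cl: "d \<in> C" "e \<in> C" using step adj_closed by auto
    have S: "{i} \<in> Sph" using singleton_spherical step by blast
    have eq: "vx d {i} = vx e {i}"
      using vx_eq_iff[OF cl S S] residue_adj[of i "{i}" d e] step by simp
    obtain r1 where "str (vx d {i}) (vx d {}) r1"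
      using str_to_centre[OF cl(1) vertex_in_chamber[OF S]] by (auto simp: vx_def)
    moreover obtain r2 where "str (vx e {i}) (vx e {}) r2"
      using str_to_centre[OF cl(2) vertex_in_chamber[OF S]] by (auto simp: vx_def)
    ultimately show ?case using step.IH eq str_sym str_trans by metis
  qed
  then show ?thesis
    using str_to_centre[OF x(1,2)] str_to_centre[OF y(1,2)] str_sym str_trans unfolding x(3) y(3)
    by meson
qed

lemma ddist_le: "x \<in> Pt \<Longrightarrow> y \<in> Pt \<Longrightarrow> str x y r \<Longrightarrow> ddist x y \<le> r"
  unfolding davis_dist_def using str_nonneg
  by (auto intro!: cInf_lower bdd_belowI[of _ 0])

lemma ddist_ge:
  assumes "x \<in> Pt" "y \<in> Pt" "\<And>r. str x y r \<Longrightarrow> a \<le> r"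
  shows "a \<le> ddist x y"
  unfolding davis_dist_def using assms str_exists[OF assms(1,2)]
  by (auto intro!: cInf_greatest)

lemma ddist_less: "x \<in> Pt \<Longrightarrow> y \<in> Pt \<Longrightarrow> ddist x y < a \<Longrightarrow> \<exists>r<a. str x y r"
  using ddist_ge[of x y a] by (meson not_le)

lemma weight_lipschitz:
  assumes "x \<in> Pt" "y \<in> Pt"
  shows "\<bar>weight c0 T x - weight c0 T y\<bar> \<le> 4 / l * ddist x y"
proof -
  have 4: "0 < 4 / l" using l_pos by simp
  have "\<bar>weight c0 T x - weight c0 T z\<bar> \<le> 4 / l * r" if "str x z r" for x z r
    using that
  proof (induction rule: davis_string.induct)
    case (Cons c \<sigma> k k' z r)
    have kc: "k \<in> chamb" "k' \<in> chamb"
      using simplex_in_chamber[OF Cons.hyps(2)] Cons.hyps(3,4) by simp_all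
    have "\<bar>weight c0 T (cls c k) - weight c0 T (cls c k')\<bar> \<le> 4 / l * sdist k k'"
    proof (cases "residue T c0 c")
      case True
      then show ?thesis
        using barycentric_lipschitz[OF Cons.hyps(2-4) l_pos] by (simp add: weight_cls Cons.hyps kc)
    next
      case False
      then show ?thesis using 4 simplex_dist_nonneg by (simp add: weight_cls Cons.hyps kc)
    qed
    then show ?case using Cons.IH by (simp add: distrib_left)
  qed simp
  then have "\<bar>weight c0 T x - weight c0 T y\<bar> / (4 / l) \<le> ddist x y"
  proof (intro ddist_ge[OF assms])
    fix r assume "str x y r"
    then have "\<bar>weight c0 T x - weight c0 T y\<bar> \<le> r * (4 / l)"
      using \<open>\<And>x z r. str x z r \<Longrightarrow> \<bar>weight c0 T x - weight c0 T z\<bar> \<le> 4 / l * r\<close>[of x y r]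
      by (simp only: mult.commute)
    then show "\<bar>weight c0 T x - weight c0 T y\<bar> / (4 / l) \<le> r" by (simp only: pos_divide_le_eq[OF 4])
  qed
  then show ?thesis using 4 by (simp only: pos_divide_le_eq mult.commute)
qed

text \<open>Folding all chambers onto one maps strings to strings in the chamber, and the Euclidean
  coordinates are defined on the whole chamber. Hence no string is shorter than the Euclidean
  distance of the images of its end points.\<close>

lemma ddist_cell:
  assumes "c \<in> C" "\<sigma> \<in> simplices" "k \<in> closed_simplex \<sigma>" "k' \<in> closed_simplex \<sigma>"
  shows "ddist (cls c k) (cls c k') = sdist k k'"
proof (rule antisym)
  have kc: "k \<in> chamb" "k' \<in> chamb" using simplex_in_chamber[OF assms(2)] assms(3,4) by simp_all
  then have P: "cls c k \<in> Pt" "cls c k' \<in> Pt" using cls_in assms by auto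
  show "ddist (cls c k) (cls c k') \<le> sdist k k'" using ddist_le[OF P] str_step assms by blast
  have "sdist (coord x) (coord z) \<le> r" if "str x z r" for x z r
    using that
  proof (induction rule: davis_string.induct)
    case (Nil x)
    then show ?case by (simp add: simplex_dist_refl)
  next
    case (Cons c \<sigma> k k' z r)
    have "k \<in> chamb" "k' \<in> chamb"
      using simplex_in_chamber[OF Cons.hyps(2)] Cons.hyps(3,4) by simp_all
    then show ?case
      using Cons.IH simplex_dist_triangle[of l n k "coord z" k'] by (simp add: coord_cls Cons.hyps)
  qed
  then have "sdist (coord (cls c k)) (coord (cls c k')) \<le> ddist (cls c k) (cls c k')"
    by (rule ddist_ge[OF P])
  then show "sdist k k' \<le> ddist (cls c k) (cls c k')" using kc assms by (simp add: coord_cls)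
qed

lemma weights_separate:
  assumes x: "x \<in> Pt" and y: "y \<in> Pt"
    and eq: "\<And>c T. c \<in> C \<Longrightarrow> weight c T x = weight c T y"
  shows "x = y"
proof -
  obtain c k where c: "c \<in> C" "k \<in> chamb" "x = cls c k" using x unfolding Pt_iff by blast
  obtain c' k' where c': "c' \<in> C" "k' \<in> chamb" "y = cls c' k'" using y unfolding Pt_iff by blast
  have "k T = 0 \<or> residue T c c' \<and> k T = k' T" for T
    using eq[OF c(1), of T] c c' residue_refl[OF c(1)] by (auto simp: weight_cls split: if_split_asm)
  note 1 = this
  have "k' T = 0 \<or> residue T c' c \<and> k T = k' T" for T
    using eq[OF c'(1), of T] c c' residue_refl[OF c'(1)] by (auto simp: weight_cls split: if_split_asm)
  then have "k T = k' T" for T using 1[of T] by metis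
  then have "k = k'" by blast
  moreover have "residue (low k) c c'"
    using 1[of "low k"] low_in_support[OF c(2)] by (auto simp: bary_support_def)
  ultimately show ?thesis using cls_eq_iff c c' by blast
qed

sublocale Metric_space Pt ddist
proof
  show "0 \<le> ddist x y" for x y
  proof (cases "x \<in> Pt \<and> y \<in> Pt")
    case True
    then show ?thesis using ddist_ge[of x y 0] str_nonneg by blast
  qed (auto simp: davis_dist_def)
  have "{r. str x y r} = {r. str y x r}" for x y using str_sym by blast
  then show "ddist x y = ddist y x" for x y by (simp add: davis_dist_def conj_commute)
  show "ddist x y = 0 \<longleftrightarrow> x = y" if P: "x \<in> Pt" "y \<in> Pt" for x y
  proof
    assume "ddist x y = 0"
    then show "x = y" using weights_separate[OF P] weight_lipschitz[OF P] by simp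
  next
    assume "x = y"
    then have "ddist x y \<le> 0" using ddist_le[OF P] davis_string.Nil[OF P(1)] by blast
    moreover have "0 \<le> ddist x y" using ddist_ge[OF P] str_nonneg by blast
    ultimately show "ddist x y = 0" by simp
  qed
  show "ddist x z \<le> ddist x y + ddist y z" if P: "x \<in> Pt" "y \<in> Pt" "z \<in> Pt" for x y z
  proof (rule field_le_epsilon)
    fix e :: real assume e: "0 < e"
    obtain r where r: "r < ddist x y + e / 2" "str x y r"
      using ddist_less[OF P(1,2), of "ddist x y + e / 2"] e by auto
    obtain r' where r': "r' < ddist y z + e / 2" "str y z r'"
      using ddist_less[OF P(2,3), of "ddist y z + e / 2"] e by auto
    have "ddist x z \<le> r + r'" using ddist_le[OF P(1,3) str_trans[OF r(2) r'(2)]] .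
    then show "ddist x z \<le> ddist x y + ddist y z + e" using r r' by linarith
  qed
qed

end

section \<open>The topology of the automorphism group\<close>

context davis
begin

abbreviation "AutG \<equiv> davis_Aut l W s n C \<delta>"
abbreviation "Aut \<equiv> carrier (davis_Aut l W s n C \<delta>)"
abbreviation "AutX \<equiv> davis_Aut_topology l W s n C \<delta>"

lemma Aut_iff:
  "g \<in> Aut \<longleftrightarrow> g \<in> Bij Pt \<and> (\<forall>x\<in>Pt. \<forall>y\<in>Pt. ddist (g x) (g y) = ddist x y) \<and> (`) g ` Cells = Cells"
  by (simp add: davis_Aut_def)

lemma Aut_bij: "g \<in> Aut \<Longrightarrow> bij_betw g Pt Pt"
  by (simp add: Aut_iff Bij_def)

lemma Aut_Pt: "g \<in> Aut \<Longrightarrow> x \<in> Pt \<Longrightarrow> g x \<in> Pt"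
  using Aut_bij bij_betwE by blast

lemma Aut_dist: "g \<in> Aut \<Longrightarrow> x \<in> Pt \<Longrightarrow> y \<in> Pt \<Longrightarrow> ddist (g x) (g y) = ddist x y"
  by (simp add: Aut_iff)

lemma Aut_Cells: "g \<in> Aut \<Longrightarrow> K \<in> Cells \<Longrightarrow> g ` K \<in> Cells"
  unfolding Aut_iff by blast

lemma Aut_Cells_onto: "g \<in> Aut \<Longrightarrow> K \<in> Cells \<Longrightarrow> \<exists>K'\<in>Cells. K = g ` K'"
  unfolding Aut_iff by blast

lemma Cells_sub: "K \<in> Cells \<Longrightarrow> K \<subseteq> Pt"
  using Cells_iff cell_sub by blast

lemma AutI:
  assumes "g \<in> extensional Pt" "bij_betw g Pt Pt"
    "\<And>x y. x \<in> Pt \<Longrightarrow> y \<in> Pt \<Longrightarrow> ddist (g x) (g y) = ddist x y"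
    "\<And>K. K \<in> Cells \<Longrightarrow> g ` K \<in> Cells" "\<And>K. K \<in> Cells \<Longrightarrow> \<exists>K'\<in>Cells. K = g ` K'"
  shows "g \<in> Aut"
  using assms unfolding Aut_iff Bij_def by blast

lemma Aut_inverse:
  assumes g: "g \<in> Aut"
  shows "restrict (inv_into Pt g) Pt \<in> Aut"
    and "x \<in> Pt \<Longrightarrow> restrict (inv_into Pt g) Pt (g x) = x"
    and "x \<in> Pt \<Longrightarrow> g (restrict (inv_into Pt g) Pt x) = x"
proof -
  let ?h = "restrict (inv_into Pt g) Pt"
  note b = Aut_bij[OF g]
  have 1: "?h (g x) = x" "g (?h x) = x" if "x \<in> Pt" for x
    using bij_betw_inv_into_left[OF b that] bij_betw_inv_into_right[OF b that] Aut_Pt[OF g that] that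
    by simp_all
  then show "x \<in> Pt \<Longrightarrow> ?h (g x) = x" "x \<in> Pt \<Longrightarrow> g (?h x) = x" by blast+
  have bh: "bij_betw ?h Pt Pt" using bij_betw_inv_into[OF b] by simp
  have img: "?h ` (g ` K) = K" if "K \<subseteq> Pt" for K
  proof -
    have "?h (g x) = x" if "x \<in> K" for x using 1(1) that \<open>K \<subseteq> Pt\<close> by blast
    then show ?thesis unfolding image_image by simp
  qed
  show "?h \<in> Aut"
  proof (rule AutI[OF _ bh])
    show "?h \<in> extensional Pt" by simp
    fix x y assume xy: "x \<in> Pt" "y \<in> Pt"
    then have "?h x \<in> Pt" "?h y \<in> Pt" using bij_betwE[OF bh] by blast+
    from Aut_dist[OF g this] show "ddist (?h x) (?h y) = ddist x y" using 1(2) xy by metis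
  next
    fix K assume K: "K \<in> Cells"
    then obtain K' where K': "K' \<in> Cells" "K = g ` K'" using Aut_Cells_onto[OF g] by blast
    then show "?h ` K \<in> Cells" using img[OF Cells_sub] by metis
    show "\<exists>K'\<in>Cells. K = ?h ` K'" using img[OF Cells_sub[OF K]] Aut_Cells[OF g K] by metis
  qed
qed

lemma Aut_compose: "g \<in> Aut \<Longrightarrow> h \<in> Aut \<Longrightarrow> compose Pt g h \<in> Aut"
proof -
  assume g: "g \<in> Aut" and h: "h \<in> Aut"
  have e: "compose Pt g h ` K = g ` (h ` K)" if "K \<subseteq> Pt" for K
  proof -
    have "compose Pt g h x = g (h x)" if "x \<in> K" for x using that \<open>K \<subseteq> Pt\<close> by (auto simp: compose_def)
    then show ?thesis unfolding image_image by (rule image_cong[OF HOL.refl])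
  qed
  show ?thesis
  proof (rule AutI)
    show "bij_betw (compose Pt g h) Pt Pt" using bij_betw_compose Aut_bij g h by blast
    fix x y assume "x \<in> Pt" "y \<in> Pt"
    then show "ddist (compose Pt g h x) (compose Pt g h y) = ddist x y"
      using Aut_dist[OF g Aut_Pt[OF h] Aut_Pt[OF h]] Aut_dist[OF h] by (simp add: compose_def)
  next
    fix K assume K: "K \<in> Cells"
    then show "compose Pt g h ` K \<in> Cells" using e[OF Cells_sub] Aut_Cells g h by simp
    obtain K1 where K1: "K1 \<in> Cells" "K = g ` K1" using Aut_Cells_onto[OF g K] by blast
    obtain K2 where "K2 \<in> Cells" "K1 = h ` K2" using Aut_Cells_onto[OF h K1(1)] by blast
    then show "\<exists>K'\<in>Cells. K = compose Pt g h ` K'" using e[OF Cells_sub] K1 by metis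
  qed simp
qed

lemma Aut_mult: "g \<in> Aut \<Longrightarrow> h \<in> Aut \<Longrightarrow> g \<otimes>\<^bsub>AutG\<^esub> h = compose Pt g h"
  by (simp add: davis_Aut_def BijGroup_def)

lemma Aut_one: "\<one>\<^bsub>AutG\<^esub> = (\<lambda>x\<in>Pt. x)"
  by (simp add: davis_Aut_def BijGroup_def)

lemma Aut_id: "(\<lambda>x\<in>Pt. x) \<in> Aut"
proof (rule AutI)
  show "bij_betw (\<lambda>x\<in>Pt. x) Pt Pt" by (simp add: bij_betw_def inj_on_def)
  have e: "(\<lambda>x\<in>Pt. x) ` K = K" if "K \<in> Cells" for K
    using Cells_sub[OF that] by force
  show "\<And>K. K \<in> Cells \<Longrightarrow> (\<lambda>x\<in>Pt. x) ` K \<in> Cells" "\<And>K. K \<in> Cells \<Longrightarrow> \<exists>K'\<in>Cells. K = (\<lambda>x\<in>Pt. x) ` K'"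
    using e by metis+
qed auto

lemma Aut_group: "group AutG"
proof -
  have "subgroup Aut (BijGroup Pt)"
  proof (rule group.subgroupI[OF group_BijGroup])
    show "Aut \<subseteq> carrier (BijGroup Pt)" by (auto simp: Aut_iff BijGroup_def)
    show "Aut \<noteq> {}" using Aut_id by blast
    fix g assume g: "g \<in> Aut"
    then have "inv\<^bsub>BijGroup Pt\<^esub> g = restrict (inv_into Pt g) Pt"
      using inv_BijGroup[of g Pt] by (simp add: Aut_iff)
    then show "inv\<^bsub>BijGroup Pt\<^esub> g \<in> Aut" using Aut_inverse(1)[OF g] by simp
    fix h assume h: "h \<in> Aut"
    have "g \<otimes>\<^bsub>BijGroup Pt\<^esub> h = compose Pt g h"
      using g h by (simp add: BijGroup_def Aut_iff)
    then show "g \<otimes>\<^bsub>BijGroup Pt\<^esub> h \<in> Aut" using Aut_compose g h by simp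
  qed
  then have "group (BijGroup Pt\<lparr>carrier := Aut\<rparr>)"
    using subgroup.subgroup_is_group group_BijGroup by blast
  moreover have "BijGroup Pt\<lparr>carrier := Aut\<rparr> = AutG" by (simp add: davis_Aut_def)
  ultimately show ?thesis by simp
qed

lemma vertex_cell: "v \<in> Vt \<longleftrightarrow> {v} \<in> Cells"
proof
  assume "v \<in> Vt"
  then obtain c T where v: "c \<in> C" "T \<in> Sph" "v = vx c T" using Vt_iff by blast
  have "{T} \<in> simplices" using v(2) by (intro simplicesI) auto
  moreover have "closed_simplex {T} = {bary_vertex T}"
  proof (intro equalityI subsetI)
    fix k assume k: "k \<in> closed_simplex {T}"
    have "k U = bary_vertex T U" for U
      using closed_simplex_outside[OF k, of U] closed_simplex_sum[OF k] by (auto simp: bary_vertex_def)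
    then show "k \<in> {bary_vertex T}" by blast
  qed (simp add: bary_vertex_simplex)
  ultimately have "{T} \<in> simplices" "{v} = cell c {T}" by (simp_all add: cell_def vx_def v(3))
  then show "{v} \<in> Cells" unfolding Cells_iff using v(1) by blast
next
  assume "{v} \<in> Cells"
  then obtain c \<sigma> where c: "c \<in> C" "\<sigma> \<in> simplices" "{v} = cell c \<sigma>" unfolding Cells_iff by blast
  obtain T where T: "T \<in> \<sigma>" using simplicesD(3)[OF c(2)] by blast
  then have "vx c T = v" using vx_mem_cell[OF c(1,2)] c(3) by blast
  then show "v \<in> Vt" using Vt_iff c(1) simplices_Sph[OF c(2) T] by blast
qed

lemma Aut_Vt: "g \<in> Aut \<Longrightarrow> v \<in> Vt \<Longrightarrow> g v \<in> Vt"
  using vertex_cell Aut_Cells[of g "{v}"] by simp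

lemma Aut_Vt_rev:
  assumes g: "g \<in> Aut" and x: "x \<in> Pt" "g x \<in> Vt" shows "x \<in> Vt"
proof -
  let ?h = "restrict (inv_into Pt g) Pt"
  have "?h (g x) \<in> Vt" using Aut_Vt[OF Aut_inverse(1)[OF g] x(2)] .
  then show ?thesis using Aut_inverse(2)[OF g x(1)] by simp
qed

lemma image_cell_vertices: "g \<in> Aut \<Longrightarrow> K \<in> Cells \<Longrightarrow> g ` K \<inter> Vt = g ` (K \<inter> Vt)"
proof (intro equalityI subsetI)
  fix y assume a: "g \<in> Aut" "K \<in> Cells" "y \<in> g ` K \<inter> Vt"
  then obtain x where x: "x \<in> K" "y = g x" by blast
  then show "y \<in> g ` (K \<inter> Vt)" using Aut_Vt_rev[OF a(1), of x] Cells_sub[OF a(2)] a(3) by blast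
next
  fix y assume "g \<in> Aut" "K \<in> Cells" "y \<in> g ` (K \<inter> Vt)"
  then show "y \<in> g ` K \<inter> Vt" using Aut_Vt by blast
qed

text \<open>Automorphisms that agree on the vertices of a cell map it onto the same cell, because a cell is
  determined by its vertices; they agree inside because a point of a Euclidean simplex is determined
  by its distances to the vertices.\<close>

lemma agree_on_cell:
  assumes g: "g \<in> Aut" and h: "h \<in> Aut" and K: "K \<in> Cells"
    and agree: "\<And>v. v \<in> K \<inter> Vt \<Longrightarrow> g v = h v" and x: "x \<in> K"
  shows "g x = h x"
proof -
  obtain c \<sigma> where c: "c \<in> C" "\<sigma> \<in> simplices" "g ` K = cell c \<sigma>" using Aut_Cells[OF g K] unfolding Cells_iff by blast
  obtain c' \<sigma>' where c': "c' \<in> C" "\<sigma>' \<in> simplices" "h ` K = cell c' \<sigma>'"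
    using Aut_Cells[OF h K] unfolding Cells_iff by blast
  have "cell c \<sigma> \<inter> Vt = g ` (K \<inter> Vt)" using image_cell_vertices[OF g K] c by simp
  also have "\<dots> = h ` (K \<inter> Vt)" using agree by simp
  also have "\<dots> = cell c' \<sigma>' \<inter> Vt" using image_cell_vertices[OF h K] c' by simp
  finally have vt: "cell c \<sigma> \<inter> Vt = cell c' \<sigma>' \<inter> Vt" .
  then have eq: "cell c \<sigma> = cell c' \<sigma>'" using cell_eq_of_vertices c(1,2) c'(1,2) by blast
  have "g x \<in> cell c \<sigma>" "h x \<in> cell c \<sigma>"
    using imageI[OF x, of g] imageI[OF x, of h] unfolding c(3) c'(3) eq by simp_all
  then obtain k k' where k: "k \<in> closed_simplex \<sigma>" "g x = cls c k" "k' \<in> closed_simplex \<sigma>" "h x = cls c k'"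
    by (auto simp: cell_def)
  have xP: "x \<in> Pt" using Cells_sub K x by blast
  have "k = k'"
  proof (rule simplex_point_determined[OF c(2) k(1,3) l_pos])
    fix T assume T: "T \<in> \<sigma>"
    have "vx c ` \<sigma> = g ` (K \<inter> Vt)"
      using cell_vertices[OF c(1,2)] image_cell_vertices[OF g K] unfolding c(3) by simp
    then have "vx c T \<in> g ` (K \<inter> Vt)" using T by blast
    then obtain v where v: "v \<in> K \<inter> Vt" "vx c T = g v" by blast
    have bT: "bary_vertex T \<in> closed_simplex \<sigma>" using bary_vertex_simplex[OF simplicesD(2)[OF c(2)]] T by blast
    have vP: "v \<in> Pt" using v Vt_sub_Pt by blast
    have "sdist k (bary_vertex T) = ddist (g x) (g v)"
      using ddist_cell[OF c(1,2) k(1) bT] k(2) v(2) by (simp add: vx_def)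
    also have "\<dots> = ddist (h x) (h v)" using Aut_dist[OF g xP vP] Aut_dist[OF h xP vP] by simp
    also have "\<dots> = sdist k' (bary_vertex T)"
      using ddist_cell[OF c(1,2) k(3) bT] k(4) v agree by (simp add: vx_def)
    finally show "sdist k (bary_vertex T) = sdist k' (bary_vertex T)" .
  qed
  then show ?thesis using k by simp
qed

lemma cell_finite_vertices: "K \<in> Cells \<Longrightarrow> finite (K \<inter> Vt)"
  using cell_vertices simplicesD(2) Cells_iff by (metis finite_imageI)

lemma point_in_cell: "x \<in> Pt \<Longrightarrow> \<exists>K\<in>Cells. x \<in> K"
proof -
  assume "x \<in> Pt"
  then obtain c k where c: "c \<in> C" "k \<in> chamb" "x = cls c k" unfolding Pt_iff by blast
  then have "x \<in> cell c (bary_support k)" using chamber_support(2) by (simp add: cell_def)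
  then show ?thesis using Cells_iff c(1) chamber_support(1)[OF c(2)] by blast
qed

lemma Aut_faithful:
  assumes "g \<in> Aut" "h \<in> Aut" "\<And>v. v \<in> Vt \<Longrightarrow> g v = h v"
  shows "g = h"
proof (rule extensionalityI[of _ Pt])
  show "g \<in> extensional Pt" "h \<in> extensional Pt" using assms by (auto simp: Aut_iff Bij_def)
  fix x assume "x \<in> Pt"
  then obtain K where "K \<in> Cells" "x \<in> K" using point_in_cell by blast
  then show "g x = h x" using agree_on_cell assms by blast
qed

lemma residue_finite_Sph: "T \<in> Sph \<Longrightarrow> finite {d. residue T c d}"
  by (rule residue_finite[OF Sph_sub_I]) (use spherical_imp_indep in blast)+

definition around :: "'c \<Rightarrow> nat set \<Rightarrow> 'c davis_point set" where
  "around c T = (\<lambda>(d, U). vx d U) ` ({d. residue T c d} \<times> Sph)"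

lemma around_finite: "T \<in> Sph \<Longrightarrow> finite (around c T)"
  unfolding around_def using residue_finite_Sph finite_spherical_subsets by blast

lemma around_sub: "around c T \<subseteq> Vt"
proof
  fix v assume "v \<in> around c T"
  then obtain d U where d: "residue T c d" "U \<in> Sph" "v = vx d U" by (auto simp: around_def)
  then show "v \<in> Vt" unfolding Vt_iff using residue_closed(2)[OF d(1)] by blast
qed

lemma weight_vx:
  "c \<in> C \<Longrightarrow> T \<in> Sph \<Longrightarrow> weight c0 U (vx c T) = (if residue U c0 c \<and> U = T then 1 else 0)"
proof -
  assume "c \<in> C" "T \<in> Sph"
  then have "weight c0 U (vx c T) = (if residue U c0 c then bary_vertex T U else 0)"
    unfolding vx_def using weight_cls vertex_in_chamber by blast
  then show ?thesis by (auto simp: bary_vertex_def)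
qed

lemma vertices_apart:
  assumes "v \<in> Vt" "w \<in> Vt" "v \<noteq> w" shows "l / 4 \<le> ddist v w"
proof -
  obtain c T where v: "c \<in> C" "T \<in> Sph" "v = vx c T" using assms Vt_iff by blast
  obtain c' T' where w: "c' \<in> C" "T' \<in> Sph" "w = vx c' T'" using assms Vt_iff by blast
  have "weight c T v = 1" using v residue_refl by (simp add: weight_vx)
  moreover have "weight c T w = 0"
    using assms(3) v w vx_eq_iff[OF v(1) w(1) v(2) w(2)] by (auto simp: weight_vx)
  ultimately have "1 \<le> 4 / l * ddist v w"
    using weight_lipschitz[of v w c T] assms Vt_sub_Pt by auto
  then show ?thesis using l_pos by (simp add: field_simps)
qed

lemma open_star: "openin (davis_topology l W s n C \<delta>) {x \<in> Pt. 0 < weight c T x}"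
  unfolding davis_topology_def openin_mtopology
proof (intro conjI allI impI)
  fix x assume x: "x \<in> {x \<in> Pt. 0 < weight c T x}"
  let ?r = "weight c T x * l / 4"
  have "0 < weight c T y" if "y \<in> Pt" "ddist x y < ?r" for y
  proof -
    have "\<bar>weight c T x - weight c T y\<bar> \<le> 4 / l * ddist x y" using weight_lipschitz x that by blast
    also have "\<dots> < 4 / l * ?r" using that l_pos by (intro mult_strict_left_mono) auto
    also have "\<dots> = weight c T x" using l_pos by simp
    finally show ?thesis by linarith
  qed
  moreover have "0 < ?r" using x l_pos by simp
  ultimately show "\<exists>r>0. mball x r \<subseteq> {x \<in> Pt. 0 < weight c T x}"
    by (intro exI[of _ ?r]) auto
qed auto

text \<open>A compact set is covered by finitely many open stars of vertices, and each star meets finitely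
  many closed cells.\<close>

lemma compact_finite_vertices:
  assumes Q: "compactin (davis_topology l W s n C \<delta>) Q"
  shows "\<exists>F. finite F \<and> F \<subseteq> Vt \<and>
    (\<forall>g\<in>Aut. \<forall>h\<in>Aut. (\<forall>v\<in>F. g v = h v) \<longrightarrow> (\<forall>x\<in>Q. g x = h x))"
proof -
  have QP: "Q \<subseteq> Pt" using compactin_subset_topspace[OF Q] by (simp add: davis_topology_def)
  let ?st = "\<lambda>(c, T). {x \<in> Pt. 0 < weight c T x}"
  have cover: "Q \<subseteq> \<Union> (?st ` (C \<times> Sph))"
  proof
    fix x assume "x \<in> Q"
    then have "x \<in> Pt" using QP by blast
    then obtain c k where c: "c \<in> C" "k \<in> chamb" "x = cls c k" unfolding Pt_iff by blast
    note cs = chamber_support[OF c(2)]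
    have "low k \<in> Sph" using low_in_support[OF c(2)] simplicesD(1)[OF cs(1)] by blast
    moreover have "0 < k (low k)"
      using low_in_support[OF c(2)] closed_simplex_nonneg[OF cs(2), of "low k"]
      by (simp add: bary_support_def order_less_le)
    ultimately show "x \<in> \<Union> (?st ` (C \<times> Sph))"
      using c residue_refl cls_in by (intro UN_I[of "(c, low k)"]) (auto simp: weight_cls)
  qed
  have "\<forall>U\<in>?st ` (C \<times> Sph). openin (davis_topology l W s n C \<delta>) U" using open_star by auto
  then obtain \<F> where \<F>: "finite \<F>" "\<F> \<subseteq> ?st ` (C \<times> Sph)" "Q \<subseteq> \<Union>\<F>"
    using Q cover unfolding compactin_def by (elim conjE allE[of _ "?st ` (C \<times> Sph)"]) blast
  obtain B where B: "B \<subseteq> C \<times> Sph" "finite B" "\<F> = ?st ` B" using finite_subset_image[OF \<F>(1,2)] by blast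
  let ?F = "\<Union>(c, T)\<in>B. around c T"
  have "finite ?F" using B around_finite by (intro finite_UN_I) auto
  moreover have "?F \<subseteq> Vt" using around_sub by auto
  moreover have "g x = h x" if g: "g \<in> Aut" and h: "h \<in> Aut" and a: "\<forall>v\<in>?F. g v = h v" and x: "x \<in> Q" for g h x
  proof -
    obtain c0 T0 where b: "(c0, T0) \<in> B" "x \<in> Pt" "0 < weight c0 T0 x" using x \<F>(3) B(3) by auto
    obtain c k where c: "c \<in> C" "k \<in> chamb" "x = cls c k" using b(2) unfolding Pt_iff by blast
    note cs = chamber_support[OF c(2)]
    have r: "residue T0 c0 c" using b(3) c by (auto simp: weight_cls split: if_split_asm)
    have "cell c (bary_support k) \<inter> Vt \<subseteq> around c0 T0"
      using cell_vertices[OF c(1) cs(1)] r simplicesD(1)[OF cs(1)] by (auto simp: around_def)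
    moreover have "around c0 T0 \<subseteq> ?F" using b(1) by (intro UN_upper[of "(c0, T0)", THEN order_trans]) auto
    ultimately have agree: "g v = h v" if "v \<in> cell c (bary_support k) \<inter> Vt" for v
      using a that by (meson subsetD)
    have 1: "x \<in> cell c (bary_support k)" using c cs(2) by (simp add: cell_def)
    have 2: "cell c (bary_support k) \<in> Cells" unfolding Cells_iff using c(1) cs(1) by blast
    show ?thesis by (rule agree_on_cell[OF g h 2 agree 1])
  qed
  ultimately show ?thesis by (intro exI[of _ ?F]) simp
qed

lemma open_vertex_image:
  assumes "v \<in> Vt" "w \<in> Vt" shows "openin AutX {h \<in> Aut. h v = w}"
proof -
  have "{h \<in> Aut. h v = w} = {h \<in> Aut. h ` {v} \<subseteq> mball w (l / 4)}"
  proof (intro equalityI subsetI)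
    fix h assume h: "h \<in> {h \<in> Aut. h ` {v} \<subseteq> mball w (l / 4)}"
    then have "h v \<in> Vt" "ddist w (h v) < l / 4" using Aut_Vt assms(1) by auto
    then have "h v = w" using vertices_apart[OF assms(2), of "h v"] by force
    then show "h \<in> {h \<in> Aut. h v = w}" using h by simp
  next
    fix h assume "h \<in> {h \<in> Aut. h v = w}"
    then show "h \<in> {h \<in> Aut. h ` {v} \<subseteq> mball w (l / 4)}" using assms(2) Vt_sub_Pt l_pos by auto
  qed
  moreover have "compactin (davis_topology l W s n C \<delta>) {v}"
    using assms Vt_sub_Pt by (auto simp: davis_topology_def)
  moreover have "openin (davis_topology l W s n C \<delta>) (mball w (l / 4))"
    by (simp add: davis_topology_def)
  ultimately show ?thesis
    unfolding davis_Aut_topology_def compact_open_topology_def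
    by (intro topology_generated_by_Basis) blast
qed

lemma open_Aut: "openin AutX Aut"
proof -
  have "Aut = {h \<in> Aut. h ` {} \<subseteq> {}}" by simp
  moreover have "compactin (davis_topology l W s n C \<delta>) {}" "openin (davis_topology l W s n C \<delta>) {}"
    by simp_all
  ultimately show ?thesis
    unfolding davis_Aut_topology_def compact_open_topology_def
    by (intro topology_generated_by_Basis) blast
qed

lemma open_agree:
  assumes "finite F" "F \<subseteq> Vt" "g \<in> Aut"
  shows "openin AutX {h \<in> Aut. \<forall>v\<in>F. h v = g v}"
  using assms
proof (induction F rule: finite_induct)
  case empty
  then show ?case using open_Aut by simp
next
  case (insert v F)
  have "openin AutX ({h \<in> Aut. h v = g v} \<inter> {h \<in> Aut. \<forall>v\<in>F. h v = g v})"
    using insert open_vertex_image Aut_Vt by (intro openin_Int) auto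
  moreover have "{h \<in> Aut. h v = g v} \<inter> {h \<in> Aut. \<forall>v\<in>F. h v = g v}
      = {h \<in> Aut. \<forall>v\<in>insert v F. h v = g v}" by auto
  ultimately show ?case by simp
qed

text \<open>One direction is \<open>compact_finite_vertices\<close>; the other holds because distinct vertices
  have distance at least \<open>l / 4\<close>, so that a small ball around a vertex isolates it.\<close>

lemma AutX_open_iff:
  "openin AutX U \<longleftrightarrow> U \<subseteq> Aut \<and>
    (\<forall>g\<in>U. \<exists>F. finite F \<and> F \<subseteq> Vt \<and> {h \<in> Aut. \<forall>v\<in>F. h v = g v} \<subseteq> U)"
proof
  assume "openin AutX U"
  then have "generate_topology_on {{f \<in> Aut. f ` Q \<subseteq> U} | Q U. compactin (davis_topology l W s n C \<delta>) Q \<and>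
      openin (davis_topology l W s n C \<delta>) U} U"
    unfolding davis_Aut_topology_def compact_open_topology_def by (rule openin_topology_generated_by)
  then show "U \<subseteq> Aut \<and> (\<forall>g\<in>U. \<exists>F. finite F \<and> F \<subseteq> Vt \<and> {h \<in> Aut. \<forall>v\<in>F. h v = g v} \<subseteq> U)"
  proof (induction rule: generate_topology_on.induct)
    case Empty
    then show ?case by simp
  next
    case (Int A B)
    have "\<exists>F. finite F \<and> F \<subseteq> Vt \<and> {h \<in> Aut. \<forall>v\<in>F. h v = g v} \<subseteq> A \<inter> B" if g: "g \<in> A \<inter> B" for g
    proof -
      obtain F where F: "finite F" "F \<subseteq> Vt" "{h \<in> Aut. \<forall>v\<in>F. h v = g v} \<subseteq> A" using Int.IH(1) g by blast
      obtain F' where F': "finite F'" "F' \<subseteq> Vt" "{h \<in> Aut. \<forall>v\<in>F'. h v = g v} \<subseteq> B" using Int.IH(2) g by blast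
      show ?thesis using F F' by (intro exI[of _ "F \<union> F'"]) blast
    qed
    moreover have "A \<inter> B \<subseteq> Aut" using Int.IH(1) by blast
    ultimately show ?case by blast
  next
    case (UN K)
    have "\<exists>F. finite F \<and> F \<subseteq> Vt \<and> {h \<in> Aut. \<forall>v\<in>F. h v = g v} \<subseteq> \<Union> K" if gK: "g \<in> \<Union> K" for g
    proof -
      obtain k where k: "k \<in> K" "g \<in> k" using gK by blast
      obtain F where "finite F" "F \<subseteq> Vt" "{h \<in> Aut. \<forall>v\<in>F. h v = g v} \<subseteq> k"
        using bspec[OF conjunct2[OF UN.IH[OF k(1)]] k(2)] by (elim exE conjE)
      moreover have "k \<subseteq> \<Union> K" using k(1) by (rule Union_upper)
      ultimately show ?thesis by (intro exI[of _ F]) simp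
    qed
    moreover have "\<Union> K \<subseteq> Aut" by (rule Union_least) (rule conjunct1[OF UN.IH])
    ultimately show ?case by simp
  next
    case (Basis B)
    then obtain Q U where B: "compactin (davis_topology l W s n C \<delta>) Q" "B = {f \<in> Aut. f ` Q \<subseteq> U}" by blast
    obtain F where F: "finite F" "F \<subseteq> Vt"
      "\<forall>g\<in>Aut. \<forall>h\<in>Aut. (\<forall>v\<in>F. g v = h v) \<longrightarrow> (\<forall>x\<in>Q. g x = h x)"
      using compact_finite_vertices[OF B(1)] by (elim exE conjE)
    have "{h \<in> Aut. \<forall>v\<in>F. h v = g v} \<subseteq> B" if g: "g \<in> B" for g
    proof
      fix h assume h: "h \<in> {h \<in> Aut. \<forall>v\<in>F. h v = g v}"
      then have "h \<in> Aut" "g \<in> Aut" "\<forall>v\<in>F. h v = g v" using g B(2) by auto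
      then have "\<forall>x\<in>Q. h x = g x" using F(3) by simp
      then have "h ` Q = g ` Q" by simp
      then show "h \<in> B" using g h B(2) by simp
    qed
    then have "\<forall>g\<in>B. \<exists>F. finite F \<and> F \<subseteq> Vt \<and> {h \<in> Aut. \<forall>v\<in>F. h v = g v} \<subseteq> B"
      using F(1,2) by (intro ballI exI[of _ F]) simp
    moreover have "B \<subseteq> Aut" using B(2) by simp
    ultimately show ?case by simp
  qed
next
  assume U: "U \<subseteq> Aut \<and> (\<forall>g\<in>U. \<exists>F. finite F \<and> F \<subseteq> Vt \<and> {h \<in> Aut. \<forall>v\<in>F. h v = g v} \<subseteq> U)"
  show "openin AutX U"
  proof (subst openin_subopen, intro ballI)
    fix g assume g: "g \<in> U"
    then obtain F where F: "finite F" "F \<subseteq> Vt" "{h \<in> Aut. \<forall>v\<in>F. h v = g v} \<subseteq> U"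
      using bspec[OF conjunct2[OF U] g] by (elim exE conjE)
    have gA: "g \<in> Aut" using U g by blast
    have "g \<in> {h \<in> Aut. \<forall>v\<in>F. h v = g v}" using gA by simp
    then show "\<exists>T. openin AutX T \<and> g \<in> T \<and> T \<subseteq> U" 
      using open_agree[OF F(1,2) gA] F(3) by (intro exI conjI)
  qed
qed

end

context davis
begin

definition neighbours :: "'c davis_point \<Rightarrow> 'c davis_point set" where
  "neighbours v = {w \<in> Vt. \<exists>K\<in>Cells. v \<in> K \<and> w \<in> K}"

lemma neighbours_finite: "v \<in> Vt \<Longrightarrow> finite (neighbours v)"
proof -
  assume "v \<in> Vt"
  then obtain c T where v: "c \<in> C" "T \<in> Sph" "v = vx c T" unfolding Vt_iff by blast
  have "neighbours v \<subseteq> around c T"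
  proof
    fix w assume "w \<in> neighbours v"
    then obtain K where K: "K \<in> Cells" "v \<in> K" "w \<in> K" "w \<in> Vt" unfolding neighbours_def by blast
    obtain d \<sigma> where d: "d \<in> C" "\<sigma> \<in> simplices" "K = cell d \<sigma>" using K(1) unfolding Cells_iff by blast
    have "residue T d c" using vx_in_cell[OF d(1) v(1) d(2) v(2)] K(2) v(3) d(3) by simp
    then have "residue T c d" by (rule residue_sym[OF Sph_sub_I[OF v(2)]])
    moreover have "w \<in> vx d ` \<sigma>" using K(3,4) cell_vertices[OF d(1,2)] d(3) by blast
    ultimately show "w \<in> around c T" using simplicesD(1)[OF d(2)] unfolding around_def by force
  qed
  then show ?thesis using around_finite[OF v(2)] by (rule finite_subset)
qed

lemma Aut_neighbours: "g \<in> Aut \<Longrightarrow> w \<in> neighbours v \<Longrightarrow> g w \<in> neighbours (g v)"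
proof -
  assume g: "g \<in> Aut" and "w \<in> neighbours v"
  then obtain K where "w \<in> Vt" "K \<in> Cells" "v \<in> K" "w \<in> K" unfolding neighbours_def by blast
  then have "g w \<in> Vt" "g ` K \<in> Cells" "g v \<in> g ` K" "g w \<in> g ` K"
    using Aut_Vt[OF g] Aut_Cells[OF g] by simp_all
  then show ?thesis unfolding neighbours_def by (intro CollectI conjI bexI[of _ "g ` K"])
qed

lemma neighbours_cell: "c \<in> C \<Longrightarrow> \<sigma> \<in> simplices \<Longrightarrow> T \<in> \<sigma> \<Longrightarrow> U \<in> \<sigma> \<Longrightarrow> vx c U \<in> neighbours (vx c T)"
proof -
  assume a: "c \<in> C" "\<sigma> \<in> simplices" "T \<in> \<sigma>" "U \<in> \<sigma>"
  have "cell c \<sigma> \<in> Cells" unfolding Cells_iff using a by blast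
  moreover have "vx c U \<in> Vt" unfolding Vt_iff using a(1) simplices_Sph[OF a(2,4)] by blast
  ultimately show ?thesis unfolding neighbours_def
    using vx_mem_cell[OF a(1,2,3)] vx_mem_cell[OF a(1,2,4)]
    by (intro CollectI conjI bexI[of _ "cell c \<sigma>"])
qed

lemma flag_simplex: "T \<in> Sph \<Longrightarrow> {{}, T} \<in> simplices"
  using empty_spherical by (intro simplicesI) auto

lemma vertices_connected:
  assumes "v \<in> Vt" "w \<in> Vt"
  shows "(\<lambda>v w. v \<in> Vt \<and> w \<in> neighbours v)\<^sup>*\<^sup>* v w"
proof -
  let ?R = "\<lambda>v w. v \<in> Vt \<and> w \<in> neighbours v"
  have VtI: "vx c T \<in> Vt" if "c \<in> C" "T \<in> Sph" for c T unfolding Vt_iff using that by blast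
  have down: "?R (vx c T) (vx c {})" and up: "?R (vx c {}) (vx c T)" if "c \<in> C" "T \<in> Sph" for c T
    using neighbours_cell[OF that(1) flag_simplex[OF that(2)]] VtI[OF that] VtI[OF that(1) empty_spherical]
    by auto
  obtain c T where v: "c \<in> C" "T \<in> Sph" "v = vx c T" using assms(1) unfolding Vt_iff by blast
  obtain d U where w: "d \<in> C" "U \<in> Sph" "w = vx d U" using assms(2) unfolding Vt_iff by blast
  have "residue I c d" by (rule gallery_connected[OF v(1) w(1)])
  then have "?R\<^sup>*\<^sup>* (vx c {}) (vx d {})"
  proof (induction rule: residue_induct)
    case (step c e i)
    have cl: "c \<in> C" "e \<in> C" using step adj_closed by auto
    have S: "{i} \<in> Sph" using singleton_spherical step by blast
    have eq: "vx c {i} = vx e {i}"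
      using vx_eq_iff[OF cl S S] residue_adj[of i "{i}" c e] step by simp
    have "?R (vx c {}) (vx e {i})" using up[OF cl(1) S] eq by simp
    moreover have "?R (vx e {i}) (vx e {})" by (rule down[OF cl(2) S])
    ultimately show ?case
      using step.IH converse_rtranclp_into_rtranclp[of ?R "vx c {}" "vx e {i}" "vx d {}"]
        converse_rtranclp_into_rtranclp[of ?R "vx e {i}" "vx e {}" "vx d {}"] by blast
  qed simp
  moreover have "?R v (vx c {})" "?R (vx d {}) w" using down[OF v(1,2)] up[OF w(1,2)] v(3) w(3) by simp_all
  ultimately show ?thesis
    using converse_rtranclp_into_rtranclp[of ?R v "vx c {}" w]
      rtranclp.rtrancl_into_rtrancl[of ?R "vx c {}" "vx d {}" w] by blast
qed

definition stab :: "'c davis_point \<Rightarrow> ('c davis_point \<Rightarrow> 'c davis_point) set" where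
  "stab v = {g \<in> Aut. g v = v}"

lemma stab_orbit_finite_vertex:
  assumes v0: "v0 \<in> Vt" and v: "v \<in> Vt"
  shows "finite ((\<lambda>g. g v) ` stab v0)"
  using vertices_connected[OF v0 v]
proof (induction rule: rtranclp_induct)
  case base
  have "(\<lambda>g. g v0) ` stab v0 \<subseteq> {v0}" by (auto simp: stab_def)
  then show ?case by (rule finite_subset) simp
next
  case (step y z)
  have "(\<lambda>g. g z) ` stab v0 \<subseteq> (\<Union>u\<in>(\<lambda>g. g y) ` stab v0. neighbours u)"
    using Aut_neighbours step.hyps(2) by (auto simp: stab_def)
  moreover have "finite (\<Union>u\<in>(\<lambda>g. g y) ` stab v0. neighbours u)"
    using step.IH step.hyps(2) Aut_Vt neighbours_finite by (intro finite_UN_I) (auto simp: stab_def)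
  ultimately show ?case by (rule finite_subset)
qed

lemma stab_orbit_finite:
  assumes v0: "v0 \<in> Vt" and x: "x \<in> Pt"
  shows "finite ((\<lambda>g. g x) ` stab v0)"
proof -
  obtain K where K: "K \<in> Cells" "x \<in> K" using point_in_cell[OF x] by blast
  let ?F = "K \<inter> Vt"
  let ?\<Phi> = "(\<lambda>g. restrict g ?F) ` stab v0"
  have "?\<Phi> \<subseteq> PiE ?F (\<lambda>v. (\<lambda>g. g v) ` stab v0)" by auto
  moreover have "finite (PiE ?F (\<lambda>v. (\<lambda>g. g v) ` stab v0))"
    using cell_finite_vertices[OF K(1)] stab_orbit_finite_vertex[OF v0] by (intro finite_PiE) auto
  ultimately have fin: "finite ?\<Phi>" by (rule finite_subset)
  have "(\<lambda>g. g x) ` stab v0 \<subseteq> (\<lambda>\<phi>. (SOME g. g \<in> stab v0 \<and> restrict g ?F = \<phi>) x) ` ?\<Phi>"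
  proof
    fix y assume "y \<in> (\<lambda>g. g x) ` stab v0"
    then obtain g where g: "g \<in> stab v0" "y = g x" by blast
    define h where "h = (SOME h. h \<in> stab v0 \<and> restrict h ?F = restrict g ?F)"
    have h: "h \<in> stab v0 \<and> restrict h ?F = restrict g ?F"
      unfolding h_def by (rule someI[of _ g]) (simp add: g)
    have "h v = g v" if "v \<in> ?F" for v using fun_cong[OF conjunct2[OF h], of v] that by simp
    then have "h x = g x" using agree_on_cell[OF _ _ K(1) _ K(2), of h g] g h by (simp add: stab_def)
    then show "y \<in> (\<lambda>\<phi>. (SOME g. g \<in> stab v0 \<and> restrict g ?F = \<phi>) x) ` ?\<Phi>"
      unfolding g(2) by (intro image_eqI[of _ _ "restrict g ?F"] imageI g(1)) (simp flip: h_def)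
  qed
  then show ?thesis using fin finite_surj by blast
qed

lemma stab_inverse:
  assumes g: "g \<in> stab v0" and v0: "v0 \<in> Vt"
  obtains h where "h \<in> stab v0" "\<And>x. x \<in> Pt \<Longrightarrow> h (g x) = x" "\<And>x. x \<in> Pt \<Longrightarrow> g (h x) = x"
proof -
  have gA: "g \<in> Aut" "g v0 = v0" and v0P: "v0 \<in> Pt" using g v0 Vt_sub_Pt by (auto simp: stab_def)
  have "restrict (inv_into Pt g) Pt v0 = v0" using Aut_inverse(2)[OF gA(1) v0P] gA(2) by simp
  then have "restrict (inv_into Pt g) Pt \<in> stab v0" using Aut_inverse(1)[OF gA(1)] by (simp add: stab_def)
  then show ?thesis using that Aut_inverse(2,3)[OF gA(1)] by blast
qed

text \<open>Since all orbits of the stabiliser are finite, an approximating automorphism that agrees with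
  \<open>f\<close> on a whole orbit already shows that \<open>f\<close> is onto, and likewise for cells.\<close>

lemma stab_closed_pointwise:
  assumes v0: "v0 \<in> Vt" and ext: "f \<in> extensional Pt"
    and approx: "\<And>F. finite F \<Longrightarrow> F \<subseteq> Pt \<Longrightarrow> \<exists>h\<in>stab v0. \<forall>x\<in>F. h x = f x"
  shows "f \<in> stab v0"
proof -
  have v0P: "v0 \<in> Pt" using v0 Vt_sub_Pt by blast
  have stA: "h \<in> Aut" if "h \<in> stab v0" for h using that by (simp add: stab_def)
  have fP: "f x \<in> Pt" if "x \<in> Pt" for x
    using approx[of "{x}"] that Aut_Pt stA by force
  have dist: "ddist (f x) (f y) = ddist x y" if "x \<in> Pt" "y \<in> Pt" for x y
  proof -
    obtain h where "h \<in> stab v0" "h x = f x" "h y = f y" using approx[of "{x, y}"] \<open>x \<in> Pt\<close> \<open>y \<in> Pt\<close> by auto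
    then show ?thesis using Aut_dist[OF stA that] by metis
  qed
  have inj: "inj_on f Pt"
  proof (rule inj_onI)
    fix x y assume xy: "x \<in> Pt" "y \<in> Pt" "f x = f y"
    then have "ddist x y = 0" using dist[OF xy(1,2)] fP by simp
    then show "x = y" using xy by simp
  qed
  have surj: "y \<in> f ` Pt" if y: "y \<in> Pt" for y
  proof -
    \<comment> \<open>An element that agrees with \<open>f\<close> on the finite orbit of \<open>y\<close> permutes this orbit, so \<open>y\<close> is attained there.\<close>
    let ?O = "(\<lambda>g. g y) ` stab v0"
    have "finite ?O" "?O \<subseteq> Pt" using stab_orbit_finite[OF v0 y] Aut_Pt stA y by auto
    then obtain h where h: "h \<in> stab v0" "\<forall>x\<in>?O. h x = f x" using approx by blast
    obtain g where g: "g \<in> stab v0" "\<And>x. x \<in> Pt \<Longrightarrow> h (g x) = x"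
      by (rule stab_inverse[OF h(1) v0]) blast
    have "f (g y) = y" using h(2) g(1) g(2)[OF y] by force
    then show ?thesis using Aut_Pt[OF stA[OF g(1)] y] by force
  qed
  have on_cell: "f ` K = h ` K"
    if h: "h \<in> stab v0" and K: "K \<in> Cells" and a: "\<And>v. v \<in> K \<inter> Vt \<Longrightarrow> h v = f v" for h K
  proof -
    have "f x = h x" if x: "x \<in> K" for x
    proof -
      have "finite (insert x (K \<inter> Vt))" "insert x (K \<inter> Vt) \<subseteq> Pt"
        using cell_finite_vertices[OF K] Cells_sub[OF K] x by auto
      then obtain h' where h': "h' \<in> stab v0" "\<forall>y\<in>insert x (K \<inter> Vt). h' y = f y" using approx by blast
      have "h' x = h x"
        by (rule agree_on_cell[OF stA[OF h'(1)] stA[OF h] K _ x]) (use h'(2) a in simp)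
      then show ?thesis using h'(2) by simp
    qed
    then show ?thesis by simp
  qed
  have "f \<in> Aut"
  proof (rule AutI[OF ext])
    show "bij_betw f Pt Pt" unfolding bij_betw_def using inj fP surj by blast
    show "ddist (f x) (f y) = ddist x y" if "x \<in> Pt" "y \<in> Pt" for x y using dist that .
    fix K assume K: "K \<in> Cells"
    have "finite (K \<inter> Vt)" "K \<inter> Vt \<subseteq> Pt" using cell_finite_vertices[OF K] Cells_sub[OF K] by auto
    then obtain h where h: "h \<in> stab v0" "\<forall>v\<in>K \<inter> Vt. h v = f v" using approx by blast
    have "f ` K = h ` K" by (rule on_cell[OF h(1) K]) (use h(2) in blast)
    then show "f ` K \<in> Cells" using Aut_Cells[OF stA[OF h(1)] K] by simp
    let ?F = "\<Union>v\<in>K \<inter> Vt. (\<lambda>g. g v) ` stab v0"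
    have "finite ?F" using cell_finite_vertices[OF K] stab_orbit_finite_vertex[OF v0] by auto
    moreover have "?F \<subseteq> Pt" using Aut_Pt stA Cells_sub[OF K] by blast
    ultimately obtain h where h: "h \<in> stab v0" "\<forall>v\<in>?F. h v = f v" using approx by blast
    obtain g where g: "g \<in> stab v0" "\<And>x. x \<in> Pt \<Longrightarrow> g (h x) = x" "\<And>x. x \<in> Pt \<Longrightarrow> h (g x) = x"
      by (rule stab_inverse[OF h(1) v0]) blast
    have K': "g ` K \<in> Cells" using Aut_Cells[OF stA[OF g(1)] K] .
    have "h v = f v" if v: "v \<in> g ` K \<inter> Vt" for v
    proof -
      have "v \<in> g ` (K \<inter> Vt)" using v image_cell_vertices[OF stA[OF g(1)] K] by simp
      then have "v \<in> ?F" using g(1) by blast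
      from bspec[OF h(2) this] show ?thesis .
    qed
    then have "f ` (g ` K) = h ` (g ` K)" using on_cell[OF h(1) K'] by blast
    also have "\<dots> = K"
    proof -
      have "h (g x) = x" if "x \<in> K" for x using g(3) that Cells_sub[OF K] by blast
      then show ?thesis unfolding image_image by simp
    qed
    finally show "\<exists>K'\<in>Cells. K = f ` K'" using K' by metis
  qed
  moreover have "f v0 = v0" using approx[of "{v0}"] v0P by (auto simp: stab_def)
  ultimately show ?thesis by (simp add: stab_def)
qed

text \<open>By \<open>stab_closed_pointwise\<close> the stabiliser is closed in the product of its finite orbits on
  points, which is compact by Tychonoff's theorem, and the product topology is finer than the
  compact-open one.\<close>

lemma stab_compact:
  assumes v0: "v0 \<in> Vt"
  shows "compactin AutX (stab v0)"
proof -
  define Or where "Or x = (\<lambda>g. g x) ` stab v0" for x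
  define T where "T = product_topology (\<lambda>x. discrete_topology (Or x)) Pt"
  have topT: "topspace T = PiE Pt Or" by (simp add: T_def)
  have sub: "stab v0 \<subseteq> PiE Pt Or"
  proof
    fix g assume g: "g \<in> stab v0"
    then have "g \<in> extensional Pt" by (simp add: stab_def Aut_iff Bij_def)
    then show "g \<in> PiE Pt Or" using g by (simp add: PiE_iff Or_def)
  qed
  have comp: "compact_space T"
    unfolding T_def compact_space_product_topology
    using stab_orbit_finite[OF v0] by (auto simp: compact_space_discrete_topology Or_def)
  have basic: "openin T {f' \<in> PiE Pt Or. \<forall>x\<in>F. f' x = f x}"
    if F: "finite F" "F \<subseteq> Pt" and f: "f \<in> PiE Pt Or" for F f
  proof -
    let ?X = "\<lambda>x. if x \<in> F then {f x} else Or x"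
    have "openin T (PiE Pt ?X)"
      unfolding T_def
    proof (rule product_topology_basis)
      show "openin (discrete_topology (Or x)) (?X x)" for x using F(2) f by auto
      have "{x. ?X x \<noteq> topspace (discrete_topology (Or x))} \<subseteq> F" by auto
      then show "finite {x. ?X x \<noteq> topspace (discrete_topology (Or x))}" using F(1) finite_subset by blast
    qed
    moreover have "PiE Pt ?X = {f' \<in> PiE Pt Or. \<forall>x\<in>F. f' x = f x}"
    proof (intro equalityI subsetI)
      fix f' assume f': "f' \<in> PiE Pt ?X"
      have "f' x \<in> Or x" if "x \<in> Pt" for x
        using PiE_mem[OF f' that] PiE_mem[OF f that] by (simp split: if_split_asm)
      moreover have "f' x = f x" if "x \<in> F" for x using PiE_mem[OF f', of x] that F(2) by auto
      ultimately show "f' \<in> {f' \<in> PiE Pt Or. \<forall>x\<in>F. f' x = f x}" using f' by (simp add: PiE_iff)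
    qed (auto simp: PiE_iff)
    ultimately show ?thesis by simp
  qed
  have "openin T (topspace T - stab v0)"
  proof (subst openin_subopen, intro ballI)
    fix f assume f: "f \<in> topspace T - stab v0"
    then have fP: "f \<in> PiE Pt Or" by (simp add: topT)
    have "\<exists>F. finite F \<and> F \<subseteq> Pt \<and> \<not> (\<exists>h\<in>stab v0. \<forall>x\<in>F. h x = f x)"
    proof (rule ccontr)
      assume "\<not> (\<exists>F. finite F \<and> F \<subseteq> Pt \<and> \<not> (\<exists>h\<in>stab v0. \<forall>x\<in>F. h x = f x))"
      then have "f \<in> stab v0" using fP by (intro stab_closed_pointwise[OF v0]) (auto simp: PiE_iff)
      then show False using f by blast
    qed
    then obtain F where F: "finite F" "F \<subseteq> Pt" "\<not> (\<exists>h\<in>stab v0. \<forall>x\<in>F. h x = f x)" by (elim exE conjE)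
    show "\<exists>U. openin T U \<and> f \<in> U \<and> U \<subseteq> topspace T - stab v0"
    proof (intro exI conjI)
      show "openin T {f' \<in> PiE Pt Or. \<forall>x\<in>F. f' x = f x}" by (rule basic[OF F(1,2) fP])
      show "f \<in> {f' \<in> PiE Pt Or. \<forall>x\<in>F. f' x = f x}" using fP by simp
      show "{f' \<in> PiE Pt Or. \<forall>x\<in>F. f' x = f x} \<subseteq> topspace T - stab v0"
        unfolding topT using F(3) by blast
    qed
  qed
  then have "closedin T (stab v0)" using sub by (simp add: closedin_def topT)
  then have cT: "compactin T (stab v0)" by (rule closedin_compact_space[OF comp])
  have "continuous_map (subtopology T (stab v0)) AutX (\<lambda>g. g)"
    unfolding continuous_map_def
  proof (intro conjI allI impI)
    have top: "topspace AutX = Aut"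
    proof
      show "topspace AutX \<subseteq> Aut" by (rule conjunct1[OF iffD1[OF AutX_open_iff openin_topspace]])
      show "Aut \<subseteq> topspace AutX" by (rule openin_subset[OF open_Aut])
    qed
    show "(\<lambda>g. g) \<in> topspace (subtopology T (stab v0)) \<rightarrow> topspace AutX"
      by (auto simp: top stab_def)
    fix U assume U: "openin AutX U"
    have e: "{g \<in> topspace (subtopology T (stab v0)). g \<in> U} = stab v0 \<inter> U" using sub by (auto simp: topT)
    show "openin (subtopology T (stab v0)) {g \<in> topspace (subtopology T (stab v0)). g \<in> U}"
      unfolding e
    proof (subst openin_subopen, intro ballI)
      fix f assume f: "f \<in> stab v0 \<inter> U"
      then have fP: "f \<in> PiE Pt Or" using sub by blast
      obtain F where F: "finite F" "F \<subseteq> Vt" "{h \<in> Aut. \<forall>v\<in>F. h v = f v} \<subseteq> U"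
        using bspec[OF conjunct2[OF iffD1[OF AutX_open_iff U]] IntD2[OF f]] by (elim exE conjE)
      let ?B = "{f' \<in> PiE Pt Or. \<forall>x\<in>F. f' x = f x}"
      have "openin T ?B" by (rule basic[OF F(1) _ fP]) (use F(2) Vt_sub_Pt in blast)
      then have "openin (subtopology T (stab v0)) (?B \<inter> stab v0)" by (rule openin_subtopology_Int)
      moreover have "f \<in> ?B \<inter> stab v0" using f fP by simp
      moreover have "?B \<inter> stab v0 \<subseteq> stab v0 \<inter> U"
      proof
        fix h assume h: "h \<in> ?B \<inter> stab v0"
        then have "h \<in> {h \<in> Aut. \<forall>v\<in>F. h v = f v}" by (simp add: stab_def)
        then show "h \<in> stab v0 \<inter> U" using F(3) h by blast
      qed
      ultimately show "\<exists>U'. openin (subtopology T (stab v0)) U' \<and> f \<in> U' \<and> U' \<subseteq> stab v0 \<inter> U"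
        by (intro exI conjI)
    qed
  qed
  moreover have "compactin (subtopology T (stab v0)) (stab v0)" using cT by (simp add: compactin_subtopology)
  ultimately have "compactin AutX ((\<lambda>g. g) ` stab v0)" by (rule image_compactin[rotated])
  then show ?thesis by (simp only: image_ident)
qed

lemma chambers_countable: "countable C"
proof -
  obtain c0 where c0: "c0 \<in> C" using chambers_nonempty by blast
  define S where "S k = (\<lambda>P. \<Union>c\<in>P. \<Union>i\<in>I. {d. adj i c d}) ^^ k" for k :: nat
  have fin: "finite (S k {c0}) \<and> S k {c0} \<subseteq> C" for k
  proof (induction k)
    case (Suc k)
    have "S (Suc k) {c0} = (\<Union>c\<in>S k {c0}. \<Union>i\<in>I. {d. adj i c d})" by (simp add: S_def)
    moreover have "finite (\<Union>c\<in>S k {c0}. \<Union>i\<in>I. {d. adj i c d})"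
    proof (intro finite_UN_I)
      fix c i assume "c \<in> S k {c0}" "i \<in> I"
      then show "finite {d. adj i c d}" using panel_finite Suc by blast
    qed (use Suc in simp_all)
    moreover have "(\<Union>c\<in>S k {c0}. \<Union>i\<in>I. {d. adj i c d}) \<subseteq> C" using adj_closed(2) by blast
    ultimately show ?case by simp
  qed (simp add: S_def c0)
  have "\<exists>k. d \<in> S k {c0}" if d: "d \<in> C" for d
  proof -
    have "residue I d c0" by (rule gallery_connected[OF d c0])
    then show ?thesis
    proof (induction rule: residue_induct)
      case base
      show ?case by (rule exI[of _ 0]) (simp add: S_def)
    next
      case (step d e i)
      then obtain k where "e \<in> S k {c0}" by blast
      moreover have "adj i e d" using step adj_sym by blast
      ultimately have "d \<in> (\<Union>c\<in>S k {c0}. \<Union>i\<in>I. {d. adj i c d})" using step(1) by blast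
      then have "d \<in> S (Suc k) {c0}" by (simp add: S_def)
      then show ?case by blast
    qed
  qed
  then have "C \<subseteq> (\<Union>k. S k {c0})" by blast
  moreover have "countable (\<Union>k. S k {c0})" by (rule countable_UN) (use fin countable_finite in auto)
  ultimately show ?thesis by (rule countable_subset)
qed

lemma Vt_countable: "countable Vt"
proof -
  have "Vt \<subseteq> (\<lambda>(c, T). vx c T) ` (C \<times> Sph)" unfolding Vt_iff subset_iff by auto
  moreover have "countable (C \<times> Sph)"
    by (intro countable_SIGMA chambers_countable countable_finite[OF finite_spherical_subsets])
  then have "countable ((\<lambda>(c, T). vx c T) ` (C \<times> Sph))" by (rule countable_image)
  ultimately show ?thesis by (rule countable_subset)
qed

end

section \<open>Uniform lattices in permutation groups\<close>

lemma sets_borel_of: "sets (borel_of Z) = sigma_sets (topspace Z) {U. openin Z U}"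
  and space_borel_of: "space (borel_of Z) = topspace Z"
proof -
  have "{U. openin Z U} \<subseteq> Pow (topspace Z)" using openin_subset by blast
  then show "sets (borel_of Z) = sigma_sets (topspace Z) {U. openin Z U}" "space (borel_of Z) = topspace Z"
    by (simp_all add: borel_of_def sets_measure_of space_measure_of)
qed

text \<open>The axiom \<open>open_iff\<close> describes the topology of pointwise convergence on the discrete set
  \<open>V\<close>.\<close>

locale permutation_topology = group G
  for G :: "('g, 'x) monoid_scheme" (structure) +
  fixes X :: "'g topology" and V :: "'v set" and act :: "'g \<Rightarrow> 'v \<Rightarrow> 'v"
  assumes act_closed: "g \<in> carrier G \<Longrightarrow> v \<in> V \<Longrightarrow> act g v \<in> V"
    and act_one: "v \<in> V \<Longrightarrow> act \<one> v = v"
    and act_mult: "g \<in> carrier G \<Longrightarrow> h \<in> carrier G \<Longrightarrow> v \<in> V \<Longrightarrow> act (g \<otimes> h) v = act g (act h v)"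
    and act_faithful: "g \<in> carrier G \<Longrightarrow> h \<in> carrier G \<Longrightarrow> (\<And>v. v \<in> V \<Longrightarrow> act g v = act h v) \<Longrightarrow> g = h"
    and V_countable: "countable V" and V_nonempty: "V \<noteq> {}"
    and open_iff: "openin X U \<longleftrightarrow> U \<subseteq> carrier G \<and>
      (\<forall>g\<in>U. \<exists>F. finite F \<and> F \<subseteq> V \<and> {h \<in> carrier G. \<forall>v\<in>F. act h v = act g v} \<subseteq> U)"
    and compact_stabilizer: "v \<in> V \<Longrightarrow> compactin X {g \<in> carrier G. act g v = v}"
begin

definition agree :: "'g \<Rightarrow> 'v set \<Rightarrow> 'g set" where
  "agree g F = {h \<in> carrier G. \<forall>v\<in>F. act h v = act g v}"

lemma open_agree_iff:
  "openin X U \<longleftrightarrow> U \<subseteq> carrier G \<and> (\<forall>g\<in>U. \<exists>F. finite F \<and> F \<subseteq> V \<and> agree g F \<subseteq> U)"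
  unfolding agree_def by (rule open_iff)

lemma openI:
  assumes "U \<subseteq> carrier G" "\<And>g. g \<in> U \<Longrightarrow> \<exists>F. finite F \<and> F \<subseteq> V \<and> agree g F \<subseteq> U"
  shows "openin X U"
  unfolding open_agree_iff using assms by simp

lemma openE:
  assumes "openin X U" "g \<in> U"
  obtains F where "finite F" "F \<subseteq> V" "agree g F \<subseteq> U"
  using bspec[OF conjunct2[OF iffD1[OF open_agree_iff assms(1)]] assms(2)] that by (elim exE conjE)

lemma open_sub: "openin X U \<Longrightarrow> U \<subseteq> carrier G"
  by (rule conjunct1[OF iffD1[OF open_agree_iff]])

lemma agree_self: "g \<in> carrier G \<Longrightarrow> g \<in> agree g F"
  by (simp add: agree_def)

lemma agree_eq: "h \<in> agree g F \<Longrightarrow> agree h F = agree g F"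
  by (auto simp: agree_def)

lemma agree_sub: "agree g F \<subseteq> carrier G"
  by (auto simp: agree_def)

lemma open_agree: "finite F \<Longrightarrow> F \<subseteq> V \<Longrightarrow> openin X (agree g F)"
  by (rule openI[OF agree_sub]) (metis agree_eq order_refl)

lemma topspace_X: "topspace X = carrier G"
proof
  show "topspace X \<subseteq> carrier G" by (rule open_sub[OF openin_topspace])
  have "openin X (carrier G)"
    by (rule openI) (use agree_sub in auto)
  then show "carrier G \<subseteq> topspace X" by (rule openin_subset)
qed

lemma act_inv:
  assumes "g \<in> carrier G" "v \<in> V"
  shows "act (inv g) (act g v) = v" "act g (act (inv g) v) = v"
  using act_mult[of "inv g" g v] act_mult[of g "inv g" v] assms act_one by simp_all

lemma open_left: "openin X U \<Longrightarrow> g \<in> carrier G \<Longrightarrow> openin X {x \<in> carrier G. g \<otimes> x \<in> U}"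
proof (rule openI)
  fix x assume U: "openin X U" and g: "g \<in> carrier G" and x: "x \<in> {x \<in> carrier G. g \<otimes> x \<in> U}"
  then have "g \<otimes> x \<in> U" by simp
  from openE[OF U this] obtain F where F: "finite F" "F \<subseteq> V" "agree (g \<otimes> x) F \<subseteq> U" by blast
  have "agree x F \<subseteq> {x \<in> carrier G. g \<otimes> x \<in> U}"
  proof
    fix y assume "y \<in> agree x F"
    then have "y \<in> carrier G" "g \<otimes> y \<in> agree (g \<otimes> x) F"
      using g x F(2) act_mult by (auto simp: agree_def subset_iff)
    then show "y \<in> {x \<in> carrier G. g \<otimes> x \<in> U}" using F(3) by blast
  qed
  then show "\<exists>F. finite F \<and> F \<subseteq> V \<and> agree x F \<subseteq> {x \<in> carrier G. g \<otimes> x \<in> U}" using F by blast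
qed auto

lemma open_right: "openin X U \<Longrightarrow> g \<in> carrier G \<Longrightarrow> openin X {x \<in> carrier G. x \<otimes> g \<in> U}"
proof (rule openI)
  fix x assume U: "openin X U" and g: "g \<in> carrier G" and x: "x \<in> {x \<in> carrier G. x \<otimes> g \<in> U}"
  then have "x \<otimes> g \<in> U" by simp
  from openE[OF U this] obtain F where F: "finite F" "F \<subseteq> V" "agree (x \<otimes> g) F \<subseteq> U" by blast
  have "agree x (act g ` F) \<subseteq> {x \<in> carrier G. x \<otimes> g \<in> U}"
  proof
    fix y assume "y \<in> agree x (act g ` F)"
    then have "y \<in> carrier G" "y \<otimes> g \<in> agree (x \<otimes> g) F"
      using g x F(2) act_mult by (auto simp: agree_def subset_iff)
    then show "y \<in> {x \<in> carrier G. x \<otimes> g \<in> U}" using F(3) by blast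
  qed
  moreover have "act g ` F \<subseteq> V" using act_closed[OF g] F(2) by blast
  ultimately show "\<exists>F. finite F \<and> F \<subseteq> V \<and> agree x F \<subseteq> {x \<in> carrier G. x \<otimes> g \<in> U}"
    using F(1) by blast
qed auto

lemma transporter_compact:
  assumes v: "v \<in> V"
  shows "compactin X {x \<in> carrier G. act x v = w}"
proof (cases "\<exists>g\<in>carrier G. act g v = w")
  case True
  then obtain g where g: "g \<in> carrier G" "act g v = w" by blast
  have "continuous_map X X (\<lambda>x. g \<otimes> x)"
    unfolding continuous_map_def topspace_X using open_left[OF _ g(1)] g(1) by auto
  then have "compactin X ((\<lambda>x. g \<otimes> x) ` {x \<in> carrier G. act x v = v})"
    using image_compactin compact_stabilizer[OF v] by blast
  moreover have "(\<lambda>x. g \<otimes> x) ` {x \<in> carrier G. act x v = v} = {x \<in> carrier G. act x v = w}"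
  proof (intro equalityI subsetI)
    fix y assume y: "y \<in> {x \<in> carrier G. act x v = w}"
    then have "act (inv g \<otimes> y) v = v" using g act_mult[of "inv g" y v] act_inv(1)[OF g(1) v] v by simp
    moreover have "y = g \<otimes> (inv g \<otimes> y)" using g y by (simp add: m_assoc[symmetric])
    ultimately show "y \<in> (\<lambda>x. g \<otimes> x) ` {x \<in> carrier G. act x v = v}" using g y by blast
  qed (use g v act_mult in auto)
  ultimately show ?thesis by simp
next
  case False
  then have e: "{x \<in> carrier G. act x v = w} = {}" by blast
  show ?thesis unfolding e by simp
qed

abbreviation "BX \<equiv> borel_of X"

lemma sets_BX: "sets BX = sigma_sets (carrier G) {U. openin X U}" and space_BX: "space BX = carrier G"
  by (simp_all add: sets_borel_of space_borel_of topspace_X)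

lemma open_in_BX: "openin X U \<Longrightarrow> U \<in> sets BX"
  by (auto simp: sets_BX)

text \<open>The cosets of the pointwise stabilisers of finite sets containing \<open>v\<close>. Two of them are
  disjoint or intersect in a third, and they form a countable base.\<close>

definition basic_sets :: "'v \<Rightarrow> 'g set set" where
  "basic_sets v = insert {} {agree g F | g F. g \<in> carrier G \<and> finite F \<and> F \<subseteq> V \<and> v \<in> F}"

lemma basic_sets_countable: "countable (basic_sets v)"
proof -
  have "basic_sets v \<subseteq> insert {} ((\<lambda>P. {h \<in> carrier G. \<forall>(v, w)\<in>P. act h v = w}) ` {P. finite P \<and> P \<subseteq> V \<times> V})"
  proof
    fix B assume "B \<in> basic_sets v"
    then consider "B = {}" | g F where "B = agree g F" "g \<in> carrier G" "finite F" "F \<subseteq> V"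
      unfolding basic_sets_def by blast
    then show "B \<in> insert {} ((\<lambda>P. {h \<in> carrier G. \<forall>(v, w)\<in>P. act h v = w}) ` {P. finite P \<and> P \<subseteq> V \<times> V})"
    proof cases
      case 2
      have "B = {h \<in> carrier G. \<forall>(v, w)\<in>(\<lambda>v. (v, act g v)) ` F. act h v = w}" by (simp add: 2 agree_def)
      moreover have "finite ((\<lambda>v. (v, act g v)) ` F)" "(\<lambda>v. (v, act g v)) ` F \<subseteq> V \<times> V"
        using 2 act_closed by auto
      ultimately show ?thesis by blast
    qed simp
  qed
  moreover have "countable {P. finite P \<and> P \<subseteq> V \<times> V}"
    by (intro countable_Collect_finite_subset countable_SIGMA V_countable)
  ultimately show ?thesis by (meson countable_image countable_insert countable_subset)
qed

lemma basic_sets_Int_stable: "Int_stable (basic_sets v)"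
proof (rule Int_stableI)
  fix A B assume AB: "A \<in> basic_sets v" "B \<in> basic_sets v"
  show "A \<inter> B \<in> basic_sets v"
  proof (cases "A \<inter> B = {}")
    case False
    then obtain z where z: "z \<in> A" "z \<in> B" by blast
    obtain g F where F: "A = agree g F" "finite F" "F \<subseteq> V" "v \<in> F"
      using AB(1) z unfolding basic_sets_def by blast
    obtain h F' where F': "B = agree h F'" "finite F'" "F' \<subseteq> V"
      using AB(2) z unfolding basic_sets_def by blast
    have "A = agree z F" "B = agree z F'" using agree_eq z F F' by auto
    then have "A \<inter> B = agree z (F \<union> F')" by (auto simp: agree_def)
    moreover have "z \<in> carrier G" using z F agree_sub by blast
    ultimately show ?thesis unfolding basic_sets_def using F F' by blast
  qed (simp add: basic_sets_def)
qed

lemma basic_sets_open: "B \<in> basic_sets v \<Longrightarrow> openin X B"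
  unfolding basic_sets_def using open_agree by auto

lemma basic_sets_generate:
  assumes v: "v \<in> V" shows "sets BX = sigma_sets (carrier G) (basic_sets v)"
proof -
  have sub: "basic_sets v \<subseteq> Pow (carrier G)" using basic_sets_open open_sub by blast
  have "U \<in> sigma_sets (carrier G) (basic_sets v)" if U: "openin X U" for U
  proof -
    have "U = \<Union> {B \<in> basic_sets v. B \<subseteq> U}"
    proof (intro equalityI subsetI)
      fix g assume g: "g \<in> U"
      then obtain F where F: "finite F" "F \<subseteq> V" "agree g F \<subseteq> U" using openE[OF U] by blast
      have gG: "g \<in> carrier G" using open_sub[OF U] g by blast
      have "agree g (insert v F) \<in> {B \<in> basic_sets v. B \<subseteq> U}"
      proof -
        have "agree g (insert v F) \<subseteq> U" using F(3) by (auto simp: agree_def)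
        moreover have "finite (insert v F)" "insert v F \<subseteq> V" "v \<in> insert v F" using F v by auto
        ultimately show ?thesis unfolding basic_sets_def using gG by blast
      qed
      then show "g \<in> \<Union> {B \<in> basic_sets v. B \<subseteq> U}" using agree_self[OF gG] by blast
    qed blast
    moreover have "\<Union> {B \<in> basic_sets v. B \<subseteq> U} \<in> sigma_sets (carrier G) (basic_sets v)"
      by (rule sigma_sets_UNION) (auto intro: countable_subset[OF _ basic_sets_countable[of v]])
    ultimately show ?thesis by simp
  qed
  then have "sigma_sets (carrier G) {U. openin X U} \<subseteq> sigma_sets (carrier G) (basic_sets v)"
    by (intro sigma_sets_mono) auto
  moreover have "sigma_sets (carrier G) (basic_sets v) \<subseteq> sigma_sets (carrier G) {U. openin X U}"
    using basic_sets_open by (intro sigma_sets_mono) auto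
  ultimately show ?thesis by (simp add: sets_BX)
qed

lemma continuous_measurable:
  assumes f: "f \<in> carrier G \<rightarrow> topspace Z" and pre: "\<And>U. openin Z U \<Longrightarrow> openin X {x \<in> carrier G. f x \<in> U}"
    and M: "sets M = sets BX"
  shows "f \<in> measurable M (borel_of Z)"
proof (rule measurable_sigma_sets)
  have spM: "space M = carrier G" using sets_eq_imp_space_eq[OF M] by (simp add: space_BX)
  show "sets (borel_of Z) = sigma_sets (topspace Z) {U. openin Z U}" "{U. openin Z U} \<subseteq> Pow (topspace Z)"
    using openin_subset by (auto simp: sets_borel_of)
  show "f \<in> space M \<rightarrow> topspace Z" using f spM by simp
  fix U assume "U \<in> {U. openin Z U}"
  moreover have "f -` U \<inter> space M = {x \<in> carrier G. f x \<in> U}" using spM by blast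
  ultimately show "f -` U \<inter> space M \<in> sets M" using pre open_in_BX M by simp
qed

end

locale permutation_haar = permutation_topology G X V act
  for G :: "('g, 'x) monoid_scheme" (structure) and X and V :: "'v set" and act +
  fixes \<mu> :: "'g measure"
  assumes haar: "haar_measure G X \<mu>"
begin

lemma sets_mu: "sets \<mu> = sets BX" and space_mu: "space \<mu> = carrier G"
proof -
  show s: "sets \<mu> = sets BX" using haar by (simp add: haar_measure_def)
  show "space \<mu> = carrier G" using sets_eq_imp_space_eq[OF s] by (simp add: space_BX)
qed

lemma mu_compact: "compactin X Q \<Longrightarrow> emeasure \<mu> Q < \<infinity>"
  and mu_open: "openin X U \<Longrightarrow> U \<noteq> {} \<Longrightarrow> 0 < emeasure \<mu> U"
  using haar by (auto simp: haar_measure_def)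

lemma left_measurable: "g \<in> carrier G \<Longrightarrow> (\<lambda>x. g \<otimes> x) \<in> measurable \<mu> \<mu>"
  and right_measurable: "g \<in> carrier G \<Longrightarrow> (\<lambda>x. x \<otimes> g) \<in> measurable \<mu> \<mu>"
proof -
  assume g: "g \<in> carrier G"
  have "measurable \<mu> BX = measurable \<mu> \<mu>" by (rule measurable_cong_sets) (simp_all add: sets_mu)
  moreover have "(\<lambda>x. g \<otimes> x) \<in> measurable \<mu> BX"
    by (rule continuous_measurable) (use g open_left sets_mu topspace_X in auto)
  moreover have "(\<lambda>x. x \<otimes> g) \<in> measurable \<mu> BX"
    by (rule continuous_measurable) (use g open_right sets_mu topspace_X in auto)
  ultimately show "(\<lambda>x. g \<otimes> x) \<in> measurable \<mu> \<mu>" "(\<lambda>x. x \<otimes> g) \<in> measurable \<mu> \<mu>" by auto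
qed

lemma left_invariant:
  assumes g: "g \<in> carrier G" and A: "A \<in> sets \<mu>"
  shows "emeasure \<mu> {x \<in> carrier G. g \<otimes> x \<in> A} = emeasure \<mu> A"
proof -
  have AG: "A \<subseteq> carrier G" using sets.sets_into_space[OF A] by (simp add: space_mu)
  have "{x \<in> carrier G. g \<otimes> x \<in> A} = inv g <# A"
  proof (intro equalityI subsetI)
    fix x assume "x \<in> {x \<in> carrier G. g \<otimes> x \<in> A}"
    moreover from this have "x = inv g \<otimes> (g \<otimes> x)" using g by (simp add: m_assoc[symmetric])
    ultimately show "x \<in> inv g <# A" unfolding l_coset_def by blast
  next
    fix x assume "x \<in> inv g <# A"
    then obtain a where a: "a \<in> A" "x = inv g \<otimes> a" unfolding l_coset_def by blast
    then have "a \<in> carrier G" using AG by blast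
    then show "x \<in> {x \<in> carrier G. g \<otimes> x \<in> A}" using a g by (simp add: m_assoc[symmetric])
  qed
  then show ?thesis using haar g A by (simp add: haar_measure_def)
qed

lemma left_distr: "g \<in> carrier G \<Longrightarrow> distr \<mu> \<mu> (\<lambda>x. g \<otimes> x) = \<mu>"
proof (rule measure_eqI)
  fix A assume g: "g \<in> carrier G" and "A \<in> sets (distr \<mu> \<mu> (\<lambda>x. g \<otimes> x))"
  then have A: "A \<in> sets \<mu>" by simp
  have "(\<lambda>x. g \<otimes> x) -` A \<inter> space \<mu> = {x \<in> carrier G. g \<otimes> x \<in> A}" by (auto simp: space_mu)
  then show "emeasure (distr \<mu> \<mu> (\<lambda>x. g \<otimes> x)) A = emeasure \<mu> A"
    using emeasure_distr[OF left_measurable[OF g] A] left_invariant[OF g A] by simp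
qed simp

lemma translate_agree:
  assumes "g \<in> carrier G" "F \<subseteq> V"
  shows "{x \<in> carrier G. inv g \<otimes> x \<in> agree \<one> F} = agree g F"
proof -
  have "inv g \<otimes> x \<in> agree \<one> F \<longleftrightarrow> x \<in> agree g F" if x: "x \<in> carrier G" for x
  proof -
    have "act (inv g \<otimes> x) v = act \<one> v \<longleftrightarrow> act x v = act g v" if "v \<in> F" for v
    proof -
      have v: "v \<in> V" using that assms by blast
      have "act (inv g \<otimes> x) v = act (inv g) (act x v)" using act_mult assms x v by simp
      then show ?thesis using act_inv assms(1) v act_one act_closed x by metis
    qed
    then show ?thesis using x assms(1) by (simp add: agree_def)
  qed
  then show ?thesis using agree_sub by blast
qed

text \<open>Uniqueness of Haar measure in the totally disconnected case: the compact open stabiliser of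
  \<open>v\<close> is a disjoint union of \<open>r\<close> cosets of any smaller basic subgroup, so a
  left-invariant measure is determined on the generator \<open>basic_sets v\<close> by its value on that
  stabiliser. The number \<open>r\<close> does not depend on the measure.\<close>

lemma invariant_measure_proportional:
  assumes v: "v \<in> V" and sets: "sets \<mu>' = sets BX"
    and inv: "\<And>g A. g \<in> carrier G \<Longrightarrow> A \<in> sets BX \<Longrightarrow> emeasure \<mu>' {x \<in> carrier G. g \<otimes> x \<in> A} = emeasure \<mu>' A"
    and fin: "emeasure \<mu>' (agree \<one> {v}) < \<infinity>"
  shows "\<exists>c. \<mu>' = scale_measure c \<mu>"
proof -
  let ?K = "agree \<one> {v}"
  have K: "?K = {x \<in> carrier G. act x v = v}" using act_one[OF v] by (simp add: agree_def)
  have Kc: "compactin X ?K" using compact_stabilizer[OF v] K by simp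
  have Ko: "openin X ?K" using open_agree v by simp
  have muK: "0 < emeasure \<mu> ?K" "emeasure \<mu> ?K < \<infinity>"
    using mu_open[OF Ko] mu_compact[OF Kc] agree_self[of \<one> "{v}"] by auto
  have trans: "emeasure M (agree g F) = emeasure M (agree \<one> F)"
    if "sets M = sets BX" "\<And>g A. g \<in> carrier G \<Longrightarrow> A \<in> sets BX \<Longrightarrow> emeasure M {x \<in> carrier G. g \<otimes> x \<in> A} = emeasure M A"
      "g \<in> carrier G" "finite F" "F \<subseteq> V" for M g F
    using that(2)[of "inv g" "agree \<one> F"] translate_agree[OF that(3,5)] that open_in_BX open_agree by simp
  have count: "\<exists>r::nat. 0 < r \<and> (\<forall>M. sets M = sets BX \<longrightarrow>
      (\<forall>g\<in>carrier G. \<forall>A\<in>sets BX. emeasure M {x \<in> carrier G. g \<otimes> x \<in> A} = emeasure M A) \<longrightarrow>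
      emeasure M ?K = of_nat r * emeasure M (agree \<one> F))"
    if F: "finite F" "F \<subseteq> V" "v \<in> F" for F
  proof -
    let ?P = "(\<lambda>g. agree g F) ` ?K"
    have PK: "\<Union> ?P = ?K"
    proof (intro equalityI subsetI)
      fix x assume "x \<in> \<Union> ?P"
      then obtain g where "g \<in> ?K" "x \<in> agree g F" by blast
      then show "x \<in> ?K" using F(3) by (simp add: agree_def)
    next
      fix x assume x: "x \<in> ?K"
      then have "x \<in> agree x F" using agree_self agree_sub by blast
      then show "x \<in> \<Union> ?P" using x by blast
    qed
    have disj: "disjoint ?P"
      unfolding disjoint_def using agree_eq by blast
    have "\<exists>\<F>. finite \<F> \<and> \<F> \<subseteq> ?P \<and> ?K \<subseteq> \<Union>\<F>"
    proof -
      have "\<forall>U\<in>?P. openin X U" using open_agree[OF F(1,2)] by blast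
      then show ?thesis using Kc PK unfolding compactin_def
        by (elim conjE allE[of _ ?P]) simp
    qed
    then obtain \<F> where \<F>: "finite \<F>" "\<F> \<subseteq> ?P" "?K \<subseteq> \<Union>\<F>" by blast
    have "?P \<subseteq> \<F>"
    proof
      fix B assume B: "B \<in> ?P"
      then obtain g where g: "g \<in> ?K" "B = agree g F" by blast
      then have gB: "g \<in> B" using agree_self agree_sub by blast
      obtain B' where B': "B' \<in> \<F>" "g \<in> B'" using \<F>(3) g by blast
      have "B' \<in> ?P" using B'(1) \<F>(2) by (rule subsetD[rotated])
      then obtain h where "B' = agree h F" by (elim imageE)
      then have "B = B'" using agree_eq[of g h F] B'(2) g(2) by simp
      then show "B \<in> \<F>" using B' by simp
    qed
    then have finP: "finite ?P" using \<F>(1) finite_subset by blast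
    have "\<one> \<in> ?K" using agree_self by simp
    then have "0 < card ?P" using finP card_gt_0_iff by blast
    moreover have "emeasure M ?K = of_nat (card ?P) * emeasure M (agree \<one> F)"
      if M: "sets M = sets BX"
        "\<forall>g\<in>carrier G. \<forall>A\<in>sets BX. emeasure M {x \<in> carrier G. g \<otimes> x \<in> A} = emeasure M A" for M
    proof -
      have "?P \<subseteq> sets M" using open_agree[OF F(1,2)] open_in_BX M(1) by blast
      then have "emeasure M (\<Union> ?P) = (\<Sum>B\<in>?P. emeasure M B)"
        using sum_emeasure[of "\<lambda>B. B" ?P M] disj finP
        by (simp add: disjoint_family_on_def disjoint_def image_subset_iff pairwise_def disjnt_def)
      also have "\<dots> = (\<Sum>B\<in>?P. emeasure M (agree \<one> F))"
      proof (rule sum.cong[OF HOL.refl])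
        fix B assume "B \<in> ?P"
        then obtain g where "g \<in> carrier G" "B = agree g F" using agree_sub by blast
        then show "emeasure M B = emeasure M (agree \<one> F)" using trans[OF M(1) _ _ F(1,2)] M(2) by blast
      qed
      finally show ?thesis by (simp add: PK)
    qed
    ultimately show ?thesis by blast
  qed
  \<comment> \<open>The ratio of the masses of the stabiliser, the only possible constant.\<close>
  define c where "c = emeasure \<mu>' ?K / emeasure \<mu> ?K"
  have muinv: "\<forall>g\<in>carrier G. \<forall>A\<in>sets BX. emeasure \<mu> {x \<in> carrier G. g \<otimes> x \<in> A} = emeasure \<mu> A"
    using left_invariant sets_mu by blast
  have eqK: "emeasure \<mu>' ?K = c * emeasure \<mu> ?K"
    unfolding c_def using muK by (simp add: ennreal_divide_times ennreal_times_divide ennreal_mult_divide_eq)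
  have one: "emeasure \<mu>' (agree \<one> F) = c * emeasure \<mu> (agree \<one> F)" if F: "finite F" "F \<subseteq> V" "v \<in> F" for F
  proof -
    obtain r :: nat where r: "0 < r" "\<forall>M. sets M = sets BX \<longrightarrow>
      (\<forall>g\<in>carrier G. \<forall>A\<in>sets BX. emeasure M {x \<in> carrier G. g \<otimes> x \<in> A} = emeasure M A) \<longrightarrow>
      emeasure M ?K = of_nat r * emeasure M (agree \<one> F)" using count[OF F] by blast
    have "of_nat r * emeasure \<mu>' (agree \<one> F) = emeasure \<mu>' ?K" using r(2) sets inv by simp
    also have "\<dots> = c * (of_nat r * emeasure \<mu> (agree \<one> F))" using eqK r(2) sets_mu muinv by simp
    also have "\<dots> = of_nat r * (c * emeasure \<mu> (agree \<one> F))" by (simp add: ac_simps)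
    finally show ?thesis
      using r(1) by (simp add: ennreal_mult_cancel_left)
  qed
  have "\<mu>' = scale_measure c \<mu>"
  proof (rule measure_eqI_generator_eq_countable[where E = "basic_sets v" and \<Omega> = "carrier G"
        and A = "{agree g {v} | g. g \<in> carrier G}"])
    show "Int_stable (basic_sets v)" by (rule basic_sets_Int_stable)
    show "basic_sets v \<subseteq> Pow (carrier G)" using basic_sets_open open_sub by blast
    show "sets \<mu>' = sigma_sets (carrier G) (basic_sets v)" using sets basic_sets_generate[OF v] by simp
    show "sets (scale_measure c \<mu>) = sigma_sets (carrier G) (basic_sets v)"
      using sets_mu basic_sets_generate[OF v] by simp
    show sub: "{agree g {v} | g. g \<in> carrier G} \<subseteq> basic_sets v"
      unfolding basic_sets_def using v by blast
    show "\<Union> {agree g {v} | g. g \<in> carrier G} = carrier G"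
    proof (intro equalityI subsetI)
      fix x assume "x \<in> carrier G"
      then show "x \<in> \<Union> {agree g {v} | g. g \<in> carrier G}" using agree_self[of x "{v}"] by blast
    next
      fix x assume "x \<in> \<Union> {agree g {v} | g. g \<in> carrier G}"
      then obtain g where "x \<in> agree g {v}" by blast
      then show "x \<in> carrier G" by (simp add: agree_def)
    qed
    show "countable {agree g {v} | g. g \<in> carrier G}"
      by (rule countable_subset[OF sub basic_sets_countable])
    fix a assume "a \<in> {agree g {v} | g. g \<in> carrier G}"
    then obtain g where g: "g \<in> carrier G" "a = agree g {v}" by blast
    have "emeasure \<mu>' (agree g {v}) = emeasure \<mu>' (agree \<one> {v})"
      by (rule trans[OF sets inv g(1)]) (use v in simp_all)
    then show "emeasure \<mu>' a \<noteq> \<infinity>" using fin g(2) by (simp only: less_top infinity_ennreal_def not_False_eq_True)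
  next
    fix B assume "B \<in> basic_sets v"
    then consider "B = {}" | g F where "B = agree g F" "g \<in> carrier G" "finite F" "F \<subseteq> V" "v \<in> F"
      unfolding basic_sets_def by blast
    then show "emeasure \<mu>' B = emeasure (scale_measure c \<mu>) B"
    proof cases
      case 2
      have "emeasure \<mu>' B = emeasure \<mu>' (agree \<one> F)"
        unfolding 2(1) by (rule trans[OF sets inv 2(2-4)])
      also have "\<dots> = c * emeasure \<mu> (agree \<one> F)" by (rule one[OF 2(3-5)])
      also have "emeasure \<mu> (agree \<one> F) = emeasure \<mu> B"
        unfolding 2(1) by (rule trans[OF sets_mu _ 2(2-4), symmetric]) (use muinv in blast)
      finally show ?thesis by simp
    qed simp
  qed
  then show ?thesis by blast
qed

lemma right_translate_proportional:
  assumes g: "g \<in> carrier G"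
  shows "\<exists>c. distr \<mu> \<mu> (\<lambda>x. x \<otimes> g) = scale_measure c \<mu>"
proof -
  obtain w where w: "w \<in> V" using V_nonempty by blast
  let ?M = "distr \<mu> \<mu> (\<lambda>x. x \<otimes> g)"
  have em: "emeasure ?M A = emeasure \<mu> {x \<in> carrier G. x \<otimes> g \<in> A}" if "A \<in> sets \<mu>" for A
  proof -
    have "(\<lambda>x. x \<otimes> g) -` A \<inter> space \<mu> = {x \<in> carrier G. x \<otimes> g \<in> A}" by (auto simp: space_mu)
    then show ?thesis using emeasure_distr[OF right_measurable[OF g] that] by simp
  qed
  show ?thesis
  proof (rule invariant_measure_proportional[OF w])
    show "sets ?M = sets BX" by (simp add: sets_mu)
    fix h A assume h: "h \<in> carrier G" and A: "A \<in> sets BX"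
    have sA: "{x \<in> carrier G. h \<otimes> x \<in> A} \<in> sets \<mu>"
      using measurable_sets[OF left_measurable[OF h], of A] A
      by (simp add: sets_mu space_mu vimage_def Int_def conj_commute)
    have sA': "{x \<in> carrier G. x \<otimes> g \<in> A} \<in> sets \<mu>"
      using measurable_sets[OF right_measurable[OF g], of A] A
      by (simp add: sets_mu space_mu vimage_def Int_def conj_commute)
    have "emeasure ?M {x \<in> carrier G. h \<otimes> x \<in> A}
        = emeasure \<mu> {x \<in> carrier G. x \<otimes> g \<in> {x \<in> carrier G. h \<otimes> x \<in> A}}"
      by (rule em[OF sA])
    also have "{x \<in> carrier G. x \<otimes> g \<in> {x \<in> carrier G. h \<otimes> x \<in> A}}
        = {x \<in> carrier G. h \<otimes> x \<in> {x \<in> carrier G. x \<otimes> g \<in> A}}"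
      using g h by (auto simp: m_assoc)
    also have "emeasure \<mu> \<dots> = emeasure \<mu> {x \<in> carrier G. x \<otimes> g \<in> A}" by (rule left_invariant[OF h sA'])
    also have "\<dots> = emeasure ?M A" using em A sets_mu by simp
    finally show "emeasure ?M {x \<in> carrier G. h \<otimes> x \<in> A} = emeasure ?M A" .
  next
    have o: "agree \<one> {w} \<in> sets \<mu>" using open_agree open_in_BX sets_mu w by simp
    have "{x \<in> carrier G. x \<otimes> g \<in> agree \<one> {w}} = {x \<in> carrier G. act x (act g w) = w}"
      using g w act_mult act_one by (auto simp: agree_def)
    then show "emeasure ?M (agree \<one> {w}) < \<infinity>"
      using em[OF o] mu_compact[OF transporter_compact[OF act_closed[OF g w]]] by simp
  qed
qed

end

text \<open>The finite set \<open>D\<close> meets every orbit of \<open>\<Gamma>\<close> on \<open>V\<close>, possibly more than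
  once.\<close>

locale cofinite_subgroup = permutation_haar G X V act \<mu>
  for G :: "('g, 'x) monoid_scheme" (structure) and X and V :: "'v set" and act and \<mu> +
  fixes \<Gamma> :: "'g set" and D :: "'v set"
  assumes subgroup_Gamma: "subgroup \<Gamma> G"
    and finite_stabilizers: "v \<in> V \<Longrightarrow> finite {\<gamma> \<in> \<Gamma>. act \<gamma> v = v}"
    and finite_D: "finite D" and D_sub: "D \<subseteq> V"
    and D_meets: "v \<in> V \<Longrightarrow> \<exists>\<gamma>\<in>\<Gamma>. act \<gamma> v \<in> D"
begin

lemma Gamma_closed: "\<gamma> \<in> \<Gamma> \<Longrightarrow> \<gamma> \<in> carrier G"
  using subgroup.subset[OF subgroup_Gamma] by blast

lemma Gamma_mult: "a \<in> \<Gamma> \<Longrightarrow> b \<in> \<Gamma> \<Longrightarrow> a \<otimes> b \<in> \<Gamma>"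
  and Gamma_inv: "a \<in> \<Gamma> \<Longrightarrow> inv a \<in> \<Gamma>"
  using subgroup_Gamma by (auto simp: subgroup_def)

lemma finite_transporter:
  assumes v: "v \<in> V" shows "finite {\<gamma> \<in> \<Gamma>. act \<gamma> v = w}"
proof (cases "\<exists>\<gamma>\<in>\<Gamma>. act \<gamma> v = w")
  case True
  then obtain \<beta> where b: "\<beta> \<in> \<Gamma>" "act \<beta> v = w" by blast
  have "{\<gamma> \<in> \<Gamma>. act \<gamma> v = w} \<subseteq> (\<lambda>\<gamma>. \<beta> \<otimes> \<gamma>) ` {\<gamma> \<in> \<Gamma>. act \<gamma> v = v}"
  proof
    fix \<gamma> assume g: "\<gamma> \<in> {\<gamma> \<in> \<Gamma>. act \<gamma> v = w}"
    have cl: "\<beta> \<in> carrier G" "\<gamma> \<in> carrier G" using b g Gamma_closed by auto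
    have "act (inv \<beta> \<otimes> \<gamma>) v = v" using act_mult[of "inv \<beta>" \<gamma> v] act_inv(1)[of \<beta> v] b g v cl by simp
    moreover have "inv \<beta> \<otimes> \<gamma> \<in> \<Gamma>" using Gamma_mult Gamma_inv b g by blast
    moreover have "\<gamma> = \<beta> \<otimes> (inv \<beta> \<otimes> \<gamma>)" using cl by (simp add: m_assoc[symmetric])
    ultimately show "\<gamma> \<in> (\<lambda>\<gamma>. \<beta> \<otimes> \<gamma>) ` {\<gamma> \<in> \<Gamma>. act \<gamma> v = v}" by blast
  qed
  then show ?thesis using finite_stabilizers[OF v] finite_surj by blast
next
  case False
  then have e: "{\<gamma> \<in> \<Gamma>. act \<gamma> v = w} = {}" by blast
  show ?thesis unfolding e by simp
qed

lemma discrete: "discrete_subgroup G X \<Gamma>"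
  unfolding discrete_subgroup_def
proof (intro conjI subgroup_Gamma)
  obtain v where v: "v \<in> V" using V_nonempty by blast
  have single: "openin (subtopology X \<Gamma>) {\<gamma>}" if g: "\<gamma> \<in> \<Gamma>" for \<gamma>
  proof -
    let ?S = "{\<beta> \<in> \<Gamma>. act \<beta> v = act \<gamma> v} - {\<gamma>}"
    have "\<forall>\<beta>\<in>?S. \<exists>w. w \<in> V \<and> act \<beta> w \<noteq> act \<gamma> w"
      using act_faithful[OF Gamma_closed Gamma_closed[OF g]] by blast
    then obtain f where f: "\<And>\<beta>. \<beta> \<in> ?S \<Longrightarrow> f \<beta> \<in> V \<and> act \<beta> (f \<beta>) \<noteq> act \<gamma> (f \<beta>)" by metis
    let ?F = "insert v (f ` ?S)"
    have "finite ?F" "?F \<subseteq> V" using finite_transporter[OF v] f v by auto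
    then have "openin X (agree \<gamma> ?F)" by (rule open_agree)
    moreover have "agree \<gamma> ?F \<inter> \<Gamma> = {\<gamma>}"
    proof (intro equalityI subsetI)
      fix \<beta> assume b: "\<beta> \<in> agree \<gamma> ?F \<inter> \<Gamma>"
      show "\<beta> \<in> {\<gamma>}"
      proof (rule ccontr)
        assume "\<beta> \<notin> {\<gamma>}"
        then have "\<beta> \<in> ?S" using b by (simp add: agree_def)
        then show False using f[of \<beta>] b by (simp add: agree_def)
      qed
    next
      fix \<beta> assume "\<beta> \<in> {\<gamma>}"
      then show "\<beta> \<in> agree \<gamma> ?F \<inter> \<Gamma>" using g Gamma_closed agree_self by simp
    qed
    ultimately show ?thesis by (metis openin_subtopology_Int)
  qed
  have "topspace (subtopology X \<Gamma>) = \<Gamma>" using Gamma_closed topspace_X by auto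
  then show "subtopology X \<Gamma> = discrete_topology \<Gamma>"
    using discrete_topology_unique[of \<Gamma> "subtopology X \<Gamma>"] single by metis
qed

abbreviation "XQ \<equiv> coset_topology G X \<Gamma>"
abbreviation "pr \<equiv> (\<lambda>x. \<Gamma> #> x)"

lemma pr_rcosets: "x \<in> carrier G \<Longrightarrow> pr x \<in> rcosets \<Gamma>"
  by (auto simp: RCOSETS_def)

lemma rcosets_pr: "y \<in> rcosets \<Gamma> \<Longrightarrow> \<exists>x\<in>carrier G. y = pr x"
  by (auto simp: RCOSETS_def)

lemma open_XQ: "openin XQ U \<longleftrightarrow> U \<subseteq> rcosets \<Gamma> \<and> openin X {g \<in> carrier G. pr g \<in> U}"
proof -
  have "istopology (\<lambda>U. U \<subseteq> rcosets \<Gamma> \<and> openin X {g \<in> carrier G. pr g \<in> U})"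
    unfolding istopology_def
  proof (intro conjI allI impI)
    fix S T assume S: "S \<subseteq> rcosets \<Gamma> \<and> openin X {g \<in> carrier G. pr g \<in> S}"
      and T: "T \<subseteq> rcosets \<Gamma> \<and> openin X {g \<in> carrier G. pr g \<in> T}"
    show "S \<inter> T \<subseteq> rcosets \<Gamma>" using S by blast
    have "{g \<in> carrier G. pr g \<in> S \<inter> T} = {g \<in> carrier G. pr g \<in> S} \<inter> {g \<in> carrier G. pr g \<in> T}" by blast
    moreover have "openin X ({g \<in> carrier G. pr g \<in> S} \<inter> {g \<in> carrier G. pr g \<in> T})"
      by (intro openin_Int conjunct2[OF S] conjunct2[OF T])
    ultimately show "openin X {g \<in> carrier G. pr g \<in> S \<inter> T}" by (simp only:)
  next
    fix K assume K: "\<forall>S\<in>K. S \<subseteq> rcosets \<Gamma> \<and> openin X {g \<in> carrier G. pr g \<in> S}"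
    show "\<Union> K \<subseteq> rcosets \<Gamma>" using K by blast
    have "{g \<in> carrier G. pr g \<in> \<Union> K} = \<Union> ((\<lambda>S. {g \<in> carrier G. pr g \<in> S}) ` K)" by blast
    moreover have "openin X (\<Union> ((\<lambda>S. {g \<in> carrier G. pr g \<in> S}) ` K))" using K by (intro openin_Union) blast
    ultimately show "openin X {g \<in> carrier G. pr g \<in> \<Union> K}" by simp
  qed
  then show ?thesis unfolding coset_topology_def by simp
qed

lemma topspace_XQ: "topspace XQ = rcosets \<Gamma>"
proof
  show "topspace XQ \<subseteq> rcosets \<Gamma>" using open_XQ[of "topspace XQ"] by simp
  have "{g \<in> carrier G. pr g \<in> rcosets \<Gamma>} = topspace X" using pr_rcosets topspace_X by blast
  then have "openin XQ (rcosets \<Gamma>)" unfolding open_XQ by simp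
  then show "rcosets \<Gamma> \<subseteq> topspace XQ" by (rule openin_subset)
qed

lemma compact_quotient: "compact_space XQ"
proof -
  obtain v where v: "v \<in> V" using V_nonempty by blast
  have cont: "continuous_map X XQ pr"
    unfolding continuous_map_def topspace_X topspace_XQ using pr_rcosets open_XQ by blast
  have "compactin XQ (\<Union>d\<in>D. pr ` {x \<in> carrier G. act x v = d})"
    using finite_D by (intro compactin_Union) (auto intro: image_compactin[OF transporter_compact[OF v] cont])
  moreover have "(\<Union>d\<in>D. pr ` {x \<in> carrier G. act x v = d}) = topspace XQ"
  proof (intro equalityI subsetI)
    fix y assume "y \<in> (\<Union>d\<in>D. pr ` {x \<in> carrier G. act x v = d})"
    then show "y \<in> topspace XQ" using topspace_XQ pr_rcosets by blast
  next
    fix y assume "y \<in> topspace XQ"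
    then obtain x where x: "x \<in> carrier G" "y = pr x" using topspace_XQ rcosets_pr by blast
    obtain \<gamma> where g: "\<gamma> \<in> \<Gamma>" "act \<gamma> (act x v) \<in> D" using D_meets[OF act_closed[OF x(1) v]] by blast
    have "act (\<gamma> \<otimes> x) v \<in> D" using act_mult[OF Gamma_closed[OF g(1)] x(1) v] g(2) by simp
    moreover have "pr (\<gamma> \<otimes> x) = y"
      using coset_mult_assoc[OF subgroup.subset[OF subgroup_Gamma] Gamma_closed[OF g(1)] x(1)]
        coset_join2[OF Gamma_closed[OF g(1)] subgroup_Gamma g(1)] x(2) by simp
    moreover have "\<gamma> \<otimes> x \<in> carrier G" using Gamma_closed[OF g(1)] x(1) by simp
    ultimately show "y \<in> (\<Union>d\<in>D. pr ` {x \<in> carrier G. act x v = d})" by blast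
  qed
  ultimately show ?thesis by (simp add: compact_space_def)
qed

definition hits :: "'v \<Rightarrow> 'g set" where
  "hits w = {\<gamma> \<in> \<Gamma>. act \<gamma> w \<in> D}"

lemma hits_finite: "w \<in> V \<Longrightarrow> finite (hits w)"
proof -
  assume w: "w \<in> V"
  have "hits w = (\<Union>d\<in>D. {\<gamma> \<in> \<Gamma>. act \<gamma> w = d})" by (auto simp: hits_def)
  then show ?thesis using finite_D finite_transporter[OF w] by simp
qed

lemma hits_nonempty: "w \<in> V \<Longrightarrow> hits w \<noteq> {}"
  using D_meets by (auto simp: hits_def)

lemma card_hits:
  assumes "\<gamma> \<in> \<Gamma>" "w \<in> V" shows "card (hits (act \<gamma> w)) = card (hits w)"
proof -
  have "bij_betw (\<lambda>\<beta>. \<beta> \<otimes> \<gamma>) (hits (act \<gamma> w)) (hits w)"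
  proof (rule bij_betw_byWitness[of _ "\<lambda>\<beta>. \<beta> \<otimes> inv \<gamma>"])
    note c = Gamma_closed[OF assms(1)]
    show "\<forall>\<beta>\<in>hits (act \<gamma> w). \<beta> \<otimes> \<gamma> \<otimes> inv \<gamma> = \<beta>" "\<forall>\<beta>\<in>hits w. \<beta> \<otimes> inv \<gamma> \<otimes> \<gamma> = \<beta>"
      using c Gamma_closed by (auto simp: hits_def m_assoc)
    show "(\<lambda>\<beta>. \<beta> \<otimes> \<gamma>) ` hits (act \<gamma> w) \<subseteq> hits w"
      using act_mult c Gamma_closed assms Gamma_mult by (auto simp: hits_def)
    show "(\<lambda>\<beta>. \<beta> \<otimes> inv \<gamma>) ` hits w \<subseteq> hits (act \<gamma> w)"
      using act_mult c Gamma_closed assms Gamma_mult Gamma_inv act_inv act_closed by (auto simp: hits_def)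
  qed
  then show ?thesis by (rule bij_betw_same_card)
qed

text \<open>As a function of \<open>x\<close>, the density at \<open>act x v\<close> has sum \<open>1\<close> over each
  coset of \<open>\<Gamma>\<close>. It plays the role of the indicator function of a fundamental domain, so
  that no measurable set of representatives has to be chosen.\<close>

definition density_at :: "'v \<Rightarrow> ennreal" where
  "density_at w = (if w \<in> D then 1 / of_nat (card (hits w)) else 0)"

lemma density_sum:
  assumes w: "w \<in> V"
  shows "(\<integral>\<^sup>+\<gamma>. density_at (act \<gamma> w) \<partial>count_space \<Gamma>) = 1"
proof -
  have "(\<integral>\<^sup>+\<gamma>. density_at (act \<gamma> w) \<partial>count_space \<Gamma>)
      = (\<integral>\<^sup>+\<gamma>. (1 / of_nat (card (hits w))) * indicator (hits w) \<gamma> \<partial>count_space \<Gamma>)"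
    by (rule nn_integral_cong) (auto simp: density_at_def hits_def card_hits[OF _ w, unfolded hits_def] indicator_def)
  also have "\<dots> = (1 / of_nat (card (hits w))) * emeasure (count_space \<Gamma>) (hits w)"
    by (rule nn_integral_cmult_indicator) (auto simp: hits_def)
  also have "emeasure (count_space \<Gamma>) (hits w) = of_nat (card (hits w))"
    using hits_finite[OF w] by (intro emeasure_count_space_finite) (auto simp: hits_def)
  also have "(1 / of_nat (card (hits w))) * of_nat (card (hits w)) = (1 :: ennreal)"
    using hits_finite[OF w] hits_nonempty[OF w]
    by (simp add: ennreal_divide_times card_gt_0_iff ennreal_of_nat_eq_real_of_nat)
  finally show ?thesis .
qed

lemma Gamma_countable: "countable \<Gamma>"
proof -
  obtain v where v: "v \<in> V" using V_nonempty by blast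
  have "\<Gamma> = (\<Union>w\<in>V. {\<gamma> \<in> \<Gamma>. act \<gamma> v = w})" using act_closed[OF Gamma_closed v] by blast
  moreover have "countable (\<Union>w\<in>V. {\<gamma> \<in> \<Gamma>. act \<gamma> v = w})"
    using V_countable finite_transporter[OF v] countable_finite by (intro countable_UN) auto
  ultimately show ?thesis by simp
qed

lemma orbit_function_measurable:
  fixes f :: "'v \<Rightarrow> ennreal"
  assumes v: "v \<in> V" shows "(\<lambda>x. f (act x v)) \<in> borel_measurable \<mu>"
proof -
  have "(\<lambda>x. act x v) \<in> measurable \<mu> (count_space V)"
  proof (subst measurable_count_space_eq_countable[OF V_countable], intro conjI ballI)
    show "(\<lambda>x. act x v) \<in> space \<mu> \<rightarrow> V" using act_closed v space_mu by auto
    fix w assume "w \<in> V"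
    have "openin X {x \<in> carrier G. act x v = w}"
    proof (rule openI)
      fix g assume "g \<in> {x \<in> carrier G. act x v = w}"
      then show "\<exists>F. finite F \<and> F \<subseteq> V \<and> agree g F \<subseteq> {x \<in> carrier G. act x v = w}"
        using v by (intro exI[of _ "{v}"]) (auto simp: agree_def)
    qed auto
    then have "{x \<in> carrier G. act x v = w} \<in> sets \<mu>" using open_in_BX sets_mu by simp
    moreover have "(\<lambda>x. act x v) -` {w} \<inter> space \<mu> = {x \<in> carrier G. act x v = w}" using space_mu by auto
    ultimately show "(\<lambda>x. act x v) -` {w} \<inter> space \<mu> \<in> sets \<mu>" by simp
  qed
  then show ?thesis by (rule measurable_compose) simp
qed

text \<open>Both sides equal the integral of \<open>h\<close> over the quotient; the proof inserts the other
  partition of unity and translates each summand by \<open>\<gamma>\<close>.\<close>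

lemma unfold_integral:
  fixes h :: "'g \<Rightarrow> ennreal"
  assumes v: "v \<in> V" and w: "w \<in> V"
    and h: "h \<in> borel_measurable \<mu>" "\<And>\<gamma> x. \<gamma> \<in> \<Gamma> \<Longrightarrow> x \<in> carrier G \<Longrightarrow> h (\<gamma> \<otimes> x) = h x"
  shows "(\<integral>\<^sup>+x. density_at (act x v) * h x \<partial>\<mu>) = (\<integral>\<^sup>+x. density_at (act x w) * h x \<partial>\<mu>)"
proof -
  let ?\<phi> = "\<lambda>v x. density_at (act x v)"
  have meas[measurable]: "?\<phi> v \<in> borel_measurable \<mu>" "?\<phi> w \<in> borel_measurable \<mu>"
    using orbit_function_measurable v w by auto
  note h(1)[measurable]
  have meas_tr: "(\<lambda>x. ?\<phi> u (\<gamma> \<otimes> x)) \<in> borel_measurable \<mu>" if "\<gamma> \<in> \<Gamma>" "u \<in> V" for \<gamma> u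
    by (rule measurable_compose[OF left_measurable[OF Gamma_closed[OF that(1)]]
        orbit_function_measurable[OF that(2)]])
  have sum1: "(\<integral>\<^sup>+\<gamma>. ?\<phi> u (\<gamma> \<otimes> x) \<partial>count_space \<Gamma>) = 1" if "x \<in> carrier G" "u \<in> V" for x u
  proof -
    have "(\<integral>\<^sup>+\<gamma>. ?\<phi> u (\<gamma> \<otimes> x) \<partial>count_space \<Gamma>) = (\<integral>\<^sup>+\<gamma>. density_at (act \<gamma> (act x u)) \<partial>count_space \<Gamma>)"
      by (rule nn_integral_cong) (use act_mult Gamma_closed that in simp)
    then show ?thesis using density_sum act_closed that by simp
  qed
  have "(\<integral>\<^sup>+x. ?\<phi> v x * h x \<partial>\<mu>) = (\<integral>\<^sup>+x. (\<integral>\<^sup>+\<gamma>. ?\<phi> v x * h x * ?\<phi> w (\<gamma> \<otimes> x) \<partial>count_space \<Gamma>) \<partial>\<mu>)"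
    by (rule nn_integral_cong) (simp add: nn_integral_cmult sum1 w space_mu)
  also have "\<dots> = (\<integral>\<^sup>+\<gamma>. (\<integral>\<^sup>+x. ?\<phi> v x * h x * ?\<phi> w (\<gamma> \<otimes> x) \<partial>\<mu>) \<partial>count_space \<Gamma>)"
    by (rule nn_integral_count_space_nn_integral[OF Gamma_countable])
      (intro borel_measurable_times_ennreal meas h(1) meas_tr w)
  also have "\<dots> = (\<integral>\<^sup>+\<gamma>. (\<integral>\<^sup>+x. ?\<phi> v (inv \<gamma> \<otimes> x) * h x * ?\<phi> w x \<partial>\<mu>) \<partial>count_space \<Gamma>)"
  proof (rule nn_integral_cong)
    fix \<gamma> assume "\<gamma> \<in> space (count_space \<Gamma>)"
    then have g: "\<gamma> \<in> \<Gamma>" by simp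
    note c = Gamma_closed[OF g]
    have m: "(\<lambda>x. ?\<phi> v (inv \<gamma> \<otimes> x) * h x * ?\<phi> w x) \<in> borel_measurable \<mu>"
      by (intro borel_measurable_times_ennreal meas h(1) meas_tr Gamma_inv g v)
    have "(\<integral>\<^sup>+x. ?\<phi> v (inv \<gamma> \<otimes> x) * h x * ?\<phi> w x \<partial>\<mu>)
        = (\<integral>\<^sup>+x. ?\<phi> v (inv \<gamma> \<otimes> x) * h x * ?\<phi> w x \<partial>distr \<mu> \<mu> (\<lambda>x. \<gamma> \<otimes> x))"
      using left_distr[OF c] by simp
    also have "\<dots> = (\<integral>\<^sup>+x. ?\<phi> v (inv \<gamma> \<otimes> (\<gamma> \<otimes> x)) * h (\<gamma> \<otimes> x) * ?\<phi> w (\<gamma> \<otimes> x) \<partial>\<mu>)"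
      by (rule nn_integral_distr[OF left_measurable[OF c]]) (use m in simp)
    also have "\<dots> = (\<integral>\<^sup>+x. ?\<phi> v x * h x * ?\<phi> w (\<gamma> \<otimes> x) \<partial>\<mu>)"
      by (rule nn_integral_cong) (use c g h(2) in \<open>simp add: space_mu m_assoc[symmetric]\<close>)
    finally show "(\<integral>\<^sup>+x. ?\<phi> v x * h x * ?\<phi> w (\<gamma> \<otimes> x) \<partial>\<mu>)
        = (\<integral>\<^sup>+x. ?\<phi> v (inv \<gamma> \<otimes> x) * h x * ?\<phi> w x \<partial>\<mu>)" by simp
  qed
  also have "\<dots> = (\<integral>\<^sup>+x. (\<integral>\<^sup>+\<gamma>. ?\<phi> v (inv \<gamma> \<otimes> x) * h x * ?\<phi> w x \<partial>count_space \<Gamma>) \<partial>\<mu>)"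
    by (rule nn_integral_count_space_nn_integral[OF Gamma_countable, symmetric])
      (intro borel_measurable_times_ennreal meas h(1) meas_tr Gamma_inv v)
  also have "\<dots> = (\<integral>\<^sup>+x. ?\<phi> w x * h x \<partial>\<mu>)"
  proof (rule nn_integral_cong)
    fix x assume "x \<in> space \<mu>"
    then have x: "x \<in> carrier G" by (simp add: space_mu)
    have "bij_betw (m_inv G) \<Gamma> \<Gamma>"
      by (rule bij_betw_byWitness[of _ "m_inv G"]) (use Gamma_inv Gamma_closed in auto)
    then have "(\<integral>\<^sup>+\<gamma>. ?\<phi> v (inv \<gamma> \<otimes> x) \<partial>count_space \<Gamma>) = (\<integral>\<^sup>+\<gamma>. ?\<phi> v (\<gamma> \<otimes> x) \<partial>count_space \<Gamma>)"
      by (rule nn_integral_bij_count_space)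
    then have "(\<integral>\<^sup>+\<gamma>. ?\<phi> v (inv \<gamma> \<otimes> x) \<partial>count_space \<Gamma>) = 1" using sum1[OF x v] by simp
    moreover have "(\<integral>\<^sup>+\<gamma>. ?\<phi> v (inv \<gamma> \<otimes> x) * h x * ?\<phi> w x \<partial>count_space \<Gamma>)
        = (\<integral>\<^sup>+\<gamma>. (?\<phi> w x * h x) * ?\<phi> v (inv \<gamma> \<otimes> x) \<partial>count_space \<Gamma>)"
      by (rule nn_integral_cong) (simp add: ac_simps)
    moreover have "\<dots> = (?\<phi> w x * h x) * (\<integral>\<^sup>+\<gamma>. ?\<phi> v (inv \<gamma> \<otimes> x) \<partial>count_space \<Gamma>)"
      by (rule nn_integral_cmult) simp
    ultimately show "(\<integral>\<^sup>+\<gamma>. ?\<phi> v (inv \<gamma> \<otimes> x) * h x * ?\<phi> w x \<partial>count_space \<Gamma>) = ?\<phi> w x * h x"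
      by simp
  qed
  finally show ?thesis .
qed

lemma pr_measurable: "pr \<in> measurable \<mu> (borel_of XQ)"
  by (rule continuous_measurable) (use pr_rcosets topspace_XQ open_XQ sets_mu in auto)

lemma coset_translate:
  assumes "x \<in> carrier G" "g \<in> carrier G" shows "pr x #> g = pr (x \<otimes> g)"
  using coset_mult_assoc[OF subgroup.subset[OF subgroup_Gamma] assms] .

lemma pr_Gamma: "\<gamma> \<in> \<Gamma> \<Longrightarrow> x \<in> carrier G \<Longrightarrow> pr (\<gamma> \<otimes> x) = pr x"
  using coset_translate[of \<gamma> x] coset_join2[OF Gamma_closed subgroup_Gamma] Gamma_closed by simp

lemma translate_image:
  assumes A: "A \<subseteq> rcosets \<Gamma>" and g: "g \<in> carrier G" and x: "x \<in> carrier G"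
  shows "pr x \<in> (\<lambda>y. y #> g) ` A \<longleftrightarrow> pr (x \<otimes> inv g) \<in> A"
proof
  assume "pr x \<in> (\<lambda>y. y #> g) ` A"
  then obtain y where y: "y \<in> A" "pr x = y #> g" by blast
  then obtain z where z: "z \<in> carrier G" "y = pr z" using A rcosets_pr by blast
  have "pr (x \<otimes> inv g) = pr x #> inv g" using coset_translate x g by simp
  also have "\<dots> = pr (z \<otimes> g) #> inv g" using y z coset_translate g by simp
  also have "\<dots> = pr z" using coset_translate[of "z \<otimes> g" "inv g"] z g by (simp add: m_assoc)
  finally show "pr (x \<otimes> inv g) \<in> A" using y z by simp
next
  assume a: "pr (x \<otimes> inv g) \<in> A"
  have "pr x = pr (x \<otimes> inv g) #> g" using coset_translate[of "x \<otimes> inv g" g] x g by (simp add: m_assoc)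
  then show "pr x \<in> (\<lambda>y. y #> g) ` A" using a by blast
qed

lemma translate_measurable:
  assumes A: "A \<in> sets (borel_of XQ)" and g: "g \<in> carrier G"
  shows "(\<lambda>y. y #> g) ` A \<in> sets (borel_of XQ)"
proof -
  have sp: "space (borel_of XQ) = rcosets \<Gamma>" by (simp add: space_borel_of topspace_XQ)
  have AR: "A \<subseteq> rcosets \<Gamma>" using sets.sets_into_space[OF A] sp by simp
  have tr: "y #> g \<in> rcosets \<Gamma>" if "y \<in> rcosets \<Gamma>" "g \<in> carrier G" for y g
    using rcosets_pr[OF that(1)] that(2) coset_translate pr_rcosets by auto
  have m: "(\<lambda>y. y #> inv g) \<in> measurable (borel_of XQ) (borel_of XQ)"
  proof (rule measurable_sigma_sets[OF sets_borel_of])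
    show "{U. openin XQ U} \<subseteq> Pow (topspace XQ)" using openin_subset by blast
    show "(\<lambda>y. y #> inv g) \<in> space (borel_of XQ) \<rightarrow> topspace XQ" using tr g sp topspace_XQ by auto
    fix U assume "U \<in> {U. openin XQ U}"
    then have U: "openin X {x \<in> carrier G. pr x \<in> U}" using open_XQ by simp
    have "{x \<in> carrier G. pr x \<in> (\<lambda>y. y #> inv g) -` U \<inter> rcosets \<Gamma>}
        = {x \<in> carrier G. x \<otimes> inv g \<in> {x \<in> carrier G. pr x \<in> U}}"
      using g coset_translate pr_rcosets by auto
    then have "openin XQ ((\<lambda>y. y #> inv g) -` U \<inter> rcosets \<Gamma>)"
      unfolding open_XQ using open_right[OF U, of "inv g"] g by simp
    then show "(\<lambda>y. y #> inv g) -` U \<inter> space (borel_of XQ) \<in> sets (borel_of XQ)"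
      by (auto simp: sets_borel_of sp)
  qed
  have "(\<lambda>y. y #> g) ` A = (\<lambda>y. y #> inv g) -` A \<inter> space (borel_of XQ)"
  proof (intro Set.set_eqI iffI)
    fix y assume y: "y \<in> (\<lambda>y. y #> g) ` A"
    then have "y \<in> rcosets \<Gamma>" using tr AR g by blast
    moreover from this obtain x where x: "x \<in> carrier G" "y = pr x" using rcosets_pr by blast
    moreover have "pr (x \<otimes> inv g) \<in> A" using translate_image[OF AR g x(1)] y x(2) by simp
    ultimately show "y \<in> (\<lambda>y. y #> inv g) -` A \<inter> space (borel_of XQ)"
      using coset_translate[OF x(1), of "inv g"] g sp by simp
  next
    fix y assume y: "y \<in> (\<lambda>y. y #> inv g) -` A \<inter> space (borel_of XQ)"
    then obtain x where x: "x \<in> carrier G" "y = pr x" using rcosets_pr sp by auto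
    then have "pr (x \<otimes> inv g) \<in> A" using y coset_translate[OF x(1), of "inv g"] g by simp
    then show "y \<in> (\<lambda>y. y #> g) ` A" using translate_image[OF AR g x(1)] x(2) by simp
  qed
  then show ?thesis using measurable_sets[OF m A] by simp
qed

text \<open>The measure on the quotient is the image of \<open>\<mu>\<close> with density \<open>density_at (act x v)\<close>.
  Right translation by \<open>g\<close> multiplies \<open>\<mu>\<close> by a constant, hence also this measure;
  the constant is \<open>1\<close> since the total mass is positive and finite and translation permutes the
  cosets.\<close>

theorem uniform: "uniform_lattice G X \<Gamma>"
  unfolding uniform_lattice_def lattice_in_def
proof (intro conjI discrete compact_quotient)
  obtain v where v: "v \<in> V" using V_nonempty by blast
  let ?\<phi> = "\<lambda>x. density_at (act x v)"
  define \<nu> where "\<nu> = distr (density \<mu> ?\<phi>) (borel_of XQ) pr"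
  have phi: "?\<phi> \<in> borel_measurable \<mu>" by (rule orbit_function_measurable[OF v])
  have sn: "sets \<nu> = sets (borel_of XQ)" by (simp add: \<nu>_def)
  have spn: "space \<nu> = rcosets \<Gamma>" by (simp add: \<nu>_def space_borel_of topspace_XQ)
  have pr': "pr \<in> measurable (density \<mu> ?\<phi>) (borel_of XQ)" using pr_measurable by simp
  have ind: "(\<lambda>x. indicator A (pr x) :: ennreal) \<in> borel_measurable \<mu>" if "A \<in> sets (borel_of XQ)" for A
    by (rule measurable_compose[OF pr_measurable borel_measurable_indicator[OF that]])
  have em: "emeasure \<nu> A = (\<integral>\<^sup>+x. ?\<phi> x * indicator A (pr x) \<partial>\<mu>)" if A: "A \<in> sets (borel_of XQ)" for A
  proof -
    have "emeasure \<nu> A = emeasure (density \<mu> ?\<phi>) (pr -` A \<inter> space \<mu>)"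
      unfolding \<nu>_def using emeasure_distr[OF pr' A] by simp
    also have "\<dots> = (\<integral>\<^sup>+x. ?\<phi> x * indicator (pr -` A \<inter> space \<mu>) x \<partial>\<mu>)"
      using phi measurable_sets[OF pr_measurable A] by (rule emeasure_density)
    also have "\<dots> = (\<integral>\<^sup>+x. ?\<phi> x * indicator A (pr x) \<partial>\<mu>)"
      by (rule nn_integral_cong) (simp add: indicator_def)
    finally show ?thesis .
  qed
  have whole: "rcosets \<Gamma> \<in> sets (borel_of XQ)"
    using sets.top[of "borel_of XQ"] by (simp add: space_borel_of topspace_XQ)
  have total: "emeasure \<nu> (space \<nu>) = (\<integral>\<^sup>+x. ?\<phi> x \<partial>\<mu>)"
    unfolding spn em[OF whole]
    by (rule nn_integral_cong) (simp add: space_mu pr_rcosets)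
  have open_tr: "openin X {x \<in> carrier G. act x v = w}" for w
  proof (rule openI)
    fix g assume "g \<in> {x \<in> carrier G. act x v = w}"
    then show "\<exists>F. finite F \<and> F \<subseteq> V \<and> agree g F \<subseteq> {x \<in> carrier G. act x v = w}"
      using v by (intro exI[of _ "{v}"]) (auto simp: agree_def)
  qed auto
  have tr_sets: "{x \<in> carrier G. act x v = w} \<in> sets \<mu>" for w using open_tr open_in_BX sets_mu by simp
  have pos: "0 < emeasure \<nu> (space \<nu>)"
  proof -
    obtain \<gamma> where g: "\<gamma> \<in> \<Gamma>" "act \<gamma> v \<in> D" using D_meets[OF v] by blast
    let ?w = "act \<gamma> v" and ?A = "{x \<in> carrier G. act x v = act \<gamma> v}"
    have w: "?w \<in> V" using g D_sub by blast
    have "\<gamma> \<in> ?A" using g Gamma_closed by simp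
    then have A: "0 < emeasure \<mu> ?A" using mu_open[OF open_tr] by blast
    have d: "0 < density_at ?w"
      using g(2) by (simp add: density_at_def ennreal_zero_less_divide of_nat_less_top)
    have "0 < density_at ?w * emeasure \<mu> ?A" using A d by (simp add: ennreal_zero_less_mult_iff)
    also have "\<dots> = (\<integral>\<^sup>+x. density_at ?w * indicator ?A x \<partial>\<mu>)"
      using nn_integral_cmult_indicator[OF tr_sets] by simp
    also have "\<dots> \<le> (\<integral>\<^sup>+x. ?\<phi> x \<partial>\<mu>)" by (rule nn_integral_mono) (simp add: indicator_def)
    finally show ?thesis using total by simp
  qed
  have fin: "emeasure \<nu> (space \<nu>) < \<infinity>"
  proof -
    have le1: "density_at w \<le> 1" for w
    proof (cases "w \<in> D")
      case True
      then have w: "w \<in> V" using D_sub by blast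
      have c: "0 < card (hits w)" using hits_finite[OF w] hits_nonempty[OF w] by (simp add: card_gt_0_iff)
      have "(1::ennreal) / of_nat (card (hits w)) \<le> 1"
      proof (rule divide_le_posI_ennreal)
        show "(0::ennreal) < of_nat (card (hits w))" using c by simp
        have "of_nat 1 \<le> (of_nat (card (hits w)) :: ennreal)" using c by (intro of_nat_mono) linarith
        then show "(1::ennreal) \<le> of_nat (card (hits w)) * 1" by simp
      qed
      then show ?thesis by (simp add: density_at_def)
    qed (simp add: density_at_def)
    have "(\<integral>\<^sup>+x. ?\<phi> x \<partial>\<mu>) \<le> (\<integral>\<^sup>+x. (\<Sum>d\<in>D. indicator {x \<in> carrier G. act x v = d} x) \<partial>\<mu>)"
    proof (rule nn_integral_mono)
      fix x assume "x \<in> space \<mu>"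
      then have x: "x \<in> carrier G" by (simp add: space_mu)
      show "?\<phi> x \<le> (\<Sum>d\<in>D. indicator {x \<in> carrier G. act x v = d} x)"
      proof (cases "act x v \<in> D")
        case True
        have "(\<Sum>d\<in>D. indicator {x \<in> carrier G. act x v = d} x) = (\<Sum>d\<in>D. if d = act x v then (1::ennreal) else 0)"
          by (rule sum.cong) (use x in \<open>auto simp: indicator_def\<close>)
        also have "\<dots> = 1" using True finite_D by simp
        finally show ?thesis using le1 by simp
      qed (simp add: density_at_def)
    qed
    also have "\<dots> = (\<Sum>d\<in>D. emeasure \<mu> {x \<in> carrier G. act x v = d})"
      using tr_sets by (subst nn_integral_sum) auto
    also have "\<dots> < \<infinity>"
      using mu_compact[OF transporter_compact[OF v]] finite_D by (simp add: less_top ennreal_sum_less_top)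
    finally show ?thesis using total by simp
  qed
  have scaled: "\<exists>c. \<forall>A\<in>sets \<nu>. emeasure \<nu> ((\<lambda>x. x #> g) ` A) = c * emeasure \<nu> A" if g: "g \<in> carrier G" for g
  proof -
    obtain c where c: "distr \<mu> \<mu> (\<lambda>x. x \<otimes> inv g) = scale_measure c \<mu>"
      using right_translate_proportional g by blast
    have "emeasure \<nu> ((\<lambda>x. x #> g) ` A) = c * emeasure \<nu> A" if "A \<in> sets \<nu>" for A
    proof -
      have A: "A \<in> sets (borel_of XQ)" using that sn by simp
      have AR: "A \<subseteq> rcosets \<Gamma>" using sets.sets_into_space[OF that] spn by simp
      let ?f = "\<lambda>y. density_at (act y (act g v)) * indicator A (pr y)"
      have f: "?f \<in> borel_measurable \<mu>"
        by (intro borel_measurable_times_ennreal orbit_function_measurable ind A act_closed g v)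
      have "emeasure \<nu> ((\<lambda>x. x #> g) ` A) = (\<integral>\<^sup>+x. ?\<phi> x * indicator ((\<lambda>x. x #> g) ` A) (pr x) \<partial>\<mu>)"
        by (rule em[OF translate_measurable[OF A g]])
      also have "\<dots> = (\<integral>\<^sup>+x. ?f (x \<otimes> inv g) \<partial>\<mu>)"
      proof (rule nn_integral_cong)
        fix x assume "x \<in> space \<mu>"
        then have x: "x \<in> carrier G" by (simp add: space_mu)
        have "act (x \<otimes> inv g) (act g v) = act x v"
          using act_mult[of "x \<otimes> inv g" g v] x g v by (simp add: m_assoc)
        then show "?\<phi> x * indicator ((\<lambda>x. x #> g) ` A) (pr x) = ?f (x \<otimes> inv g)"
          using translate_image[OF AR g x] by (simp add: indicator_def)
      qed
      also have "\<dots> = (\<integral>\<^sup>+y. ?f y \<partial>distr \<mu> \<mu> (\<lambda>x. x \<otimes> inv g))"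
        by (rule nn_integral_distr[OF right_measurable, symmetric]) (use f g in simp_all)
      also have "\<dots> = c * (\<integral>\<^sup>+y. ?f y \<partial>\<mu>)" unfolding c by (rule nn_integral_scale_measure[OF f])
      also have "(\<integral>\<^sup>+y. ?f y \<partial>\<mu>) = (\<integral>\<^sup>+x. ?\<phi> x * indicator A (pr x) \<partial>\<mu>)"
        by (rule unfold_integral[OF act_closed[OF g v] v ind[OF A]]) (simp add: pr_Gamma)
      also have "\<dots> = emeasure \<nu> A" using em[OF A] by simp
      finally show ?thesis .
    qed
    then show ?thesis by blast
  qed
  have inv: "\<forall>g\<in>carrier G. \<forall>A\<in>sets \<nu>. emeasure \<nu> ((\<lambda>x. x #> g) ` A) = emeasure \<nu> A"
  proof (intro ballI)
    fix g A assume g: "g \<in> carrier G" and A: "A \<in> sets \<nu>"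
    obtain c where c: "\<forall>A\<in>sets \<nu>. emeasure \<nu> ((\<lambda>x. x #> g) ` A) = c * emeasure \<nu> A" using scaled[OF g] by blast
    have "(\<lambda>y. y #> g) ` (rcosets \<Gamma>) = rcosets \<Gamma>"
    proof (intro Set.set_eqI iffI)
      fix y assume "y \<in> (\<lambda>y. y #> g) ` (rcosets \<Gamma>)"
      then show "y \<in> rcosets \<Gamma>" using rcosets_pr g coset_translate pr_rcosets by fastforce
    next
      fix y assume "y \<in> rcosets \<Gamma>"
      then obtain x where x: "x \<in> carrier G" "y = pr x" using rcosets_pr by blast
      then show "y \<in> (\<lambda>y. y #> g) ` (rcosets \<Gamma>)"
        using translate_image[OF order_refl g x(1)] pr_rcosets g by simp
    qed
    moreover have "rcosets \<Gamma> \<in> sets \<nu>" using whole sn by simp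
    ultimately have "emeasure \<nu> (rcosets \<Gamma>) = c * emeasure \<nu> (rcosets \<Gamma>)" using c by metis
    then have "c = 1"
      using pos fin unfolding spn
      by (metis ennreal_mult_cancel_left mult.commute mult.right_neutral less_irrefl infinity_ennreal_def)
    then show "emeasure \<nu> ((\<lambda>x. x #> g) ` A) = emeasure \<nu> A" using c A by simp
  qed
  show "\<exists>\<nu> :: 'g set measure. sets \<nu> = sets (borel_of XQ) \<and> 0 < emeasure \<nu> (space \<nu>) \<and>
      emeasure \<nu> (space \<nu>) < \<infinity> \<and>
      (\<forall>g\<in>carrier G. \<forall>A\<in>sets \<nu>. emeasure \<nu> ((\<lambda>x. x #> g) ` A) = emeasure \<nu> A)"
    using sn pos fin inv by (intro exI[of _ \<nu>] conjI)
qed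

end

section \<open>Automorphisms induced by symmetries of the chamber set\<close>

context davis
begin

definition symmetric :: "('c \<Rightarrow> 'c) \<Rightarrow> bool" where
  "symmetric g \<longleftrightarrow> bij_betw g C C \<and> (\<forall>c\<in>C. \<forall>d\<in>C. \<delta> (g c) (g d) = \<delta> c d)"

definition induced :: "('c \<Rightarrow> 'c) \<Rightarrow> 'c davis_point \<Rightarrow> 'c davis_point" where
  "induced g = (\<lambda>x\<in>Pt. (\<lambda>(c, k). (g c, k)) ` x)"

lemma symmetric_closed: "symmetric g \<Longrightarrow> c \<in> C \<Longrightarrow> g c \<in> C"
  unfolding symmetric_def using bij_betwE by blast

lemma symmetric_residue:
  assumes "symmetric g" "T \<subseteq> I" "c \<in> C" "d \<in> C"
  shows "residue T (g c) (g d) \<longleftrightarrow> residue T c d"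
  using residue_iff_delta[OF assms(2-4)]
    residue_iff_delta[OF assms(2) symmetric_closed[OF assms(1,3)] symmetric_closed[OF assms(1,4)]] assms
  by (simp add: symmetric_def)

lemma induced_cls:
  assumes g: "symmetric g" and c: "c \<in> C" and k: "k \<in> chamb"
  shows "induced g (cls c k) = cls (g c) k"
proof -
  have "(\<lambda>(c, k). (g c, k)) ` ({c'. residue (low k) c c'} \<times> {k}) = {c'. residue (low k) (g c) c'} \<times> {k}"
  proof (intro equalityI subsetI)
    fix e assume "e \<in> (\<lambda>(c, k). (g c, k)) ` ({c'. residue (low k) c c'} \<times> {k})"
    then obtain c' where c': "residue (low k) c c'" "e = (g c', k)" by auto
    then show "e \<in> {c'. residue (low k) (g c) c'} \<times> {k}"
      using symmetric_residue[OF g low_sub_I[OF k] c residue_closed(2)[OF c'(1)]] by simp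
  next
    fix e assume "e \<in> {c'. residue (low k) (g c) c'} \<times> {k}"
    then obtain d where d: "residue (low k) (g c) d" "e = (d, k)" by auto
    then have "d \<in> g ` C" using residue_closed(2)[OF d(1)] g by (simp add: symmetric_def bij_betw_def)
    then obtain c' where c': "c' \<in> C" "d = g c'" by blast
    then have "residue (low k) c c'" using symmetric_residue[OF g low_sub_I[OF k] c c'(1)] d by simp
    then show "e \<in> (\<lambda>(c, k). (g c, k)) ` ({c'. residue (low k) c c'} \<times> {k})"
      using d c' by (intro image_eqI[of _ _ "(c', k)"]) auto
  qed
  then show ?thesis
    using cls_in[OF c k] by (simp add: induced_def cls_eq_set k)
qed

lemma induced_vx: "symmetric g \<Longrightarrow> c \<in> C \<Longrightarrow> T \<in> Sph \<Longrightarrow> induced g (vx c T) = vx (g c) T"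
  unfolding vx_def by (rule induced_cls[OF _ _ vertex_in_chamber])

lemma induced_cell:
  assumes "symmetric g" "c \<in> C" "\<sigma> \<in> simplices"
  shows "induced g ` cell c \<sigma> = cell (g c) \<sigma>"
  unfolding cell_def image_image
  by (rule image_cong[OF HOL.refl]) (rule induced_cls[OF assms(1,2) simplex_in_chamber[OF assms(3)]])

lemma induced_closed: "symmetric g \<Longrightarrow> x \<in> Pt \<Longrightarrow> induced g x \<in> Pt"
proof -
  assume g: "symmetric g" and "x \<in> Pt"
  then obtain c k where x: "c \<in> C" "k \<in> chamb" "x = cls c k" unfolding Pt_iff by blast
  show ?thesis unfolding x(3) induced_cls[OF g x(1,2)] by (rule cls_in[OF symmetric_closed[OF g x(1)] x(2)])
qed

lemma induced_str: "str x y r \<Longrightarrow> symmetric g \<Longrightarrow> str (induced g x) (induced g y) r"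
proof (induction rule: davis_string.induct)
  case (Nil x)
  then show ?case using davis_string.Nil[OF induced_closed] by blast
next
  case (Cons c \<sigma> k k' z r)
  have kc: "k \<in> chamb" "k' \<in> chamb"
    using simplex_in_chamber[OF Cons.hyps(2)] Cons.hyps(3,4) by simp_all
  have "str (cls (g c) k') (induced g z) r"
    using Cons.IH[OF Cons.prems] unfolding induced_cls[OF Cons.prems Cons.hyps(1) kc(2)] .
  from davis_string.Cons[OF symmetric_closed[OF Cons.prems Cons.hyps(1)] Cons.hyps(2-4) this]
  show ?case unfolding induced_cls[OF Cons.prems Cons.hyps(1) kc(1)] .
qed

lemma induced_dist_le:
  assumes "symmetric g" "x \<in> Pt" "y \<in> Pt"
  shows "ddist (induced g x) (induced g y) \<le> ddist x y"
  by (rule ddist_ge[OF assms(2,3)])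
    (rule ddist_le[OF induced_closed[OF assms(1,2)] induced_closed[OF assms(1,3)] induced_str[OF _ assms(1)]])

lemma induced_inverse:
  assumes g: "symmetric g" and h: "symmetric h" and hg: "\<And>c. c \<in> C \<Longrightarrow> h (g c) = c" and x: "x \<in> Pt"
  shows "induced h (induced g x) = x"
proof -
  obtain c k where c: "c \<in> C" "k \<in> chamb" "x = cls c k" using x unfolding Pt_iff by blast
  show ?thesis
    unfolding c(3) induced_cls[OF g c(1,2)] induced_cls[OF h symmetric_closed[OF g c(1)] c(2)] hg[OF c(1)] ..
qed

text \<open>Strings are mapped to strings of the same length, so the induced map and the map induced by the
  inverse are both distance-nonincreasing.\<close>

lemma induced_Aut:
  assumes g: "symmetric g" and h: "symmetric h"
    and hg: "\<And>c. c \<in> C \<Longrightarrow> h (g c) = c" and gh: "\<And>c. c \<in> C \<Longrightarrow> g (h c) = c"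
  shows "induced g \<in> Aut"
proof (rule AutI)
  show "induced g \<in> extensional Pt" by (simp add: induced_def)
  show "bij_betw (induced g) Pt Pt"
    by (rule bij_betw_byWitness[of _ "induced h"])
      (use induced_inverse[OF g h hg] induced_inverse[OF h g gh] induced_closed g h in auto)
  fix x y assume P: "x \<in> Pt" "y \<in> Pt"
  have "ddist x y = ddist (induced h (induced g x)) (induced h (induced g y))"
    using induced_inverse[OF g h hg] P by simp
  also have "\<dots> \<le> ddist (induced g x) (induced g y)"
    by (rule induced_dist_le[OF h]) (use induced_closed[OF g] P in auto)
  finally show "ddist (induced g x) (induced g y) = ddist x y" using induced_dist_le[OF g P] by simp
next
  fix K assume "K \<in> Cells"
  then obtain c \<sigma> where c: "c \<in> C" "\<sigma> \<in> simplices" "K = cell c \<sigma>" unfolding Cells_iff by blast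
  show "induced g ` K \<in> Cells"
    unfolding c(3) induced_cell[OF g c(1,2)] Cells_iff using symmetric_closed[OF g c(1)] c(2) by blast
  have "K = induced g ` cell (h c) \<sigma>"
    unfolding c(3) induced_cell[OF g symmetric_closed[OF h c(1)] c(2)] gh[OF c(1)] ..
  moreover have "cell (h c) \<sigma> \<in> Cells" unfolding Cells_iff using symmetric_closed[OF h c(1)] c(2) by blast
  ultimately show "\<exists>K'\<in>Cells. K = induced g ` K'" by blast
qed

lemma induced_compose:
  assumes g: "symmetric g" and h: "symmetric h"
  shows "compose Pt (induced g) (induced h) = induced (compose C g h)"
proof (rule extensionalityI[of _ Pt])
  fix x assume "x \<in> Pt"
  then obtain c k where c: "c \<in> C" "k \<in> chamb" "x = cls c k" unfolding Pt_iff by blast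
  have "symmetric (compose C g h)"
    using g h symmetric_closed[OF h] bij_betw_compose[of h C C g C]
    by (simp add: symmetric_def compose_def)
  then show "compose Pt (induced g) (induced h) x = induced (compose C g h) x"
    using c cls_in induced_cls[OF h c(1,2)] induced_cls[OF g symmetric_closed[OF h c(1)] c(2)]
      induced_cls[of "compose C g h" c k] by (simp add: compose_def)
qed (simp_all add: induced_def)

lemma aut_permutation_topology: "permutation_topology AutG AutX Vt (\<lambda>g. g)"
proof -
  interpret G: group AutG by (rule Aut_group)
  show ?thesis
  proof
    fix g v assume "g \<in> Aut" "v \<in> Vt" then show "g v \<in> Vt" by (rule Aut_Vt)
  next
    fix v assume "v \<in> Vt" then show "\<one>\<^bsub>AutG\<^esub> v = v" using Vt_sub_Pt by (auto simp: Aut_one)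
  next
    fix g h v assume "g \<in> Aut" "h \<in> Aut" "v \<in> Vt"
    then show "(g \<otimes>\<^bsub>AutG\<^esub> h) v = g (h v)" using Vt_sub_Pt by (auto simp: Aut_mult compose_def)
  next
    fix g h assume "g \<in> Aut" "h \<in> Aut" "\<And>v. v \<in> Vt \<Longrightarrow> g v = h v"
    then show "g = h" by (rule Aut_faithful)
  next
    show "countable Vt" by (rule Vt_countable)
    show "Vt \<noteq> {}" using chambers_nonempty empty_spherical Vt_iff by blast
    show "openin AutX U \<longleftrightarrow> U \<subseteq> Aut \<and>
      (\<forall>g\<in>U. \<exists>F. finite F \<and> F \<subseteq> Vt \<and> {h \<in> Aut. \<forall>v\<in>F. h v = g v} \<subseteq> U)" for U by (rule AutX_open_iff)
    fix v assume "v \<in> Vt" then show "compactin AutX {g \<in> Aut. g v = v}"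
      using stab_compact by (simp add: stab_def)
  qed
qed

end

section \<open>The covolume of a group of lifts\<close>

text \<open>The colours \<open>bc\<close> are invariant under \<open>A\<close> and are used to select a chamber in each
  spherical residue.\<close>

locale davis_lifts =
  lifted_symmetries W s n m q C \<delta> Y E colY A col \<kappa> + davis W s n m q C \<delta> l
  for W :: "('w, 'x) monoid_scheme" (structure) and s n m q and C :: "'c set" and \<delta>
    and Y :: "'y set" and E colY A col \<kappa> and l :: real +
  fixes bc :: "nat \<Rightarrow> nat"
  assumes finite_Y: "finite Y" and finite_A: "finite A"
    and bc_less: "i \<in> I \<Longrightarrow> bc i < q i"
    and bc_fixed: "a \<in> A \<Longrightarrow> y \<in> Y \<Longrightarrow> i \<in> I \<Longrightarrow> colY (a y) i = bc i \<longleftrightarrow> colY y i = bc i"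
begin

definition Lat :: "('c davis_point \<Rightarrow> 'c davis_point) set" where
  "Lat = induced ` lifts"

lemma lifts_symmetric: "g \<in> lifts \<Longrightarrow> symmetric g"
  using liftsD(1) lifts_delta by (simp add: symmetric_def)

lemma induced_lift_Aut: "g \<in> lifts \<Longrightarrow> induced g \<in> Aut"
  using lifts_inv induced_Aut lifts_symmetric by metis

lemma Lat_subgroup: "subgroup Lat AutG"
proof (rule group.subgroupI[OF Aut_group])
  show "Lat \<subseteq> Aut" using induced_lift_Aut by (auto simp: Lat_def)
  show "Lat \<noteq> {}" using lifts_one by (auto simp: Lat_def)
  fix a assume a: "a \<in> Lat"
  then obtain g where g: "g \<in> lifts" "a = induced g" by (auto simp: Lat_def)
  obtain h where h: "h \<in> lifts" "\<And>c. c \<in> C \<Longrightarrow> g (h c) = c" "\<And>c. c \<in> C \<Longrightarrow> h (g c) = c"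
    using lifts_inv[OF g(1)] by blast
  note sg = lifts_symmetric[OF g(1)] and sh = lifts_symmetric[OF h(1)]
  have "induced h \<otimes>\<^bsub>AutG\<^esub> a = compose Pt (induced h) (induced g)"
    using Aut_mult induced_lift_Aut g h by simp
  also have "\<dots> = (\<lambda>x\<in>Pt. x)"
    using induced_inverse[OF sg sh h(3)] by (auto simp: compose_def restrict_def fun_eq_iff)
  finally have "induced h \<otimes>\<^bsub>AutG\<^esub> a = \<one>\<^bsub>AutG\<^esub>" by (simp add: Aut_one)
  then have "inv\<^bsub>AutG\<^esub> a = induced h"
    using group.inv_equality[OF Aut_group] induced_lift_Aut g h by blast
  then show "inv\<^bsub>AutG\<^esub> a \<in> Lat" using h by (simp add: Lat_def)
  fix b assume "b \<in> Lat"
  then obtain g' where g': "g' \<in> lifts" "b = induced g'" by (auto simp: Lat_def)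
  have "a \<otimes>\<^bsub>AutG\<^esub> b = induced (compose C g g')"
    using Aut_mult[of a b] induced_lift_Aut g g' induced_compose[OF sg lifts_symmetric[OF g'(1)]] by simp
  then show "a \<otimes>\<^bsub>AutG\<^esub> b \<in> Lat" using lifts_mult[OF g(1) g'(1)] by (simp add: Lat_def)
qed

lemma induced_inj: "g \<in> lifts \<Longrightarrow> h \<in> lifts \<Longrightarrow> induced g = induced h \<Longrightarrow> g = h"
proof -
  assume g: "g \<in> lifts" and h: "h \<in> lifts" and eq: "induced g = induced h"
  show "g = h"
  proof (rule extensionalityI[OF liftsD(5)[OF g] liftsD(5)[OF h]])
    fix c assume c: "c \<in> C"
    have "vx (g c) {} = vx (h c) {}"
      using induced_vx[OF lifts_symmetric[OF g] c empty_spherical]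
        induced_vx[OF lifts_symmetric[OF h] c empty_spherical] eq by simp
    then show "g c = h c"
      using vx_eq_iff[OF liftsD(2)[OF g c] liftsD(2)[OF h c] empty_spherical empty_spherical]
      by (simp add: residue_empty)
  qed
qed

text \<open>Vertices of type \<open>T\<close> correspond to residues of type \<open>T\<close>. Replacing each residue by
  its chamber with the invariant colours identifies the vertices equivariantly with pairs of a type
  and a chamber; this reduces stabilisers of vertices to stabilisers of chambers.\<close>

definition normal_chamber :: "'c \<Rightarrow> nat set \<Rightarrow> bool" where
  "normal_chamber c T \<longleftrightarrow> c \<in> C \<and> T \<in> Sph \<and> (\<forall>i\<in>T. col c i = bc i)"

lemma normal_exists: "v \<in> Vt \<Longrightarrow> \<exists>c T. normal_chamber c T \<and> v = vx c T"
proof -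
  assume "v \<in> Vt"
  then obtain c T where v: "c \<in> C" "T \<in> Sph" "v = vx c T" unfolding Vt_iff by blast
  have "bc i < q i" if "i \<in> T" for i using bc_less that Sph_sub_I[OF v(2)] by blast
  then obtain d where d: "residue T c d" "\<forall>i\<in>T. col d i = bc i"
    using residue_with_colours[OF C_colouring Sph_sub_I[OF v(2)] v(1)] by blast
  have dC: "d \<in> C" using residue_closed(2)[OF d(1)] .
  have "vx c T = vx d T" using vx_eq_iff[OF v(1) dC v(2,2)] d(1) by simp
  then show ?thesis using d(2) dC v(2,3) unfolding normal_chamber_def by blast
qed

lemma normal_unique:
  assumes "normal_chamber c T" "normal_chamber d U" "vx c T = vx d U" shows "c = d \<and> T = U"
proof -
  have cd: "c \<in> C" "d \<in> C" "T \<in> Sph" "U \<in> Sph" using assms by (auto simp: normal_chamber_def)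
  have r: "T = U" "residue T c d" using vx_eq_iff[OF cd] assms(3) by auto
  have "c = d"
    by (rule residue_colour_inj[OF C_colouring Sph_sub_I[OF cd(3)] spherical_imp_indep[OF cd(3)] r(2)])
      (use assms r(1) in \<open>auto simp: normal_chamber_def\<close>)
  then show ?thesis using r(1) by blast
qed

lemma normal_lift:
  assumes g: "g \<in> lifts" and c: "normal_chamber c T" shows "normal_chamber (g c) T"
proof -
  obtain a where a: "a \<in> A" "\<forall>c\<in>C. \<kappa> (g c) = a (\<kappa> c)" using liftsD(4)[OF g] by blast
  have cC: "c \<in> C" "T \<in> Sph" "\<And>i. i \<in> T \<Longrightarrow> col c i = bc i" using c by (auto simp: normal_chamber_def)
  have "col (g c) i = bc i" if i: "i \<in> T" for i
  proof -
    have iI: "i \<in> I" using i Sph_sub_I[OF cC(2)] by blast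
    have "colY (\<kappa> c) i = bc i" using cover_colour[OF cC(1) iI] cC(3)[OF i] by simp
    then have "colY (\<kappa> (g c)) i = bc i" using bc_fixed[OF a(1) cover_closed[OF cC(1)] iI] a(2) cC(1) by simp
    then show ?thesis using cover_colour[OF liftsD(2)[OF g cC(1)] iI] by simp
  qed
  then show ?thesis using cC liftsD(2)[OF g] by (simp add: normal_chamber_def)
qed

text \<open>The image of a vertex in the quotient of the set of vertices by the deck transformations.\<close>

definition shadow :: "'c davis_point \<Rightarrow> nat set \<times> 'y" where
  "shadow v = (THE z. \<exists>c T. normal_chamber c T \<and> v = vx c T \<and> z = (T, \<kappa> c))"

lemma shadow_vx: "normal_chamber c T \<Longrightarrow> shadow (vx c T) = (T, \<kappa> c)"
  unfolding shadow_def by (rule the_equality) (use normal_unique in blast)+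

definition shadows :: "(nat set \<times> 'y) set" where
  "shadows = (SIGMA T:Sph. {y \<in> Y. \<forall>i\<in>T. colY y i = bc i})"

lemma shadows_finite: "finite shadows"
  unfolding shadows_def using finite_spherical_subsets finite_Y by (intro finite_SigmaI) auto

lemma shadow_in: "v \<in> Vt \<Longrightarrow> shadow v \<in> shadows"
proof -
  assume "v \<in> Vt"
  then obtain c T where v: "normal_chamber c T" "v = vx c T" using normal_exists by blast
  then have c: "c \<in> C" "T \<in> Sph" "\<And>i. i \<in> T \<Longrightarrow> col c i = bc i" by (auto simp: normal_chamber_def)
  have "colY (\<kappa> c) i = bc i" if "i \<in> T" for i
    using cover_colour[OF c(1), of i] c(3)[OF that] Sph_sub_I[OF c(2)] that by auto
  then show ?thesis using v shadow_vx cover_closed[OF c(1)] c(2) by (simp add: shadows_def)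
qed

lemma shadow_onto: "z \<in> shadows \<Longrightarrow> \<exists>v\<in>Vt. shadow v = z"
proof -
  assume "z \<in> shadows"
  then obtain T y where z: "z = (T, y)" "T \<in> Sph" "y \<in> Y" "\<forall>i\<in>T. colY y i = bc i" by (auto simp: shadows_def)
  obtain c where c: "c \<in> C" "y = \<kappa> c" using z(3) cover_onto by blast
  have "col c i = bc i" if "i \<in> T" for i
    using cover_colour[OF c(1), of i] z(4) c(2) Sph_sub_I[OF z(2)] that by auto
  then have "normal_chamber c T" using c(1) z(2) by (simp add: normal_chamber_def)
  moreover have "vx c T \<in> Vt" unfolding Vt_iff using c z by blast
  ultimately show ?thesis using shadow_vx z(1) c(2) by blast
qed

lemma shadow_same_orbit:
  assumes "v \<in> Vt" "w \<in> Vt" "shadow v = shadow w" shows "\<exists>\<gamma>\<in>Lat. \<gamma> v = w"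
proof -
  obtain c T where v: "normal_chamber c T" "v = vx c T" using normal_exists assms by blast
  obtain d U where w: "normal_chamber d U" "w = vx d U" using normal_exists assms by blast
  have eq: "T = U" "\<kappa> c = \<kappa> d" using assms(3) shadow_vx v w by auto
  have cd: "c \<in> C" "d \<in> C" "T \<in> Sph" using v w by (auto simp: normal_chamber_def)
  obtain g where "g \<in> lifts" "g c = d" using same_orbit[OF cd(1,2) eq(2)] by blast
  then show ?thesis
    using induced_vx[OF lifts_symmetric cd(1,3)] v w eq by (auto simp: Lat_def)
qed

text \<open>A lift with a prescribed value at one chamber is determined by the symmetry that it covers.\<close>

lemma card_lifts_between:
  assumes c: "c \<in> C" "c' \<in> C"
  shows "card {g \<in> lifts. g c = c'} = card {a \<in> A. a (\<kappa> c) = \<kappa> c'}"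
proof -
  define \<alpha> where "\<alpha> g = (SOME a. a \<in> A \<and> (\<forall>d\<in>C. \<kappa> (g d) = a (\<kappa> d)))" for g
  have \<alpha>: "\<alpha> g \<in> A \<and> (\<forall>d\<in>C. \<kappa> (g d) = \<alpha> g (\<kappa> d))" if "g \<in> lifts" for g
  proof -
    have "\<exists>a. a \<in> A \<and> (\<forall>d\<in>C. \<kappa> (g d) = a (\<kappa> d))" using liftsD(4)[OF that] by blast
    then show ?thesis unfolding \<alpha>_def by (rule someI_ex)
  qed
  have "bij_betw \<alpha> {g \<in> lifts. g c = c'} {a \<in> A. a (\<kappa> c) = \<kappa> c'}"
    unfolding bij_betw_def
  proof (intro conjI inj_onI equalityI subsetI)
    fix g h assume gh: "g \<in> {g \<in> lifts. g c = c'}" "h \<in> {g \<in> lifts. g c = c'}" "\<alpha> g = \<alpha> h"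
    then have "\<kappa> (g d) = \<kappa> (h d)" if "d \<in> C" for d using \<alpha>[of g] \<alpha>[of h] that by simp
    then show "g = h" using lifts_eqI[of g h c] gh c by simp
  next
    fix a assume "a \<in> \<alpha> ` {g \<in> lifts. g c = c'}"
    then obtain g where g: "g \<in> lifts" "g c = c'" "a = \<alpha> g" by blast
    show "a \<in> {a \<in> A. a (\<kappa> c) = \<kappa> c'}" using \<alpha>[OF g(1)] g(2,3) c(1) by (metis (mono_tags) mem_Collect_eq)
  next
    fix a assume a: "a \<in> {a \<in> A. a (\<kappa> c) = \<kappa> c'}"
    then obtain g where g: "g \<in> lifts" "g c = c'" "\<forall>d\<in>C. \<kappa> (g d) = a (\<kappa> d)"
      using lift_exists[of a c c'] c by auto
    have "\<alpha> g = a"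
    proof (rule A_faithful)
      show "\<alpha> g \<in> A" "a \<in> A" using \<alpha>[OF g(1)] a by auto
      fix y assume "y \<in> Y"
      then obtain d where d: "d \<in> C" "y = \<kappa> d" using cover_onto by blast
      have "\<kappa> (g d) = \<alpha> g (\<kappa> d)" using \<alpha>[OF g(1)] d(1) by blast
      moreover have "\<kappa> (g d) = a (\<kappa> d)" using g(3) d(1) by blast
      ultimately show "\<alpha> g y = a y" using d(2) by simp
    qed
    then show "a \<in> \<alpha> ` {g \<in> lifts. g c = c'}" using g by blast
  qed
  then show ?thesis by (rule bij_betw_same_card)
qed

lemma card_lifts_translate:
  assumes c: "c \<in> C" and h: "h \<in> lifts"
  shows "card {g \<in> lifts. g c = h c} = card {g \<in> lifts. g c = c}"
proof -
  obtain k where k: "k \<in> lifts" "\<And>d. d \<in> C \<Longrightarrow> h (k d) = d" "\<And>d. d \<in> C \<Longrightarrow> k (h d) = d"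
    using lifts_inv[OF h] by blast
  have cancel: "compose C h (compose C k g) = g" "compose C k (compose C h g) = g" if "g \<in> lifts" for g
    using liftsD(2,5)[OF that] k(2,3) by (auto simp: compose_def fun_eq_iff extensional_def)
  have "bij_betw (\<lambda>g. compose C k g) {g \<in> lifts. g c = h c} {g \<in> lifts. g c = c}"
    by (rule bij_betw_byWitness[of _ "\<lambda>g. compose C h g"])
      (use cancel lifts_mult h k c in \<open>auto simp: compose_eq\<close>)
  then show ?thesis by (rule bij_betw_same_card)
qed

text \<open>The orbit-stabiliser formula for \<open>A\<close> acting on the image of \<open>v\<close>.\<close>

lemma stabilizer_card:
  assumes v: "v \<in> Vt"
  shows "finite {\<gamma> \<in> Lat. \<gamma> v = v}"
    and "card {\<gamma> \<in> Lat. \<gamma> v = v} * card (shadow ` ((\<lambda>\<gamma>. \<gamma> v) ` Lat)) = card A"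
proof -
  obtain c T where cT: "normal_chamber c T" "v = vx c T" using normal_exists[OF v] by blast
  have c: "c \<in> C" "T \<in> Sph" using cT(1) by (auto simp: normal_chamber_def)
  have vg: "induced g v = vx (g c) T" if "g \<in> lifts" for g
    using induced_vx[OF lifts_symmetric[OF that] c] cT(2) by simp
  have st: "{\<gamma> \<in> Lat. \<gamma> v = v} = induced ` {g \<in> lifts. g c = c}"
  proof (intro equalityI subsetI)
    fix \<gamma> assume "\<gamma> \<in> {\<gamma> \<in> Lat. \<gamma> v = v}"
    then obtain g where g: "g \<in> lifts" "\<gamma> = induced g" "induced g v = v" by (auto simp: Lat_def)
    then have "vx (g c) T = vx c T" using vg cT(2) by simp
    then have "g c = c" using normal_unique normal_lift[OF g(1) cT(1)] cT(1) by blast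
    then show "\<gamma> \<in> induced ` {g \<in> lifts. g c = c}" using g by blast
  next
    fix \<gamma> assume "\<gamma> \<in> induced ` {g \<in> lifts. g c = c}"
    then show "\<gamma> \<in> {\<gamma> \<in> Lat. \<gamma> v = v}" using vg cT(2) by (auto simp: Lat_def)
  qed
  have inj: "inj_on induced {g \<in> lifts. g c = c}" by (rule inj_onI) (use induced_inj in blast)
  let ?k = "card {g \<in> lifts. g c = c}"
  have k: "?k = card {a \<in> A. a (\<kappa> c) = \<kappa> c}" by (rule card_lifts_between[OF c(1) c(1)])
  have "{a \<in> A. a (\<kappa> c) = \<kappa> c} \<noteq> {}" using A_one cover_closed[OF c(1)] by blast
  then have "0 < ?k" unfolding k using finite_A by (simp add: card_gt_0_iff)
  then have "finite {g \<in> lifts. g c = c}" using card_ge_0_finite by blast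
  then show "finite {\<gamma> \<in> Lat. \<gamma> v = v}" unfolding st by (rule finite_imageI)
  have ck: "card {\<gamma> \<in> Lat. \<gamma> v = v} = ?k" unfolding st by (rule card_image[OF inj])
  let ?O = "(\<lambda>a. a (\<kappa> c)) ` A"
  have "shadow ` ((\<lambda>\<gamma>. \<gamma> v) ` Lat) = (\<lambda>g. (T, \<kappa> (g c))) ` lifts"
  proof -
    have "shadow (induced g v) = (T, \<kappa> (g c))" if "g \<in> lifts" for g
      using vg[OF that] shadow_vx[OF normal_lift[OF that cT(1)]] by simp
    then show ?thesis unfolding Lat_def image_image by (rule image_cong[OF HOL.refl])
  qed
  also have "\<dots> = {T} \<times> ?O"
  proof (intro equalityI subsetI)
    fix z assume "z \<in> (\<lambda>g. (T, \<kappa> (g c))) ` lifts"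
    then obtain g where g: "g \<in> lifts" "z = (T, \<kappa> (g c))" by blast
    obtain a where "a \<in> A" "\<forall>c\<in>C. \<kappa> (g c) = a (\<kappa> c)" using liftsD(4)[OF g(1)] by blast
    then show "z \<in> {T} \<times> ?O" using g c by auto
  next
    fix z assume "z \<in> {T} \<times> ?O"
    then obtain a where a: "a \<in> A" "z = (T, a (\<kappa> c))" by auto
    obtain c' where c': "c' \<in> C" "\<kappa> c' = a (\<kappa> c)"
      using A_closed[OF a(1) cover_closed[OF c(1)]] cover_onto by (metis imageE)
    then obtain g where g: "g \<in> lifts" "g c = c'" using lift_exists[OF a(1) c(1) c'] by blast
    show "z \<in> (\<lambda>g. (T, \<kappa> (g c))) ` lifts"
      by (rule image_eqI[OF _ g(1)]) (simp add: a g c')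
  qed
  finally have cs: "card (shadow ` ((\<lambda>\<gamma>. \<gamma> v) ` Lat)) = card ?O" by (simp add: card_cartesian_product)
  have fibre: "card {a \<in> A. a (\<kappa> c) = y} = ?k" if y: "y \<in> ?O" for y
  proof -
    obtain a where a: "a \<in> A" "y = a (\<kappa> c)" using y by blast
    obtain c' where c': "c' \<in> C" "\<kappa> c' = a (\<kappa> c)"
      using A_closed[OF a(1) cover_closed[OF c(1)]] cover_onto by (metis imageE)
    obtain g where g: "g \<in> lifts" "g c = c'" using lift_exists[OF a(1) c(1) c'] by blast
    show ?thesis
      using card_lifts_between[OF c(1) c'(1)] card_lifts_translate[OF c(1) g(1)] g(2) a c' by simp
  qed
  have "card A = card (\<Union>y\<in>?O. {a \<in> A. a (\<kappa> c) = y})" by (rule arg_cong[of _ _ card]) auto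
  also have "\<dots> = (\<Sum>y\<in>?O. card {a \<in> A. a (\<kappa> c) = y})"
    by (rule card_UN_disjoint) (use finite_A in auto)
  also have "\<dots> = card ?O * ?k" using fibre by simp
  finally show "card {\<gamma> \<in> Lat. \<gamma> v = v} * card (shadow ` ((\<lambda>\<gamma>. \<gamma> v) ` Lat)) = card A"
    unfolding ck cs by simp
qed

lemma A_card_pos: "0 < card A"
  using A_one finite_A card_gt_0_iff by blast

text \<open>By \<open>stabilizer_card\<close> the orbit of \<open>v\<close> contributes the size of its image divided by
  \<open>\<bar>A\<bar>\<close>, and the images of distinct orbits partition \<open>shadows\<close>.\<close>

lemma stabilizer_sum_Lat:
  "stabilizer_sum AutG Vt Lat = ennreal (real (card shadows) / real (card A))"
proof -
  let ?orb = "\<lambda>v. (\<lambda>\<gamma>. \<gamma> v) ` Lat"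
  let ?Os = "?orb ` Vt"
  have orbits: "orbits (AutG\<lparr>carrier := Lat\<rparr>) Vt (\<lambda>g. g) = ?Os"
    by (auto simp: orbits_def orbit_def image_def)
  have LatA: "\<gamma> \<in> Aut" if "\<gamma> \<in> Lat" for \<gamma> using Lat_subgroup that subgroup.subset by blast
  have one: "(\<lambda>x\<in>Pt. x) \<in> Lat" using subgroup.one_closed[OF Lat_subgroup] by (simp add: Aut_one)
  have mem: "v \<in> ?orb v" if "v \<in> Vt" for v using one that Vt_sub_Pt by (force intro!: image_eqI[of _ _ "\<lambda>x\<in>Pt. x"])
  have orb_sub: "?orb v \<subseteq> Vt" if "v \<in> Vt" for v using Aut_Vt[OF LatA] that by blast
  have orb_le: "?orb w \<subseteq> ?orb v" if v: "v \<in> Vt" and w: "w \<in> ?orb v" for v w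
  proof
    fix x assume "x \<in> ?orb w"
    then obtain b where b: "b \<in> Lat" "x = b w" by blast
    obtain a where a: "a \<in> Lat" "w = a v" using w by blast
    have "b \<otimes>\<^bsub>AutG\<^esub> a \<in> Lat" using subgroup.m_closed[OF Lat_subgroup b(1) a(1)] .
    moreover have "(b \<otimes>\<^bsub>AutG\<^esub> a) v = x"
      using Aut_mult[OF LatA[OF b(1)] LatA[OF a(1)]] a b v Vt_sub_Pt by (auto simp: compose_def)
    ultimately show "x \<in> ?orb v" by blast
  qed
  have orb_sym: "v \<in> ?orb w" if v: "v \<in> Vt" and w: "w \<in> ?orb v" for v w
  proof -
    obtain a where a: "a \<in> Lat" "w = a v" using w by blast
    have i: "inv\<^bsub>AutG\<^esub> a \<in> Lat" using subgroup.m_inv_closed[OF Lat_subgroup a(1)] .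
    have "inv\<^bsub>AutG\<^esub> a \<otimes>\<^bsub>AutG\<^esub> a = \<one>\<^bsub>AutG\<^esub>" using group.l_inv[OF Aut_group LatA[OF a(1)]] .
    then have "compose Pt (inv\<^bsub>AutG\<^esub> a) a v = v"
      using Aut_mult[OF LatA[OF i] LatA[OF a(1)]] v Vt_sub_Pt by (auto simp: Aut_one)
    then have "(inv\<^bsub>AutG\<^esub> a) w = v" using v Vt_sub_Pt a(2) by (auto simp: compose_def)
    then show ?thesis using i by blast
  qed
  have orb_eq: "?orb w = ?orb v" if "v \<in> Vt" "w \<in> ?orb v" for v w
    using orb_le[OF that] orb_le[OF _ orb_sym[OF that]] orb_sub[OF that(1)] that(2) by blast
  have disj: "Os = Os'" if OO: "Os \<in> ?Os" "Os' \<in> ?Os" "shadow ` Os \<inter> shadow ` Os' \<noteq> {}" for Os Os'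
  proof -
    obtain v where v1: "v \<in> Vt" "Os = ?orb v" using OO(1) by blast
    obtain v' where v2: "v' \<in> Vt" "Os' = ?orb v'" using OO(2) by blast
    note v = v1 v2
    obtain w w' where w: "w \<in> Os" "w' \<in> Os'" "shadow w = shadow w'" using OO(3) by blast
    have wV: "w \<in> Vt" "w' \<in> Vt" using w v orb_sub by blast+
    obtain \<gamma> where "\<gamma> \<in> Lat" "\<gamma> w = w'" using shadow_same_orbit[OF wV w(3)] by blast
    then have "w' \<in> ?orb w" by blast
    then have "?orb w' = ?orb w" by (rule orb_eq[OF wV(1)])
    moreover have "?orb w = ?orb v" using orb_eq[OF v(1)] w(1) v(2) by blast
    moreover have "?orb w' = ?orb v'" using orb_eq[OF v(3)] w(2) v(4) by blast
    ultimately show ?thesis using v by simp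
  qed
  have ne: "shadow ` Os \<noteq> {}" if "Os \<in> ?Os" for Os using that mem by blast
  have inj: "inj_on ((`) shadow) ?Os"
  proof (rule inj_onI)
    fix Os Os' assume a: "Os \<in> ?Os" "Os' \<in> ?Os" "shadow ` Os = shadow ` Os'"
    then show "Os = Os'" using disj[OF a(1,2)] ne[OF a(1)] by simp
  qed
  have "(`) shadow ` ?Os \<subseteq> Pow shadows" using shadow_in orb_sub by blast
  then have fin: "finite ?Os"
    using inj shadows_finite by (meson finite_Pow_iff finite_imageD finite_subset)
  have cover: "(\<Union>Os\<in>?Os. shadow ` Os) = shadows"
  proof (intro equalityI subsetI)
    fix z assume "z \<in> (\<Union>Os\<in>?Os. shadow ` Os)"
    then show "z \<in> shadows" using shadow_in orb_sub by blast
  next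
    fix z assume "z \<in> shadows"
    then obtain v where "v \<in> Vt" "shadow v = z" using shadow_onto by blast
    then show "z \<in> (\<Union>Os\<in>?Os. shadow ` Os)" using mem[of v] by blast
  qed
  have finO: "finite (shadow ` Os)" if "Os \<in> ?Os" for Os
  proof (rule finite_subset[OF _ shadows_finite])
    show "shadow ` Os \<subseteq> shadows" unfolding cover[symmetric] by (rule UN_upper[OF that])
  qed
  have term_eq: "1 / of_nat (card (stabilizer (AutG\<lparr>carrier := Lat\<rparr>) (\<lambda>g. g) (SOME v'. v' \<in> Os)))
      = ennreal (real (card (shadow ` Os)) / real (card A))" if Os: "Os \<in> ?Os" for Os
  proof -
    obtain v where v: "v \<in> Vt" "Os = ?orb v" using Os by blast
    define w where "w = (SOME v'. v' \<in> Os)"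
    have w: "w \<in> Os" unfolding w_def by (rule someI[of _ v]) (use mem v in simp)
    have wV: "w \<in> Vt" using w v orb_sub by blast
    have "Os = ?orb w" using orb_eq[OF v(1)] w v(2) by blast
    then have c: "card {\<gamma> \<in> Lat. \<gamma> w = w} * card (shadow ` Os) = card A"
      using stabilizer_card(2)[OF wV] by simp
    let ?s = "card {\<gamma> \<in> Lat. \<gamma> w = w}"
    have s: "0 < ?s * card (shadow ` Os)" unfolding c by (rule A_card_pos)
    then have s: "0 < ?s" "0 < card (shadow ` Os)" by (auto intro: gr0I)
    have "real (card (shadow ` Os)) / real (card A) = 1 / real ?s"
      unfolding c[symmetric] of_nat_mult using s by simp
    moreover have "stabilizer (AutG\<lparr>carrier := Lat\<rparr>) (\<lambda>g. g) w = {\<gamma> \<in> Lat. \<gamma> w = w}"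
      by (simp add: stabilizer_def)
    moreover have "(1::ennreal) / of_nat ?s = ennreal (1 / real ?s)"
      using s(1) by (simp add: ennreal_of_nat_eq_real_of_nat divide_ennreal flip: ennreal_1)
    ultimately show ?thesis unfolding w_def[symmetric] by simp
  qed
  have "stabilizer_sum AutG Vt Lat = (\<Sum>Os\<in>?Os. ennreal (real (card (shadow ` Os)) / real (card A)))"
    unfolding stabilizer_sum_def orbits
    by (subst nn_integral_count_space_finite[OF fin]) (rule sum.cong[OF HOL.refl term_eq])
  also have "\<dots> = ennreal (\<Sum>Os\<in>?Os. real (card (shadow ` Os)) / real (card A))"
    by (rule sum_ennreal) simp
  also have "(\<Sum>Os\<in>?Os. real (card (shadow ` Os)) / real (card A)) = real (\<Sum>Os\<in>?Os. card (shadow ` Os)) / real (card A)"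
    by (simp add: sum_divide_distrib)
  also have "(\<Sum>Os\<in>?Os. card (shadow ` Os)) = card (\<Union>Os\<in>?Os. shadow ` Os)"
  proof (rule card_UN_disjoint[symmetric, OF fin])
    show "\<forall>Os\<in>?Os. finite (shadow ` Os)" by (intro ballI finO)
    show "\<forall>Os\<in>?Os. \<forall>Os'\<in>?Os. Os \<noteq> Os' \<longrightarrow> shadow ` Os \<inter> shadow ` Os' = {}"
    proof (intro ballI impI)
      fix Os Os' assume "Os \<in> ?Os" "Os' \<in> ?Os" "Os \<noteq> Os'"
      then show "shadow ` Os \<inter> shadow ` Os' = {}" using disj[of Os Os'] by (metis (no_types))
    qed
  qed
  finally show ?thesis unfolding cover .
qed

lemma finite_transversal:
  "\<exists>D. finite D \<and> D \<subseteq> Vt \<and> (\<forall>v\<in>Vt. \<exists>\<gamma>\<in>Lat. \<gamma> v \<in> D)"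
proof -
  define f where "f z = (SOME v. v \<in> Vt \<and> shadow v = z)" for z
  have f: "f z \<in> Vt \<and> shadow (f z) = z" if z: "z \<in> shadows" for z
  proof -
    have "\<exists>v. v \<in> Vt \<and> shadow v = z" using shadow_onto[OF z] by blast
    then show ?thesis unfolding f_def by (rule someI_ex)
  qed
  have "\<exists>\<gamma>\<in>Lat. \<gamma> v \<in> f ` shadows" if v: "v \<in> Vt" for v
  proof -
    have z: "shadow v \<in> shadows" by (rule shadow_in[OF v])
    obtain \<gamma> where "\<gamma> \<in> Lat" "\<gamma> v = f (shadow v)" using shadow_same_orbit[OF v] f[OF z] by metis
    then show ?thesis using z by blast
  qed
  moreover have "f ` shadows \<subseteq> Vt" using f by blast
  moreover have "finite (f ` shadows)" using shadows_finite by (rule finite_imageI)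
  ultimately show ?thesis by (intro exI[of _ "f ` shadows"]) simp
qed

theorem Lat_uniform_lattice:
  assumes "serre_haar_measure AutG AutX Vt \<mu>"
  shows "uniform_lattice AutG AutX Lat"
    and "covolume AutG \<mu> Lat = ennreal (real (card shadows) / real (card A))"
proof -
  obtain D where D: "finite D" "D \<subseteq> Vt" "\<And>v. v \<in> Vt \<Longrightarrow> \<exists>\<gamma>\<in>Lat. \<gamma> v \<in> D" using finite_transversal by blast
  interpret P: permutation_topology AutG AutX Vt "\<lambda>g. g" by (rule aut_permutation_topology)
  interpret H: permutation_haar AutG AutX Vt "\<lambda>g. g" \<mu>
    by unfold_locales (use assms in \<open>simp add: serre_haar_measure_def\<close>)
  interpret U: cofinite_subgroup AutG AutX Vt "\<lambda>g. g" \<mu> Lat D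
  proof (intro cofinite_subgroup.intro H.permutation_haar_axioms cofinite_subgroup_axioms.intro)
    show "subgroup Lat AutG" by (rule Lat_subgroup)
    show "finite D" "D \<subseteq> Vt" by (rule D)+
    fix v assume v: "v \<in> Vt"
    show "finite {\<gamma> \<in> Lat. \<gamma> v = v}" by (rule stabilizer_card(1)[OF v])
    show "\<exists>\<gamma>\<in>Lat. \<gamma> v \<in> D" by (rule D(3)[OF v])
  qed
  show "uniform_lattice AutG AutX Lat" by (rule U.uniform)
  have "covolume AutG \<mu> Lat = stabilizer_sum AutG Vt Lat"
    using assms U.discrete by (simp add: serre_haar_measure_def)
  then show "covolume AutG \<mu> Lat = ennreal (real (card shadows) / real (card A))"
    by (simp add: stabilizer_sum_Lat)
qed

end

text \<open>Only a factor \<open>p ^ t\<close> of \<open>D\<close> cancels, and \<open>t < D\<close> because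
  \<open>t < p ^ t \<le> D\<close>.\<close>

lemma fraction_with_large_denominator:
  fixes p N D \<alpha> :: nat
  assumes p: "prime p" and D: "0 < D" and N: "0 < N" "coprime N p" "\<alpha> + D \<le> N"
  shows "\<exists>a b :: nat. 0 < a \<and> 0 < b \<and> coprime a b \<and>
    real (N * D) / real (p ^ N) = real a / real b \<and> p ^ \<alpha> dvd b"
proof -
  have p1: "1 < p" using prime_gt_1_nat[OF p] .
  have pN: "0 < p ^ N" using p1 by simp
  define g where "g = gcd (N * D) (p ^ N)"
  have g0: "0 < g" using pN by (simp add: g_def)
  have "g dvd p ^ N" by (simp add: g_def)
  then obtain t where t: "t \<le> N" "g = p ^ t" using divides_primepow_nat[OF p] by blast
  have "coprime (p ^ t) N" using N(2) by (simp add: coprime_commute)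
  moreover have "p ^ t dvd N * D" using t(2) by (metis g_def gcd_dvd1)
  ultimately have "p ^ t dvd D" by (simp add: coprime_dvd_mult_right_iff)
  then have "p ^ t \<le> D" using D dvd_imp_le by blast
  moreover have "t < p ^ t" using power_gt_expt[of p t] p1 by (simp add: One_nat_def)
  ultimately have tD: "t < D" by linarith
  define a b where "a = N * D div g" and "b = p ^ N div g"
  have ga: "a * g = N * D" and gb: "b * g = p ^ N" by (simp_all add: a_def b_def g_def)
  have ab: "0 < a" "0 < b" using ga gb N(1) D pN by (auto intro: gr0I)
  have "coprime a b" unfolding a_def b_def g_def by (rule div_gcd_coprime) (use pN in auto)
  moreover have "real (N * D) / real (p ^ N) = real a / real b"
    using g0 by (simp flip: ga gb)
  moreover have "b = p ^ (N - t)"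
  proof -
    have "b * p ^ t = p ^ (N - t) * p ^ t" using gb t by (simp flip: power_add)
    then show ?thesis using p1 by simp
  qed
  then have "p ^ \<alpha> dvd b" using tD N(3) by (simp add: le_imp_power_dvd)
  ultimately show ?thesis using ab by blast
qed

text \<open>The vertices of type \<open>T\<close> in the quotient are counted by the vectors of colours with
  invariant entries at \<open>T\<close> in each of the \<open>N\<close> copies, which gives
  \<open>D = (\<Sum>T. \<Prod>i\<notin>T. q i)\<close>, summed over the spherical subsets.\<close>

theorem corollary3p22:
  fixes W :: "('w, 'x) monoid_scheme" and s :: "nat \<Rightarrow> 'w"
    and n j :: nat and m :: "nat \<Rightarrow> nat \<Rightarrow> enat" and q :: "nat \<Rightarrow> nat"
    and C :: "'c set" and \<delta> :: "'c \<Rightarrow> 'c \<Rightarrow> 'w" and l :: real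
    and \<mu> :: "('c davis_point \<Rightarrow> 'c davis_point) measure"
    and p \<alpha> :: nat
  assumes "coxeter_system W s n m" and "right_angled n m"
    and "2 \<le> j" and "j \<le> n" and "\<forall>i\<in>{1..j}. free_generator n m i"
    and "\<forall>i\<in>{1..n}. 2 \<le> q i"
    and "regular_building W s n q C \<delta>"
    and "0 < l"
    and "serre_haar_measure (davis_Aut l W s n C \<delta>) (davis_Aut_topology l W s n C \<delta>)
           (davis_vertices W s n C \<delta>) \<mu>"
    and "prime p" and "p < Max (q ` {1..j})"
  shows "\<exists>\<Gamma>. uniform_lattice (davis_Aut l W s n C \<delta>) (davis_Aut_topology l W s n C \<delta>) \<Gamma> \<and>
           (\<exists>a b :: nat. 0 < a \<and> 0 < b \<and> coprime a b \<and>
              covolume (davis_Aut l W s n C \<delta>) \<mu> \<Gamma> = ennreal (real a / real b) \<and>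
              p ^ \<alpha> dvd b)"
proof -
  interpret davis W s n m q C \<delta> l by unfold_locales (fact assms)+
  have "Max (q ` {1..j}) \<in> q ` {1..j}" using assms(3) by (intro Max_in) auto
  then obtain u where u: "u \<in> {1..j}" "p < q u" using assms(11) by auto
  define v where "v = (if u = 1 then 2 else 1 :: nat)"
  have v: "v \<in> {1..j}" "u \<noteq> v" using assms(3) by (auto simp: v_def)
  have uvI: "u \<in> {1..n}" "v \<in> {1..n}" using u v assms(4) by auto
  have free: "\<not> indep i w" "\<not> indep w i" if "w = u \<or> w = v" "i \<in> {1..n}" for i w
  proof -
    have w: "w \<in> {1..n}" "free_generator n m w" using that(1) u v uvI assms(5) by auto
    show "\<not> indep i w"
    proof (cases "i = w")
      case False
      then have "m i w = \<infinity>" using w(2) that(2) unfolding free_generator_def by blast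
      then show ?thesis using dep_iff[OF that(2) w(1)] by blast
    qed (simp add: noncommuting_def)
    then show "\<not> indep w i" using noncommuting_sym by blast
  qed
  define D where "D = (\<Sum>T\<in>Sph. \<Prod>i\<in>{1..n} - T. q i)"
  \<comment> \<open>The summand \<open>1\<close> makes \<open>N\<close> coprime to \<open>p\<close>; the size absorbs the cancellation against \<open>D\<close>.\<close>
  define N where "N = p * (\<alpha> + D) + 1"
  have p0: "0 < p" using prime_gt_0_nat assms(10) .
  interpret Tw: twisted_cubes "{1..n}" q indep u v p N
  proof
    show "0 < p" "p < q u" by (rule p0, rule u(2))
    show "2 \<le> q v" using assms(6) uvI(2) by blast
    show "0 < N" by (simp add: N_def)
    show "0 < q i" if "i \<in> {1..n}" for i using q_pos[OF that] .
    fix i k assume ik: "i \<in> {1..n}" "k \<in> {1..n}" "indep i k"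
    show "i \<noteq> k \<and> i \<noteq> u \<and> i \<noteq> v \<and> k \<noteq> u \<and> k \<noteq> v"
    proof (intro conjI notI)
      show False if "i = k" using ik(3) that by (simp add: noncommuting_def)
      show False if "i = u" using free(2)[of u k] ik that by blast
      show False if "i = v" using free(2)[of v k] ik that by blast
      show False if "k = u" using free(1)[of u i] ik that by blast
      show False if "k = v" using free(1)[of v i] ik that by blast
    qed
  qed (use uvI v(2) in auto)
  obtain col where col: "proper_colouring {1..n} q C adj col" using proper_colouring_exists by blast
  obtain c0 where c0: "c0 \<in> C" using chambers_nonempty by blast
  let ?x0 = "(0, restrict (col c0) {1..n})"
  have x0: "?x0 \<in> Tw.cells"
    unfolding Tw.cells_iff using Tw.N proper_colouringD(1)[OF col _ c0] by (simp add: PiE_iff)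
  obtain \<kappa> where \<kappa>: "colour_morphism {1..n} C adj col Tw.cells Tw.near snd \<kappa>"
    using colour_morphism_exists[OF col Tw.cells_system Tw.cells_colouring c0 x0] by auto
  note cD = proper_colouringD[OF col] and TD = proper_colouringD[OF Tw.cells_colouring]
    and XD = chamber_systemD[OF Tw.cells_system] and kD = colour_morphismD[OF \<kappa>]
  have onto: "\<kappa> ` C = Tw.cells"
  proof (rule Tw.cells_connected)
    show "\<kappa> ` C \<subseteq> Tw.cells" using kD(1) by blast
    show "\<kappa> ` C \<noteq> {}" using c0 by blast
    fix i y z assume i: "i \<in> {1..n}" and y: "y \<in> \<kappa> ` C" and yz: "Tw.near i y z"
    obtain c where c: "c \<in> C" "y = \<kappa> c" using y by blast
    obtain d where d: "adj i c d" "col d i = snd z i"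
      using cD(2)[OF i c(1) TD(1)[OF i XD(2)[OF i yz]]] by blast
    have dC: "d \<in> C" using adj_closed(2)[OF d(1)] .
    have "Tw.near i (\<kappa> d) z" using XD(3,5)[OF i] kD(3)[OF i d(1)] yz c(2) by blast
    moreover have "snd (\<kappa> d) i = snd z i" using kD(2)[OF dC i] d(2) by simp
    ultimately have "\<kappa> d = z" using TD(3)[OF i] by blast
    then show "z \<in> \<kappa> ` C" using dC by blast
  qed
  have finite_sym: "finite Tw.symmetries"
    using Tw.card_symmetries p0 by (intro card_ge_0_finite) simp
  interpret L: davis_lifts W s n m q C \<delta> Tw.cells Tw.near snd Tw.symmetries col \<kappa> l Tw.base_colour
  proof (intro davis_lifts.intro lifted_symmetries.intro lifted_symmetries_axioms.intro davis_lifts_axioms.intro)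
    show "ra_building W s n m q C \<delta>" by unfold_locales
    show "davis W s n m q C \<delta> l" by unfold_locales
    show "chamber_system {1..n} indep Tw.cells Tw.near" by (rule Tw.cells_system)
    show "proper_colouring {1..n} q Tw.cells Tw.near snd" by (rule Tw.cells_colouring)
    show "\<exists>a\<in>Tw.symmetries. \<forall>y\<in>Tw.cells. a y = y" by (rule Tw.symmetries_one)
    show "proper_colouring {1..n} q C adj col" by (rule col)
    show "colour_morphism {1..n} C adj col Tw.cells Tw.near snd \<kappa>" by (rule \<kappa>)
    show "\<kappa> ` C = Tw.cells" by (rule onto)
    show "finite Tw.cells" by (rule Tw.finite_cells)
    show "finite Tw.symmetries" by (rule finite_sym)
    show "Tw.base_colour i < q i" if "i \<in> {1..n}" for i by (rule Tw.base_colour_less[OF that])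
    fix a assume a: "a \<in> Tw.symmetries"
    show "a y \<in> Tw.cells" if "y \<in> Tw.cells" for y by (rule Tw.symmetries_closed[OF a that])
    show "Tw.near i (a y) (a z)" if "Tw.near i y z" for i y z by (rule Tw.symmetries_near[OF a that])
    show "\<exists>b\<in>Tw.symmetries. \<forall>y\<in>Tw.cells. a (b y) = y \<and> b (a y) = y" by (rule Tw.symmetries_inv[OF a])
    show "snd (a y) i = Tw.base_colour i \<longleftrightarrow> snd y i = Tw.base_colour i" if "y \<in> Tw.cells" for y i
      by (rule Tw.symmetries_base_colour[OF a that])
    fix b assume b: "b \<in> Tw.symmetries"
    show "\<exists>c\<in>Tw.symmetries. \<forall>y\<in>Tw.cells. c y = a (b y)" by (rule Tw.symmetries_mult[OF a b])
    show "a = b" if "\<And>y. y \<in> Tw.cells \<Longrightarrow> a y = b y"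
      by (rule extensionalityI[OF Tw.symmetries_extensional[OF a] Tw.symmetries_extensional[OF b] that])
  qed
  have cardA: "card Tw.symmetries = p ^ N" by (rule Tw.card_symmetries)
  have "card L.shadows = (\<Sum>T\<in>Sph. card {y \<in> Tw.cells. \<forall>i\<in>T. snd y i = Tw.base_colour i})"
    unfolding L.shadows_def using finite_spherical_subsets Tw.finite_cells by (subst card_SigmaI) auto
  also have "\<dots> = (\<Sum>T\<in>Sph. N * (\<Prod>i\<in>{1..n} - T. q i))"
    by (rule sum.cong[OF HOL.refl]) (rule Tw.card_base_coloured[OF Sph_sub_I])
  finally have cardS: "card L.shadows = N * D" by (simp add: D_def sum_distrib_left)
  have "0 < (\<Prod>i\<in>{1..n} - {}. q i)" using q_pos by (intro prod_pos) simp
  also have "\<dots> \<le> D"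
    unfolding D_def by (rule member_le_sum[OF empty_spherical]) (use finite_spherical_subsets in auto)
  finally have D0: "0 < D" .
  have "coprime N p"
  proof (rule coprimeI)
    fix d assume d: "d dvd N" "d dvd p"
    then have "d dvd p * (\<alpha> + D)" by simp
    then show "is_unit d" using d(1) unfolding N_def by (simp only: dvd_add_right_iff)
  qed
  moreover have "\<alpha> + D \<le> N" using p0 unfolding N_def by (simp add: trans_le_add1)
  ultimately obtain a b :: nat where "0 < a" "0 < b" "coprime a b"
    "real (N * D) / real (p ^ N) = real a / real b" "p ^ \<alpha> dvd b"
    using fraction_with_large_denominator[OF assms(10) D0 Tw.N] by blast
  then show ?thesis
    using L.Lat_uniform_lattice[OF assms(9)] unfolding cardA cardS by metis
qed

end
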